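(* Let $0\le a<b$ and let $m\ge1$ be an integer. For $\sigma\ge 1$ let $\hat{\mathcal B}^{(\sigma)}_{[a,b)}$ be the normalized quantum Lévy area of variance parameter $\sigma$ over $[a,b)$. Then $$\lim_{\sigma\to\infty}\mathbb E\Big[\big(\hat{\mathcal B}^{(\sigma)}_{[a,b)}\big)^{2m}\Big]=\left(\frac{b-a}{2}\right)^{2m}A_{2m},$$ where $A_{2m}$ is the Euler zigzag number.
   Context: Quantum planar Brownian motion. For $\sigma\ge1$, $(P^{(\sigma)}(t),Q^{(\sigma)}(t))_{t\ge0}$ is a pair of self-adjoint operator-valued processes, each individually a Brownian motion of variance $\sigma^2$, with $[P^{(\sigma)}(s),Q^{(\sigma)}(t)]=-2i\min\{s,t\}$ (in the Weyl sense) and Itô multiplication $(dP^{(\sigma)})^2=(dQ^{(\sigma)})^2=\sigma^2dT$, $dP^{(\sigma)}dQ^{(\sigma)}=-i\,dT$, $dQ^{(\sigma)}dP^{(\sigma)}=i\,dT$, all products involving $dT$ being $0$ ($T(x)=x$ is time). Concretely, let $\mathcal F$ be the symmetric Fock space over $L^2(\mathbb R_+)$ with annihilation and creation processes $A(t),A^\dagger(t)$ (those of the indicator function $1_{[0,t)}$), let $c_\pm=\sqrt{\tfrac12(\sigma^2\pm1)}$, and on $\mathcal F\otimes\mathcal F$ set $$Q^{(\sigma)}=c_+\,(A+A^\dagger)\otimes I+c_-\,I\otimes(A+A^\dagger),\qquad P^{(\sigma)}=c_+\,(-i)(A-A^\dagger)\otimes I+c_-\,I\otimes i(A-A^\dagger).$$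 The expectation $\mathbb E$ is $\mathbb E[X]=\langle\Omega,X\Omega\rangle$ with $\Omega$ the tensor product of the two Fock vacuum vectors. All operators are considered on finite-particle vectors. Quantum Lévy area. The quantum Lévy area over $[a,b)$ is the Itô-type quantum stochastic integral $$\mathcal B^{(\sigma)}_{[a,b)}=\tfrac12\int_a^b\Big((P^{(\sigma)}-P^{(\sigma)}(a))\,dQ^{(\sigma)}-(Q^{(\sigma)}-Q^{(\sigma)}(a))\,dP^{(\sigma)}\Big),$$ that is, the limit over partitions $a=t_0<\dots<t_N=b$ with mesh tending to $0$ of $\tfrac12\sum_j\big((P^{(\sigma)}(t_j)-P^{(\sigma)}(a))(Q^{(\sigma)}(t_{j+1})-Q^{(\sigma)}(t_j))-(Q^{(\sigma)}(t_j)-Q^{(\sigma)}(a))(P^{(\sigma)}(t_{j+1})-P^{(\sigma)}(t_j))\big)$, taken on finite-particle vectors. The normalized quantum Lévy area is $\hat{\mathcal B}^{(\sigma)}_{[a,b)}=\sigma^{-2}\mathcal B^{(\sigma)}_{[a,b)}$. The Euler zigzag number $A_n$ is the number of permutations $\mathfrak s$ of $\{1,\dots,n\}$ with $\mathfrak s(1)>\mathfrak s(2)<\mathfrak s(3)>\mathfrak s(4)<\cdots$. *)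

theory Defs
  imports "HOL-Analysis.Analysis" "HOL-Library.Multiset" "HOL-Combinatorics.Permutations"
begin

section \<open>Symmetric Fock space over the square-integrable functions on the half-line\<close>

text \<open>
  The symmetric Fock space is the Hilbert sum over n of the symmetric square-integrable functions
  of n variables in the half-line.  A symmetric function of n variables is the same as a function
  on multisets of size n, so a Fock vector is represented by one function on finite multisets,
  whose n-particle component is its restriction to multisets of size n.  Under the canonical
  identification of the tensor product of two L2 spaces with the L2 space of the product measure,
  a vector of the (completed) tensor square of the Fock space is a function of two multisets.
  Vectors are represented by functions, i.e. up to equality almost everywhere on each component.
\<close>

type_synonym fock = "real multiset \<Rightarrow> complex"
type_synonym fock2 = "real multiset \<Rightarrow> real multiset \<Rightarrow> complex"

definition half_line :: "real measure" where
  "half_line = restrict_space lborel {0..}"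

definition config :: "nat \<Rightarrow> (nat \<Rightarrow> real) \<Rightarrow> real multiset" where
  "config n x = image_mset x (mset_set {..<n})"

definition particle_measure :: "nat \<Rightarrow> nat \<Rightarrow> ((nat \<Rightarrow> real) \<times> (nat \<Rightarrow> real)) measure" where
  "particle_measure n k =
     (Pi\<^sub>M {..<n} (\<lambda>_. half_line)) \<Otimes>\<^sub>M (Pi\<^sub>M {..<k} (\<lambda>_. half_line))"

definition component :: "nat \<Rightarrow> nat \<Rightarrow> fock2 \<Rightarrow> (nat \<Rightarrow> real) \<times> (nat \<Rightarrow> real) \<Rightarrow> complex" where
  "component n k \<psi> = (\<lambda>(x, y). \<psi> (config n x) (config k y))"

definition fock_inner :: "fock2 \<Rightarrow> fock2 \<Rightarrow> complex" where
  "fock_inner \<phi> \<psi> =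
     (\<Sum>\<^sub>\<infinity>(n, k)\<in>UNIV. \<integral>z. cnj (component n k \<phi> z) * component n k \<psi> z \<partial>particle_measure n k)"

definition fock_norm :: "fock2 \<Rightarrow> real" where
  "fock_norm \<psi> = sqrt (Re (fock_inner \<psi> \<psi>))"

definition finite_particle :: "fock2 set" where
  "finite_particle = {\<psi>.
     (\<forall>n k. component n k \<psi> \<in> borel_measurable (particle_measure n k) \<and>
            integrable (particle_measure n k) (\<lambda>z. (norm (component n k \<psi> z))\<^sup>2)) \<and>
     (\<exists>K. \<forall>M N. size M + size N > K \<longrightarrow> \<psi> M N = 0)}"

definition vacuum :: fock2 where
  "vacuum M N = (if M = {#} \<and> N = {#} then 1 else 0)"

definition vacuum_expectation :: "(fock2 \<Rightarrow> fock2) \<Rightarrow> complex" where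
  "vacuum_expectation X = fock_inner vacuum (X vacuum)"


section \<open>Creation and annihilation operators\<close>

definition annihilation :: "(real \<Rightarrow> complex) \<Rightarrow> fock \<Rightarrow> fock" where
  "annihilation f \<psi> M =
     of_real (sqrt (real (size M + 1))) * (\<integral>x. cnj (f x) * \<psi> (add_mset x M) \<partial>half_line)"

text \<open>On the vacuum component the sum below is empty, so the division by zero is harmless.\<close>

definition creation :: "(real \<Rightarrow> complex) \<Rightarrow> fock \<Rightarrow> fock" where
  "creation f \<psi> M =
     (\<Sum>x\<in>#M. f x * \<psi> (M - {#x#})) / of_real (sqrt (real (size M)))"

definition ann_proc :: "real \<Rightarrow> fock \<Rightarrow> fock" where
  "ann_proc t = annihilation (indicator {0..<t})"

definition cre_proc :: "real \<Rightarrow> fock \<Rightarrow> fock" where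
  "cre_proc t = creation (indicator {0..<t})"

definition tensor_left :: "(fock \<Rightarrow> fock) \<Rightarrow> fock2 \<Rightarrow> fock2" \<comment> \<open>X tensor I\<close> where
  "tensor_left X \<psi> = (\<lambda>M N. X (\<lambda>M'. \<psi> M' N) M)"

definition tensor_right :: "(fock \<Rightarrow> fock) \<Rightarrow> fock2 \<Rightarrow> fock2" \<comment> \<open>I tensor X\<close> where
  "tensor_right X \<psi> = (\<lambda>M N. X (\<psi> M) N)"


section \<open>Quantum planar Brownian motion\<close>

definition c_plus :: "real \<Rightarrow> real" where
  "c_plus \<sigma> = sqrt ((\<sigma>\<^sup>2 + 1) / 2)"

definition c_minus :: "real \<Rightarrow> real" where
  "c_minus \<sigma> = sqrt ((\<sigma>\<^sup>2 - 1) / 2)"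

definition Q_proc :: "real \<Rightarrow> real \<Rightarrow> fock2 \<Rightarrow> fock2" where
  "Q_proc \<sigma> t \<psi> M N =
     of_real (c_plus \<sigma>) * tensor_left (\<lambda>\<xi> L. ann_proc t \<xi> L + cre_proc t \<xi> L) \<psi> M N
   + of_real (c_minus \<sigma>) * tensor_right (\<lambda>\<xi> L. ann_proc t \<xi> L + cre_proc t \<xi> L) \<psi> M N"

definition P_proc :: "real \<Rightarrow> real \<Rightarrow> fock2 \<Rightarrow> fock2" where
  "P_proc \<sigma> t \<psi> M N =
     of_real (c_plus \<sigma>) * tensor_left (\<lambda>\<xi> L. - \<i> * (ann_proc t \<xi> L - cre_proc t \<xi> L)) \<psi> M N
   + of_real (c_minus \<sigma>) * tensor_right (\<lambda>\<xi> L. \<i> * (ann_proc t \<xi> L - cre_proc t \<xi> L)) \<psi> M N"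


section \<open>Quantum Levy area\<close>

definition incr :: "(real \<Rightarrow> fock2 \<Rightarrow> fock2) \<Rightarrow> real \<Rightarrow> real \<Rightarrow> fock2 \<Rightarrow> fock2" where
  "incr X s t \<psi> = (\<lambda>M N. X t \<psi> M N - X s \<psi> M N)"

definition is_partition :: "real \<Rightarrow> real \<Rightarrow> nat \<Rightarrow> (nat \<Rightarrow> real) \<Rightarrow> bool" where
  "is_partition a b n t \<longleftrightarrow> t 0 = a \<and> t n = b \<and> (\<forall>j<n. t j < t (Suc j))"

definition levy_sum :: "real \<Rightarrow> real \<Rightarrow> nat \<Rightarrow> (nat \<Rightarrow> real) \<Rightarrow> fock2 \<Rightarrow> fock2" where
  "levy_sum \<sigma> a n t \<psi> = (\<lambda>M N. (1/2) * (\<Sum>j<n.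
       incr (P_proc \<sigma>) a (t j) (incr (Q_proc \<sigma>) (t j) (t (Suc j)) \<psi>) M N
     - incr (Q_proc \<sigma>) a (t j) (incr (P_proc \<sigma>) (t j) (t (Suc j)) \<psi>) M N))"

definition levy_limit :: "real \<Rightarrow> real \<Rightarrow> real \<Rightarrow> fock2 \<Rightarrow> fock2 \<Rightarrow> bool" where
  "levy_limit \<sigma> a b \<psi> \<phi> \<longleftrightarrow>
     (\<forall>\<epsilon>>0. \<exists>\<delta>>0. \<forall>n t. is_partition a b n t \<and> (\<forall>j<n. t (Suc j) - t j < \<delta>) \<longrightarrow>
        fock_norm (\<lambda>M N. levy_sum \<sigma> a n t \<psi> M N - \<phi> M N) < \<epsilon>)"

text \<open>
  The limit is determined only up to equality almost everywhere on each component; the choice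
  operator picks a representative, and inner products do not depend on it.
\<close>

definition levy_area :: "real \<Rightarrow> real \<Rightarrow> real \<Rightarrow> fock2 \<Rightarrow> fock2" where
  "levy_area \<sigma> a b \<psi> = (SOME \<phi>. \<phi> \<in> finite_particle \<and> levy_limit \<sigma> a b \<psi> \<phi>)"

definition normalized_levy_area :: "real \<Rightarrow> real \<Rightarrow> real \<Rightarrow> fock2 \<Rightarrow> fock2" where
  "normalized_levy_area \<sigma> a b \<psi> = (\<lambda>M N. levy_area \<sigma> a b \<psi> M N / of_real (\<sigma>\<^sup>2))"


section \<open>Euler zigzag numbers\<close>

definition zigzag :: "nat \<Rightarrow> nat" where
  "zigzag n = card {s. s permutes {1..n} \<and>
     (\<forall>i\<in>{1..<n}. if odd i then s i > s (Suc i) else s i < s (Suc i))}"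

end

theory Submission
  imports Defs "HOL-Computational_Algebra.Formal_Power_Series"
begin

text \<open>The argument replaces the Levy area by an explicit quadratic operator, and then solves the
evolution of the vacuum under that operator in closed form.

Put \<open>K x y = sgn (y - x)\<close> on the square of the interval \<open>[a, b)\<close>, and \<open>L = b - a\<close>. In terms of the modes
\<open>lower = c_plus A \<otimes> I + c_minus I \<otimes> A*\<close> and its adjoint \<open>raise\<close> one has \<open>Q = lower + raise\<close> and
\<open>P = -i (lower - raise)\<close>. In a term of a Levy sum the two factors live on disjoint intervals, so that
normal ordering leaves no constant behind, and the whole sum is exactly \<open>i\<close> times a quadratic operator
(\<open>levy_op\<close>: hopping on either side, creation and annihilation of a left-right pair) whose kernel is a
step function approximating \<open>K\<close> (\<open>levy_sum_to_fock\<close>). The approximation fails only close to the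
diagonal; dominated convergence gives the limit in the Fock norm (\<open>levy_op_small\<close>), and the limit is
unique almost everywhere (\<open>levy_limit_unique\<close>). All operators respect equality almost everywhere
(\<open>regular_levy_sum\<close>), hence powers of the Levy area on the vacuum are, up to null sets, powers of the
explicit operator.

For the vacuum moments let \<open>D\<close> be this operator divided by \<open>\<sigma>\<^sup>2\<close> and by \<open>i\<close>, and let \<open>C p\<close> create a pair
with kernel \<open>K ^ p\<close>. The hopping coefficients of \<open>D\<close> add up to 1 and the coefficient of the pair terms is
\<open>g = c_plus c_minus / \<sigma>\<^sup>2\<close>. The commutation relations show that
\<open>exp (z D) vacuum = G(z) exp (\<Sum>p. \<eta> p z^p C p) vacuum\<close>, where \<open>h(s) = \<Sum>p. \<eta> p s^p\<close> solves the Riccati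
equation \<open>h' = g + h + g h^2\<close> and \<open>G'/G = (\<Sum>p. g \<eta> p tr (K ^ (p+1)) z^p)\<close>. This is proved coefficient by
coefficient (\<open>lift_hop_rule\<close>), and the vacuum component of the result is a recursion for the moments
(\<open>taylor_vacuum_component\<close>) whose solution depends continuously on \<open>g\<close>.

As \<open>\<sigma>\<close> tends to infinity, \<open>g\<close> tends to 1/2, and there \<open>h(s) = 1 / (1 - s/2) - 1\<close>. The powers of \<open>K\<close> are
explicit because \<open>K\<close> is a convolution with an antiperiodic function; up to a factor their traces are
the coefficients of the hyperbolic tangent (\<open>kernel_trace_eq\<close>). Up to signs the recursion therefore
becomes \<open>sec' = sec tan\<close>, together with \<open>tan' = 1 + tan^2\<close>. The zigzag numbers satisfy the same
recursion, by cutting an alternating permutation at its minimum (\<open>zigzag_rec\<close>).\<close>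

section \<open>Zigzag numbers\<close>

definition alternating :: "'a::linorder list \<Rightarrow> bool" where
  "alternating xs \<longleftrightarrow> (\<forall>i. Suc i < length xs \<longrightarrow> (if even i then xs ! i > xs ! Suc i else xs ! i < xs ! Suc i))"

definition alternations :: "'a::linorder set \<Rightarrow> 'a list set" where
  "alternations S = {xs. set xs = S \<and> distinct xs \<and> alternating xs}"

lemma finite_alternations: "finite S \<Longrightarrow> finite (alternations S)"
  by (rule finite_subset[of _ "{xs. set xs \<subseteq> S \<and> length xs \<le> card S}"])
     (auto simp: alternations_def distinct_card[symmetric] intro: finite_lists_length_le)

lemma zigzag_eq_card_alternations: "zigzag n = card (alternations {1..n})"
proof -
  let ?P = "{s. s permutes {1..n} \<and> (\<forall>i\<in>{1..<n}. if odd i then s i > s (Suc i) else s i < s (Suc i))}"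
  let ?f = "\<lambda>s::nat \<Rightarrow> nat. map (\<lambda>i. s (Suc i)) [0..<n]"
  have "bij_betw ?f ?P (alternations {1..n})"
  proof (rule bij_betwI')
    fix s t assume st: "s \<in> ?P" "t \<in> ?P"
    show "(?f s = ?f t) = (s = t)"
    proof
      assume eq: "?f s = ?f t"
      show "s = t"
      proof
        fix x show "s x = t x"
        proof (cases "x \<in> {1..n}")
          case True
          then have "?f s ! (x - 1) = s x" "?f t ! (x - 1) = t x" by auto
          then show ?thesis using eq by metis
        next
          case False then show ?thesis using st by (auto simp: permutes_def)
        qed
      qed
    qed simp
  next
    fix s assume s: "s \<in> ?P"
    then have p: "s permutes {1..n}" by simp
    have "set (?f s) = s ` {1..n}"
      by (auto simp: image_iff) (metis One_nat_def Suc_le_lessD Suc_pred atLeast0LessThan diff_le_self lessThan_iff less_eq_Suc_le not_less_eq_eq)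
    moreover have "distinct (?f s)" using permutes_inj[OF p] by (auto simp: distinct_map inj_on_def dest: injD)
    moreover have "alternating (?f s)" using s unfolding alternating_def
      by (auto split: if_splits)
    ultimately show "?f s \<in> alternations {1..n}"
      using permutes_image[OF p] by (simp add: alternations_def)
  next
    fix xs assume xs: "xs \<in> alternations {1..n}"
    then have len: "length xs = n" by (auto simp: alternations_def dest: distinct_card)
    define s where "s = (\<lambda>i. if i \<in> {1..n} then xs ! (i - 1) else i)"
    have "bij_betw s {1..n} {1..n}"
    proof -
      have "bij_betw (\<lambda>i. i - 1) {1..n} {..<n}"
        by (rule bij_betwI[where g=Suc]) auto
      moreover have "bij_betw ((!) xs) {..<n} {1..n}"
        using xs len by (auto simp: alternations_def intro: bij_betw_nth)
      ultimately have "bij_betw ((!) xs \<circ> (\<lambda>i. i - 1)) {1..n} {1..n}" by (rule bij_betw_trans)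
      then show ?thesis by (rule bij_betw_cong[THEN iffD1, rotated]) (auto simp: s_def)
    qed
    then have "s permutes {1..n}" by (rule bij_imp_permutes) (auto simp: s_def)
    moreover have "\<forall>i\<in>{1..<n}. if odd i then s i > s (Suc i) else s i < s (Suc i)"
    proof
      fix i assume i: "i \<in> {1..<n}"
      then obtain j where j: "i = Suc j" by (cases i) auto
      have "if even j then xs ! j > xs ! Suc j else xs ! j < xs ! Suc j"
        using xs i j len by (simp add: alternations_def alternating_def)
      then show "if odd i then s i > s (Suc i) else s i < s (Suc i)"
        using i j by (auto simp: s_def)
    qed
    moreover have "xs = ?f s" using len by (auto intro!: nth_equalityI simp: s_def)
    ultimately show "\<exists>s\<in>?P. xs = ?f s" by blast
  qed
  then show ?thesis unfolding zigzag_def by (rule bij_betw_same_card)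
qed

text \<open>Alternation depends on the relative order of the letters only, so that it is transported along the
increasing enumeration of the alphabet.\<close>

lemma card_alternations_cong:
  fixes S :: "nat set"
  assumes "finite S"
  shows "card (alternations S) = zigzag (card S)"
proof -
  obtain h where h: "strict_mono_on {1..card S} h" "h ` {1..card S} = S"
  proof -
    let ?h = "\<lambda>i. sorted_list_of_set S ! (i - 1)"
    have mono: "strict_mono_on {1..card S} ?h"
    proof (rule strict_mono_onI)
      fix r s assume "r \<in> {1..card S}" "s \<in> {1..card S}" "r < s"
      then have "r - 1 < s - 1" "s - 1 < length (sorted_list_of_set S)" by auto
      then show "?h r < ?h s"
        using sorted_wrt_nth_less[OF strict_sorted_list_of_set] by blast
    qed
    then have "card (?h ` {1..card S}) = card S"
      by (simp add: card_image strict_mono_on_imp_inj_on)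
    moreover have "?h ` {1..card S} \<subseteq> S"
    proof safe
      fix i assume "i \<in> {1..card S}"
      then have "?h i \<in> set (sorted_list_of_set S)" by (intro nth_mem) auto
      then show "?h i \<in> S" using assms by simp
    qed
    ultimately have "?h ` {1..card S} = S" using assms by (intro card_subset_eq) auto
    with mono show ?thesis by (rule that)
  qed
  have inj: "inj_on h {1..card S}" using h(1) by (rule strict_mono_on_imp_inj_on)
  have mono: "h x < h y \<longleftrightarrow> x < y" if "x \<in> {1..card S}" "y \<in> {1..card S}" for x y
    using strict_mono_on_less[OF h(1)] that by blast
  have alt: "alternating (map h xs) \<longleftrightarrow> alternating xs" if "set xs \<subseteq> {1..card S}" for xs
    unfolding alternating_def length_map
  proof (intro all_cong)
    fix i assume i: "Suc i < length xs"
    then have "xs ! i \<in> {1..card S}" "xs ! Suc i \<in> {1..card S}" using that nth_mem by (metis Suc_lessD subsetD)+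
    then show "(if even i then map h xs ! Suc i < map h xs ! i else map h xs ! i < map h xs ! Suc i) =
         (if even i then xs ! Suc i < xs ! i else xs ! i < xs ! Suc i)"
      using i mono by simp
  qed
  have "bij_betw (map h) (alternations {1..card S}) (alternations S)"
  proof (rule bij_betw_imageI)
    show "inj_on (map h) (alternations {1..card S})"
      by (rule inj_on_mapI) (rule inj_on_subset[OF inj], auto simp: alternations_def)
    show "map h ` alternations {1..card S} = alternations S"
    proof safe
      fix xs assume "xs \<in> alternations {1..card S}"
      then show "map h xs \<in> alternations S"
        using h(2) inj alt[of xs] by (auto simp: alternations_def distinct_map)
    next
      fix ys assume ys: "ys \<in> alternations S"
      then have "set ys \<subseteq> h ` {1..card S}" using h by (auto simp: alternations_def)
      define xs where "xs = map (inv_into {1..card S} h) ys"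
      have xs: "set xs \<subseteq> {1..card S}" "ys = map h xs"
        using \<open>set ys \<subseteq> h ` {1..card S}\<close> unfolding xs_def
        by (auto simp: inv_into_into f_inv_into_f subset_iff intro!: nth_equalityI simp del: atLeastAtMost_iff)
      have "set xs = {1..card S}"
      proof -
        have "h ` set xs = h ` {1..card S}" using ys xs h by (simp add: alternations_def)
        then show ?thesis using inj_on_image_eq_iff[OF inj xs(1) order_refl] by simp
      qed
      then have "xs \<in> alternations {1..card S}" using ys xs alt[of xs]
        by (auto simp: alternations_def distinct_map)
      then show "ys \<in> map h ` alternations {1..card S}" using xs by blast
    qed
  qed
  then show ?thesis by (simp add: zigzag_eq_card_alternations bij_betw_same_card)
qed

text \<open>The least letter can only be entered by a descent and left by an ascent; as descents and ascents
take turns, this fixes the parity of its position, and the word after it starts with a descent again.\<close>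

lemma alternating_append_min:
  fixes z :: "'a::linorder"
  assumes "\<And>x. x \<in> set us \<Longrightarrow> z < x" "\<And>x. x \<in> set vs \<Longrightarrow> z < x" "us @ vs \<noteq> []"
  shows "alternating (us @ z # vs) \<longleftrightarrow> odd (length us) \<and> alternating us \<and> alternating vs"
proof
  assume A: "alternating (us @ z # vs)"
  have odd: "odd (length us)"
  proof (rule ccontr)
    assume e: "\<not> odd (length us)"
    show False
    proof (cases "us = []")
      case True
      then have "vs \<noteq> []" using assms(3) by simp
      then obtain v vs' where v: "vs = v # vs'" by (cases vs) auto
      have "z > v" using A[unfolded alternating_def, rule_format, of 0] True v by simp
      then show False using assms(2)[of v] v by simp
    next
      case False
      then obtain i where i: "length us = Suc i" by (cases us) auto
      have "us ! i < z" using A[unfolded alternating_def, rule_format, of i] i e by (simp add: nth_append)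
      then show False using assms(1)[of "us ! i"] i by simp
    qed
  qed
  moreover have "alternating us"
    unfolding alternating_def
  proof (intro allI impI)
    fix i assume i: "Suc i < length us"
    then have i': "i < length us" by simp
    show "if even i then us ! Suc i < us ! i else us ! i < us ! Suc i"
      using A[unfolded alternating_def, rule_format, of i] i i' by (cases "even i") (simp_all add: nth_append_left)
  qed
  moreover have "alternating vs"
    unfolding alternating_def
  proof (intro allI impI)
    fix i assume "Suc i < length vs"
    then show "if even i then vs ! Suc i < vs ! i else vs ! i < vs ! Suc i"
      using A[unfolded alternating_def, rule_format, of "length us + Suc i"] odd by (cases "even i") (simp_all add: nth_append)
  qed
  ultimately show "odd (length us) \<and> alternating us \<and> alternating vs" by simp
next
  assume B: "odd (length us) \<and> alternating us \<and> alternating vs"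
  show "alternating (us @ z # vs)" unfolding alternating_def
  proof (intro allI impI)
    fix i assume i: "Suc i < length (us @ z # vs)"
    consider "Suc i < length us" | "Suc i = length us" | "i = length us" | j where "i = length us + Suc j"
      by (metis add_Suc_right less_iff_Suc_add linorder_neqE_nat not_less_eq)
    then show "if even i then (us @ z # vs) ! Suc i < (us @ z # vs) ! i else (us @ z # vs) ! i < (us @ z # vs) ! Suc i"
    proof cases
      case 1
      then have "i < length us" by simp
      then show ?thesis using B 1 by (simp add: alternating_def nth_append_left)
    next
      case 2 
      then have "even i" using B by (metis even_Suc)
      moreover have "us ! i \<in> set us" using 2 by simp
      ultimately show ?thesis using assms(1) 2 by (simp add: nth_append)
    next
      case 3 then show ?thesis using B i assms(2) by (auto simp: nth_append)
    next
      case 4 then show ?thesis using B i by (simp add: alternating_def nth_append)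
    qed
  qed
qed

lemma zigzag_0: "zigzag 0 = 1" 
proof -
  have "alternations {1..0::nat} = {[]}" by (auto simp: alternations_def alternating_def)
  then show ?thesis by (simp add: zigzag_eq_card_alternations)
qed
lemma zigzag_1: "zigzag (Suc 0) = 1"
proof -
  have "alternations {1..Suc 0} = {[1]}"
  proof -
    have "xs = [1]" if "set xs = {Suc 0}" "distinct xs" for xs :: "nat list"
      using that by (cases xs; cases "tl xs") auto
    then show ?thesis by (auto simp: alternations_def alternating_def)
  qed
  then show ?thesis by (simp add: zigzag_eq_card_alternations)
qed

text \<open>Cutting at the minimum, rather than at the maximum, leaves words of the down-up type on both sides,
whatever the parity of the length.\<close>

lemma zigzag_rec:
  assumes "n \<ge> 1"
  shows "zigzag (Suc n) = (\<Sum>i\<le>n. if odd i then (n choose i) * zigzag i * zigzag (n - i) else 0)"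
proof -
  let ?S = "{1..n}"
  let ?I = "{U. U \<subseteq> ?S \<and> odd (card U)}"
  \<comment> \<open>The alphabet is shifted to \<open>{0..n}\<close>, which makes 0 the least letter.\<close>
  let ?f = "\<lambda>(us, vs). us @ (0::nat) # vs"
  let ?X = "\<Union>U\<in>?I. alternations U \<times> alternations (?S - U)"
  have fin: "finite U" if "U \<subseteq> ?S" for U using that finite_subset by blast
  have im: "?f ` ?X = alternations {0..n}"
  proof safe
    fix us vs U assume *: "U \<subseteq> ?S" "odd (card U)" "us \<in> alternations U" "vs \<in> alternations (?S - U)"
    then have "odd (length us)" by (simp add: alternations_def distinct_card[symmetric])
    moreover have "us @ vs \<noteq> []" using calculation by auto
    moreover have "0 < x" if "x \<in> set us \<or> x \<in> set vs" for x using that * by (auto simp: alternations_def)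
    ultimately have "alternating (us @ 0 # vs)" using *
      by (subst alternating_append_min) (auto simp: alternations_def)
    moreover have "set (us @ 0 # vs) = {0..n}"
    proof -
      have "{0..n} = insert 0 {1..n}" by auto
      then show ?thesis using * by (auto simp: alternations_def)
    qed
    moreover have "distinct (us @ 0 # vs)" using * by (auto simp: alternations_def)
    ultimately show "us @ 0 # vs \<in> alternations {0..n}" by (simp add: alternations_def)
  next
    fix xs assume xs: "xs \<in> alternations {0..n}"
    then have "0 \<in> set xs" by (simp add: alternations_def)
    then obtain us vs where s: "xs = us @ 0 # vs" by (meson split_list)
    have d: "distinct xs" "set xs = {0..n}" "alternating xs" using xs by (auto simp: alternations_def)
    have nz: "0 < x" if "x \<in> set us \<or> x \<in> set vs" for x using that d(1) s by (cases x) auto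
    have sub: "set us \<union> set vs = ?S"
    proof -
      have "set us \<union> set vs = set xs - {0}" using nz s by fastforce
      also have "\<dots> = ?S" unfolding d(2) by auto
      finally show ?thesis .
    qed
    have ne: "us @ vs \<noteq> []" using sub assms by auto
    have alt: "odd (length us)" "alternating us" "alternating vs"
      using d(3) nz ne unfolding s by (subst (asm) alternating_append_min; auto)+
    have "us \<in> alternations (set us)" "vs \<in> alternations (?S - set us)"
      using d(1) alt sub unfolding s by (auto simp: alternations_def)
    moreover have "set us \<in> ?I" using sub alt d(1) s by (auto simp: distinct_card)
    ultimately have "(us, vs) \<in> ?X" by blast
    then show "xs \<in> ?f ` ?X" by (rule rev_image_eqI) (simp add: s)
  qed
  have inj: "inj_on ?f ?X"
  proof (rule inj_onI)
    fix p q assume p: "p \<in> ?X" and q: "q \<in> ?X" and eq: "?f p = ?f q"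
    have nz: "0 \<notin> set (fst r) \<and> 0 \<notin> set (snd r)" if "r \<in> ?X" for r
      using that by (fastforce simp: alternations_def)
    have "fst p @ 0 # snd p = fst q @ 0 # snd q" using eq by (simp add: split_def)
    then have "fst p = fst q \<and> snd p = snd q" using nz[OF p] nz[OF q] by (metis append_Cons_eq_iff)
    then show "p = q" by (simp add: prod_eq_iff)
  qed
  have "zigzag (Suc n) = card (alternations {0..n})"
    using card_alternations_cong[of "{0..n}"] by simp
  also have "\<dots> = card ?X" using card_image[OF inj] im by simp
  also have "\<dots> = (\<Sum>U\<in>?I. card (alternations U \<times> alternations (?S - U)))"
  proof (rule card_UN_disjoint)
    show "finite ?I" by simp
    show "\<forall>U\<in>?I. finite (alternations U \<times> alternations (?S - U))"
      using fin by (auto intro!: finite_alternations)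
    show "\<forall>U\<in>?I. \<forall>V\<in>?I. U \<noteq> V \<longrightarrow> (alternations U \<times> alternations (?S - U)) \<inter> (alternations V \<times> alternations (?S - V)) = {}"
      by (auto simp: alternations_def)
  qed
  also have "\<dots> = (\<Sum>U\<in>?I. zigzag (card U) * zigzag (n - card U))"
    by (rule sum.cong[OF refl]) (auto simp: card_cartesian_product card_alternations_cong fin card_Diff_subset)
  also have "\<dots> = (\<Sum>U\<in>Pow ?S. if odd (card U) then zigzag (card U) * zigzag (n - card U) else 0)"
    by (rule sum.mono_neutral_cong_left) auto
  also have "\<dots> = (\<Sum>i\<le>n. \<Sum>U\<in>{U\<in>Pow ?S. card U = i}. if odd (card U) then zigzag (card U) * zigzag (n - card U) else 0)"
    by (rule sum.group[symmetric]) (use card_mono[of "{1..n}"] in auto)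
  also have "\<dots> = (\<Sum>i\<le>n. if odd i then (n choose i) * zigzag i * zigzag (n - i) else 0)"
  proof (rule sum.cong[OF refl])
    fix i
    have "(\<Sum>U\<in>{U\<in>Pow ?S. card U = i}. if odd (card U) then zigzag (card U) * zigzag (n - card U) else 0)
      = (\<Sum>U\<in>{U. U \<subseteq> ?S \<and> card U = i}. if odd i then zigzag i * zigzag (n - i) else 0)"
      by (rule sum.cong) auto
    also have "\<dots> = (n choose i) * (if odd i then zigzag i * zigzag (n - i) else 0)"
      using n_subsets[of ?S i] by (simp only: sum_constant of_nat_id) simp
    finally show "(\<Sum>U\<in>{U\<in>Pow ?S. card U = i}. if odd (card U) then zigzag (card U) * zigzag (n - card U) else 0)
      = (if odd i then (n choose i) * zigzag i * zigzag (n - i) else 0)" by simp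
  qed
  finally show ?thesis .
qed

section \<open>Hyperbolic tangent series and the moment recursion\<close>

text \<open>The series of \<open>tanh (L s)\<close>. The factor \<open>1 - tanh (L s) = 2 / (1 + exp (2 L s))\<close> is what the
antiperiodic boundary condition of the iterated kernels produces.\<close>

definition tanh_series :: "real \<Rightarrow> real fps" where
  "tanh_series L = 1 - 2 * inverse (1 + fps_exp (2 * L))"

lemma tanh_series_mult: "(1 - tanh_series L) * (1 + fps_exp (2 * L)) = 2"
proof -
  have "inverse (1 + fps_exp (2 * L)) * (1 + fps_exp (2 * L)) = 1"
    by (rule inverse_mult_eq_1) simp
  then show ?thesis by (simp add: tanh_series_def mult.assoc)
qed

lemma tanh_series_nth_0: "fps_nth (tanh_series L) 0 = 0"
  by (simp add: tanh_series_def)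

lemma tanh_series_deriv: "fps_deriv (tanh_series L) = fps_const L * (1 - tanh_series L * tanh_series L)"
proof -
  let ?T = "tanh_series L" and ?X = "fps_exp (2 * L)"
  have nz: "1 + ?X \<noteq> 0"
  proof
    assume "1 + ?X = 0"
    then have "fps_nth (1 + ?X) 0 = fps_nth 0 0" by metis
    then show False by simp
  qed
  have "fps_deriv ((1 - ?T) * (1 + ?X)) = 0" by (simp only: tanh_series_mult) simp
  then have d: "fps_deriv ?T * (1 + ?X) = (1 - ?T) * (fps_const (2 * L) * ?X)"
    by (simp add: algebra_simps)
  have p: "(1 + ?T) * (1 + ?X) = 2 * ?X"
  proof -
    have "(1 + ?T) * (1 + ?X) = 2 * (1 + ?X) - (1 - ?T) * (1 + ?X)" by (simp add: algebra_simps)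
    then show ?thesis by (simp only: tanh_series_mult) (simp add: algebra_simps)
  qed
  have c: "fps_const (2 * L) = fps_const L * 2" by (simp add: fps_numeral_fps_const mult.commute)
  have "fps_deriv ?T * (1 + ?X) = fps_const L * (1 - ?T) * (2 * ?X)"
    unfolding d c by (simp add: algebra_simps)
  also have "\<dots> = fps_const L * (1 - ?T) * ((1 + ?T) * (1 + ?X))" by (simp only: p)
  also have "\<dots> = (fps_const L * (1 - ?T * ?T)) * (1 + ?X)" by (simp add: algebra_simps)
  finally show ?thesis using nz by simp
qed

lemma tanh_series_rec:
  "of_nat (Suc n) * fps_nth (tanh_series L) (Suc n)
     = L * ((if n = 0 then 1 else 0) - (\<Sum>i\<le>n. fps_nth (tanh_series L) i * fps_nth (tanh_series L) (n - i)))"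
proof -
  have "fps_nth (fps_deriv (tanh_series L)) n = fps_nth (fps_const L * (1 - tanh_series L * tanh_series L)) n"
    by (simp only: tanh_series_deriv)
  also have "\<dots> = L * ((if n = 0 then 1 else 0) - fps_nth (tanh_series L * tanh_series L) n)"
    by (simp add: fps_mult_left_const_nth)
  finally show ?thesis by (simp add: fps_mult_nth atMost_atLeast0 del: of_nat_Suc)
qed

lemma zigzag_rec_fact:
  assumes "n \<ge> 1"
  shows "real (Suc n) * (real (zigzag (Suc n)) / fact (Suc n))
    = (\<Sum>i\<le>n. if odd i then (real (zigzag i) / fact i) * (real (zigzag (n - i)) / fact (n - i)) else 0)"
proof -
  have "real (Suc n) * (real (zigzag (Suc n)) / fact (Suc n)) = real (zigzag (Suc n)) / fact n"
    by (simp add: fact_Suc del: of_nat_Suc)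
  also have "\<dots> = (\<Sum>i\<le>n. real (if odd i then (n choose i) * zigzag i * zigzag (n - i) else 0) / fact n)"
    by (simp only: zigzag_rec[OF assms] of_nat_sum sum_divide_distrib)
  also have "\<dots> = (\<Sum>i\<le>n. if odd i then (real (zigzag i) / fact i) * (real (zigzag (n - i)) / fact (n - i)) else 0)"
    by (rule sum.cong) (auto simp: binomial_fact field_simps)
  finally show ?thesis .
qed

text \<open>Up to signs, \<open>tanh' = L (1 - tanh^2)\<close> is the recursion of the zigzag numbers of odd index.\<close>

lemma tanh_series_nth:
  "fps_nth (tanh_series L) n = (if odd n then (-1) ^ (n div 2) * L ^ n * real (zigzag n) / fact n else 0)"
proof (induction n rule: less_induct)
  case (less n)
  let ?T = "fps_nth (tanh_series L)"
  show ?case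
  proof (cases n)
    case 0 then show ?thesis by (simp add: tanh_series_nth_0)
  next
    case (Suc m)
    have IH: "?T i = (if odd i then (-1) ^ (i div 2) * L ^ i * real (zigzag i) / fact i else 0)" if "i \<le> m" for i
      using less[of i] that Suc by simp
    have S: "(\<Sum>i\<le>m. ?T i * ?T (m - i)) =
       (if even m then (\<Sum>i\<le>m. - ((-1) ^ (m div 2) * L ^ m * (if odd i then (real (zigzag i) / fact i) * (real (zigzag (m - i)) / fact (m - i)) else 0))) else 0)"
    proof (cases "even m")
      case True
      have "(\<Sum>i\<le>m. ?T i * ?T (m - i)) = (\<Sum>i\<le>m. - ((-1) ^ (m div 2) * L ^ m * (if odd i then (real (zigzag i) / fact i) * (real (zigzag (m - i)) / fact (m - i)) else 0)))"
      proof (rule sum.cong[OF refl])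
        fix i assume "i \<in> {..m}" then have i: "i \<le> m" by simp
        show "?T i * ?T (m - i) = - ((-1) ^ (m div 2) * L ^ m * (if odd i then (real (zigzag i) / fact i) * (real (zigzag (m - i)) / fact (m - i)) else 0))"
        proof (cases "odd i")
          case o: True
          then have o': "odd (m - i)" using True i by simp
          obtain u v where uv: "i = 2 * u + 1" "m - i = 2 * v + 1" using o o' by (meson oddE)
          then have m: "m = 2 * (u + v + 1)" using i by simp
          have s: "(-1) ^ (i div 2) * (-1) ^ ((m - i) div 2) = - ((-1::real) ^ (m div 2))"
            using uv m by (simp add: power_add)
          have l: "L ^ i * L ^ (m - i) = L ^ m" using i by (simp add: power_add[symmetric])
          have "?T i * ?T (m - i) = ((-1) ^ (i div 2) * (-1) ^ ((m - i) div 2)) * (L ^ i * L ^ (m - i)) * ((real (zigzag i) / fact i) * (real (zigzag (m - i)) / fact (m - i)))"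
            using o o' by (simp add: IH i)
          then show ?thesis using o unfolding s l by simp
        qed (simp add: IH i)
      qed
      then show ?thesis using True by simp
    next
      case False
      have "(\<Sum>i\<le>m. ?T i * ?T (m - i)) = 0"
        by (rule sum.neutral) (use False in \<open>auto simp: IH\<close>)
      then show ?thesis using False by simp
    qed
    have R: "real (Suc m) * ?T (Suc m) = L * ((if m = 0 then 1 else 0) - (\<Sum>i\<le>m. ?T i * ?T (m - i)))"
      by (rule tanh_series_rec)
    consider "m = 0" | "even m" "m \<ge> 1" | "odd m" by (cases m) auto
    then have "real (Suc m) * ?T (Suc m) = real (Suc m) * (if odd (Suc m) then (-1) ^ (Suc m div 2) * L ^ Suc m * real (zigzag (Suc m)) / fact (Suc m) else 0)"
    proof cases
      case 1 then show ?thesis using R by (simp add: zigzag_1 tanh_series_nth_0)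
    next
      case 2
      have "real (Suc m) * ?T (Suc m) = L * ((-1) ^ (m div 2) * L ^ m * (real (Suc m) * (real (zigzag (Suc m)) / fact (Suc m))))"
        unfolding R S using 2 by (simp only: zigzag_rec_fact[OF 2(2)] sum_negf sum_distrib_left[symmetric]) simp
      also have "\<dots> = real (Suc m) * ((-1) ^ (m div 2) * L ^ Suc m * real (zigzag (Suc m)) / fact (Suc m))" by simp
      finally show ?thesis using 2 by simp
    next
      case 3 then show ?thesis unfolding R S by (cases m) auto
    qed
    then show ?thesis using Suc by simp
  qed
qed

text \<open>The coefficients of the solution of \<open>h' = g + h + g h^2\<close> with \<open>h(0) = 0\<close>.\<close>

fun eta :: "real \<Rightarrow> nat \<Rightarrow> real" where
  "eta g 0 = 0"
| "eta g (Suc p) = ((if p = 0 then g else 0) + eta g p + g * (\<Sum>i\<le>p. eta g i * eta g (p - i))) / real (Suc p)"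

text \<open>The coefficients of the solution of \<open>G' = (\<Sum>j. g \<eta> j \<tau> (j + 1) z^j) G\<close> with \<open>G(0) = 1\<close>.\<close>

fun vac_moment :: "(nat \<Rightarrow> real) \<Rightarrow> real \<Rightarrow> nat \<Rightarrow> real" where
  "vac_moment \<tau> g 0 = 1"
| "vac_moment \<tau> g (Suc n) = (\<Sum>j\<le>n. g * eta g j * \<tau> (Suc j) * vac_moment \<tau> g (n - j)) / real (Suc n)"

lemma isCont_eta: "isCont (\<lambda>g. eta g n) x"
proof (induction n rule: less_induct)
  case (less n)
  show ?case
  proof (cases n)
    case (Suc p)
    have "isCont (\<lambda>g. eta g i) x" if "i \<le> p" for i using less that Suc by simp
    then show ?thesis unfolding Suc by (cases "p = 0") (auto intro!: continuous_intros)
  qed simp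
qed

lemma isCont_vac_moment: "isCont (\<lambda>g. vac_moment \<tau> g n) x"
proof (induction n rule: less_induct)
  case (less n)
  show ?case
  proof (cases n)
    case (Suc p)
    have "isCont (\<lambda>g. vac_moment \<tau> g i) x" if "i \<le> p" for i using less that Suc by simp
    then show ?thesis unfolding Suc by (auto intro!: continuous_intros isCont_eta)
  qed simp
qed

text \<open>At \<open>g = 1/2\<close> the Riccati equation is \<open>(1 + h)' = (1 + h)^2 / 2\<close>, solved by \<open>1 + h = 1 / (1 - s/2)\<close>.\<close>

lemma eta_half: "eta (1/2) n = (if n = 0 then 0 else 1 / 2 ^ n)"
proof (induction n rule: less_induct)
  case (less n)
  show ?case
  proof (cases n)
    case (Suc p)
    have IH: "eta (1/2) i = (if i = 0 then 0 else 1 / 2 ^ i)" if "i \<le> p" for i using less that Suc by simp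
    have "(\<Sum>i\<le>p. eta (1/2) i * eta (1/2) (p - i)) = (\<Sum>i\<in>{1..<p}. 1 / 2 ^ p)"
    proof (rule sum.mono_neutral_cong_right)
      show "\<forall>i\<in>{..p} - {1..<p}. eta (1/2) i * eta (1/2) (p - i) = 0"
      proof
        fix i assume "i \<in> {..p} - {1..<p}"
        then have "i = 0 \<or> p - i = 0" by auto
        then show "eta (1/2) i * eta (1/2) (p - i) = 0" by (metis eta.simps(1) mult_zero_left mult_zero_right)
      qed
    qed (auto simp: IH power_add[symmetric] simp del: eta.simps)
    then have "eta (1/2) (Suc p) = ((if p = 0 then 1/2 else 0) + eta (1/2) p + real (p - 1) / 2 ^ p / 2) / real (Suc p)"
      by simp
    also have "\<dots> = (real (Suc p) / 2 ^ Suc p) / real (Suc p)"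
    proof (cases p)
      case (Suc q)
      then show ?thesis by (simp add: IH field_simps del: eta.simps)
    qed simp
    also have "\<dots> = 1 / 2 ^ Suc p" by simp
    finally show ?thesis using Suc by simp
  qed simp
qed

text \<open>With the traces inserted, \<open>G'/G\<close> is the tangent up to signs, so \<open>G\<close> follows the recursion of the
secant.\<close>

lemma vac_moment_half:
  assumes \<tau>: "\<And>j. j \<ge> 1 \<Longrightarrow> \<tau> (Suc j) = - L * fps_nth (tanh_series L) j"
  shows "vac_moment \<tau> (1/2) n = (if even n then (-1) ^ (n div 2) * (L/2) ^ n * real (zigzag n) / fact n else 0)"
proof (induction n rule: less_induct)
  case (less n)
  show ?case
  proof (cases n)
    case 0 then show ?thesis by (simp add: zigzag_0)
  next
    case (Suc m)
    let ?\<mu> = "vac_moment \<tau> (1/2)"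
    have IH: "?\<mu> i = (if even i then (-1) ^ (i div 2) * (L/2) ^ i * real (zigzag i) / fact i else 0)" if "i \<le> m" for i
      using less[of i] that Suc by simp
    have t: "(1/2) * eta (1/2) j * \<tau> (Suc j) = (if odd j then - ((-1) ^ (j div 2) * (L/2) ^ Suc j * real (zigzag j) / fact j) else 0)" for j
      by (cases "j = 0") (auto simp: eta_half \<tau> tanh_series_nth power_divide field_simps simp del: eta.simps)
    have M: "real (Suc m) * ?\<mu> (Suc m) = (\<Sum>j\<le>m. (1/2) * eta (1/2) j * \<tau> (Suc j) * ?\<mu> (m - j))"
      by (simp del: eta.simps)
    show ?thesis
    proof (cases "even m")
      case True
      have "(\<Sum>j\<le>m. (1/2) * eta (1/2) j * \<tau> (Suc j) * ?\<mu> (m - j)) = 0"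
        unfolding t by (rule sum.neutral) (use True in \<open>auto simp: IH\<close>)
      then have "?\<mu> (Suc m) = 0" using M by (simp del: vac_moment.simps eta.simps)
      then show ?thesis using Suc True by simp
    next
      case False
      have "(\<Sum>j\<le>m. (1/2) * eta (1/2) j * \<tau> (Suc j) * ?\<mu> (m - j))
         = (\<Sum>j\<le>m. (-1) ^ (Suc m div 2) * (L/2) ^ Suc m * (if odd j then (real (zigzag j) / fact j) * (real (zigzag (m - j)) / fact (m - j)) else 0))"
      proof (rule sum.cong[OF refl])
        fix j assume "j \<in> {..m}" then have j: "j \<le> m" by simp
        show "(1/2) * eta (1/2) j * \<tau> (Suc j) * ?\<mu> (m - j) = (-1) ^ (Suc m div 2) * (L/2) ^ Suc m * (if odd j then (real (zigzag j) / fact j) * (real (zigzag (m - j)) / fact (m - j)) else 0)"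
        proof (cases "odd j")
          case o: True
          then have e: "even (m - j)" using False j by simp
          obtain u v where uv: "j = 2 * u + 1" "m - j = 2 * v" using o e by (meson oddE evenE)
          then have m: "m = 2 * (u + v) + 1" using j by simp
          have s: "- ((-1) ^ (j div 2) * (-1) ^ ((m - j) div 2)) = ((-1::real) ^ (Suc m div 2))"
            using uv m by (simp add: power_add)
          have l: "(L/2) ^ Suc j * (L/2) ^ (m - j) = (L/2) ^ Suc m" using j by (subst power_add[symmetric]) simp
          have "(1/2) * eta (1/2) j * \<tau> (Suc j) * ?\<mu> (m - j) = (- ((-1) ^ (j div 2) * (-1) ^ ((m - j) div 2))) * ((L/2) ^ Suc j * (L/2) ^ (m - j)) * ((real (zigzag j) / fact j) * (real (zigzag (m - j)) / fact (m - j)))"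
            unfolding t using o e by (simp add: IH del: power_Suc)
          then show ?thesis using o unfolding s l by simp
        qed (unfold t, simp)
      qed
      also have "\<dots> = (-1) ^ (Suc m div 2) * (L/2) ^ Suc m * (real (Suc m) * (real (zigzag (Suc m)) / fact (Suc m)))"
        using False by (subst zigzag_rec_fact) (auto simp: sum_distrib_left elim: oddE)
      finally have "real (Suc m) * ?\<mu> (Suc m) = real (Suc m) * ((-1) ^ (Suc m div 2) * (L/2) ^ Suc m * real (zigzag (Suc m)) / fact (Suc m))"
        unfolding M by simp
      then have "?\<mu> (Suc m) = (-1) ^ (Suc m div 2) * (L/2) ^ Suc m * real (zigzag (Suc m)) / fact (Suc m)"
        by (subst (asm) mult_cancel_left) simp
      then show ?thesis using Suc False by simp
    qed
  qed
qed

section \<open>Measurability of functions of particle configurations\<close>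

lemma add_mset_diff_member: "x' \<in># M \<Longrightarrow> add_mset x M - {#x'#} = add_mset x (M - {#x'#})"
  by simp

lemma sum_mset_remove_add:
  "(\<Sum>x'\<in>#add_mset x M. F x' (add_mset x M - {#x'#})) = F x M + (\<Sum>x'\<in>#M. F x' (add_mset x (M - {#x'#})))"
proof -
  have "image_mset (\<lambda>x'. F x' (add_mset x M - {#x'#})) M = image_mset (\<lambda>x'. F x' (add_mset x (M - {#x'#}))) M"
    by (rule image_mset_cong) (simp add: add_mset_diff_member)
  then show ?thesis by simp
qed

text \<open>Both sides sum over ordered pairs of distinct occurrences in the multiset.\<close>

lemma sum_mset_remove2_swap:
  fixes F :: "'a \<Rightarrow> 'a \<Rightarrow> 'a multiset \<Rightarrow> 'b::comm_monoid_add"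
  shows "(\<Sum>x\<in>#M. \<Sum>y\<in>#M - {#x#}. F x y (M - {#x#} - {#y#}))
       = (\<Sum>y\<in>#M. \<Sum>x\<in>#M - {#y#}. F x y (M - {#y#} - {#x#}))"
proof (induction M arbitrary: F)
  case empty
  then show ?case by simp
next
  case (add z M)
  have A: "(\<Sum>x\<in>#add_mset z M. \<Sum>y\<in>#add_mset z M - {#x#}. G x y (add_mset z M - {#x#} - {#y#}))
     = (\<Sum>y\<in>#M. G z y (M - {#y#})) + ((\<Sum>x\<in>#M. G x z (M - {#x#})) + (\<Sum>x\<in>#M. \<Sum>y\<in>#M - {#x#}. G x y (add_mset z (M - {#x#} - {#y#}))))"
    for G :: "'a \<Rightarrow> 'a \<Rightarrow> 'a multiset \<Rightarrow> 'b"
  proof -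
    have "(\<Sum>x\<in>#add_mset z M. \<Sum>y\<in>#add_mset z M - {#x#}. G x y (add_mset z M - {#x#} - {#y#}))
      = (\<Sum>y\<in>#M. G z y (M - {#y#})) + (\<Sum>x\<in>#M. \<Sum>y\<in>#add_mset z (M - {#x#}). G x y (add_mset z (M - {#x#}) - {#y#}))"
      using sum_mset_remove_add[of "\<lambda>x M'. \<Sum>y\<in>#M'. G x y (M' - {#y#})" z M] by simp
    also have "(\<Sum>x\<in>#M. \<Sum>y\<in>#add_mset z (M - {#x#}). G x y (add_mset z (M - {#x#}) - {#y#}))
      = (\<Sum>x\<in>#M. G x z (M - {#x#}) + (\<Sum>y\<in>#M - {#x#}. G x y (add_mset z (M - {#x#} - {#y#}))))"
      by (subst sum_mset_remove_add) simp
    finally show ?thesis by (simp add: sum_mset.distrib)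
  qed
  have B: "(\<Sum>x\<in>#M. \<Sum>y\<in>#M - {#x#}. F x y (add_mset z (M - {#x#} - {#y#})))
     = (\<Sum>y\<in>#M. \<Sum>x\<in>#M - {#y#}. F x y (add_mset z (M - {#y#} - {#x#})))"
    using add[of "\<lambda>x y M. F x y (add_mset z M)"] by simp
  show ?case
    using A[of F] A[of "\<lambda>x y. F y x"] B by (simp add: add.left_commute add.commute)
qed

lemma sum_mset_remove_nth:
  "(\<Sum>x\<in>#mset xs. F x (mset xs - {#x#})) = (\<Sum>i<length xs. F (xs ! i) (mset (take i xs @ drop (Suc i) xs)))"
proof -
  have "(\<Sum>x\<in>#mset xs. F x (mset xs - {#x#})) = (\<Sum>x\<leftarrow>xs. F x (mset xs - {#x#}))"
    by (metis mset_map sum_mset_sum_list)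
  also have "\<dots> = (\<Sum>i<length xs. F (xs ! i) (mset xs - {#xs ! i#}))"
    by (simp add: sum_list_sum_nth lessThan_atLeast0)
  also have "\<dots> = (\<Sum>i<length xs. F (xs ! i) (mset (take i xs @ drop (Suc i) xs)))"
  proof (rule sum.cong[OF refl])
    fix i assume "i \<in> {..<length xs}"
    then have "mset xs = add_mset (xs ! i) (mset (take i xs @ drop (Suc i) xs))"
      by (subst id_take_nth_drop[of i xs]) auto
    then show "F (xs ! i) (mset xs - {#xs ! i#}) = F (xs ! i) (mset (take i xs @ drop (Suc i) xs))"
      by simp
  qed
  finally show ?thesis .
qed

lemma integral_sum_mset:
  fixes F :: "'a \<Rightarrow> 'b \<Rightarrow> complex"
  assumes "\<And>x. x \<in># M \<Longrightarrow> integrable S (F x)"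
  shows "integrable S (\<lambda>y. \<Sum>x\<in>#M. F x y)" "(\<integral>y. (\<Sum>x\<in>#M. F x y) \<partial>S) = (\<Sum>x\<in>#M. \<integral>y. F x y \<partial>S)"
  using assms by (induction M) auto

lemma config_conv_mset: "config n x = mset (map x [0..<n])"
  by (simp add: config_def lessThan_atLeast0)

lemma size_config: "size (config n x) = n"
  by (simp add: config_def)

lemma space_half_line: "space half_line = {0..}"
  by (simp add: half_line_def)

lemma sets_half_line [measurable_cong]: "sets half_line = sets (restrict_space borel {0..})"
  unfolding half_line_def by (rule sets_restrict_space_cong) simp

lemma half_line_borel_measurable: "f \<in> borel_measurable borel \<Longrightarrow> f \<in> borel_measurable half_line"
  using measurable_cong_sets[OF sets_half_line refl] measurable_restrict_space1 by blast

lemma sigma_finite_half_line: "sigma_finite_measure half_line"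
  unfolding half_line_def by (rule sigma_finite_measure_restrict_space) (auto intro: sigma_finite_lborel)

interpretation half_line: sigma_finite_measure half_line by (rule sigma_finite_half_line)
interpretation half_lines: product_sigma_finite "\<lambda>_::nat. half_line" by standard
interpretation half_line_pair: pair_sigma_finite half_line half_line by standard

definition meas :: "fock2 \<Rightarrow> bool" where
  "meas \<theta> \<longleftrightarrow> (\<forall>n k. component n k \<theta> \<in> borel_measurable (particle_measure n k))"

text \<open>Measurability is tested and used along arbitrary lists of measurable coordinate functions. Adding or
removing a particle is then a list operation, and no reindexing of product spaces is needed.\<close>

lemma meas_section:
  assumes "meas \<theta>" and gs: "\<And>g. g \<in> set gs \<Longrightarrow> g \<in> measurable S half_line"
    and hs: "\<And>h. h \<in> set hs \<Longrightarrow> h \<in> measurable S half_line"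
  shows "(\<lambda>s. \<theta> (mset (map (\<lambda>g. g s) gs)) (mset (map (\<lambda>h. h s) hs))) \<in> borel_measurable S"
proof -
  have *: "(\<lambda>s. (\<lambda>i\<in>{..<length gs}. (gs ! i) s)) \<in> measurable S (Pi\<^sub>M {..<length gs} (\<lambda>_. half_line))"
    if "\<And>g. g \<in> set gs \<Longrightarrow> g \<in> measurable S half_line" for gs
    by (rule measurable_restrict) (simp add: that)
  have "(\<lambda>s. ((\<lambda>i\<in>{..<length gs}. (gs ! i) s), (\<lambda>i\<in>{..<length hs}. (hs ! i) s)))
      \<in> measurable S (particle_measure (length gs) (length hs))"
    unfolding particle_measure_def by (intro measurable_Pair * gs hs)
  then have "(\<lambda>s. component (length gs) (length hs) \<theta> ((\<lambda>i\<in>{..<length gs}. (gs ! i) s), (\<lambda>i\<in>{..<length hs}. (hs ! i) s)))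
     \<in> borel_measurable S"
    using assms(1) unfolding meas_def by (rule_tac measurable_compose) auto
  moreover have "config (length gs) (\<lambda>i\<in>{..<length gs}. (gs ! i) s) = mset (map (\<lambda>g. g s) gs)"
    for s :: 'a and gs :: "('a \<Rightarrow> real) list"
    unfolding config_conv_mset by (rule arg_cong[where f=mset], rule nth_equalityI) auto
  ultimately show ?thesis unfolding component_def by simp
qed

lemma meas_intro:
  assumes "\<And>gs hs. (\<And>g. g \<in> set gs \<Longrightarrow> g \<in> measurable (particle_measure (length gs) (length hs)) half_line) \<Longrightarrow>
     (\<And>h. h \<in> set hs \<Longrightarrow> h \<in> measurable (particle_measure (length gs) (length hs)) half_line) \<Longrightarrow>
     (\<lambda>s. \<theta> (mset (map (\<lambda>g. g s) gs)) (mset (map (\<lambda>h. h s) hs))) \<in> borel_measurable (particle_measure (length gs) (length hs))"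
  shows "meas \<theta>"
  unfolding meas_def
proof (intro allI)
  fix n k
  let ?gs = "map (\<lambda>i (z::(nat \<Rightarrow> real) \<times> (nat \<Rightarrow> real)). fst z i) [0..<n]"
  let ?hs = "map (\<lambda>i (z::(nat \<Rightarrow> real) \<times> (nat \<Rightarrow> real)). snd z i) [0..<k]"
  have "(\<lambda>s. \<theta> (mset (map (\<lambda>g. g s) ?gs)) (mset (map (\<lambda>h. h s) ?hs))) \<in> borel_measurable (particle_measure (length ?gs) (length ?hs))"
    by (rule assms) (auto simp: particle_measure_def intro!: measurable_compose[OF measurable_fst measurable_component_singleton]
       measurable_compose[OF measurable_snd measurable_component_singleton])
  moreover have "(\<lambda>s. \<theta> (mset (map (\<lambda>g. g s) ?gs)) (mset (map (\<lambda>h. h s) ?hs))) = component n k \<theta>"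
    by (auto simp: component_def config_conv_mset o_def fun_eq_iff)
  ultimately show "component n k \<theta> \<in> borel_measurable (particle_measure n k)" by simp
qed

definition swap2 :: "fock2 \<Rightarrow> fock2" where "swap2 \<theta> = (\<lambda>M N. \<theta> N M)"

lemma meas_swap2: "meas \<theta> \<Longrightarrow> meas (swap2 \<theta>)"
  unfolding swap2_def by (rule meas_intro) (rule meas_section)

text \<open>Creation and annihilation act here on renormalized vectors: the Fock vector belonging to \<open>\<theta>\<close> is
\<open>\<theta> M N / sqrt (|M|! |N|!)\<close> (see \<open>to_fock\<close>), which absorbs all square roots of particle numbers.\<close>

definition ann_left :: "(real \<Rightarrow> complex) \<Rightarrow> fock2 \<Rightarrow> fock2" where
  "ann_left f \<theta> M N = (\<integral>x. f x * \<theta> (add_mset x M) N \<partial>half_line)"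
definition cre_left :: "(real \<Rightarrow> complex) \<Rightarrow> fock2 \<Rightarrow> fock2" where
  "cre_left f \<theta> M N = (\<Sum>x\<in>#M. f x * \<theta> (M - {#x#}) N)"
definition ann_right :: "(real \<Rightarrow> complex) \<Rightarrow> fock2 \<Rightarrow> fock2" where
  "ann_right f \<theta> M N = (\<integral>x. f x * \<theta> M (add_mset x N) \<partial>half_line)"
definition cre_right :: "(real \<Rightarrow> complex) \<Rightarrow> fock2 \<Rightarrow> fock2" where
  "cre_right f \<theta> M N = (\<Sum>x\<in>#N. f x * \<theta> M (N - {#x#}))"

definition pair_cre :: "(real \<Rightarrow> real \<Rightarrow> complex) \<Rightarrow> fock2 \<Rightarrow> fock2" where
  "pair_cre k \<theta> M N = (\<Sum>x\<in>#M. \<Sum>y\<in>#N. k x y * \<theta> (M - {#x#}) (N - {#y#}))"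
definition pair_ann :: "(real \<Rightarrow> real \<Rightarrow> complex) \<Rightarrow> fock2 \<Rightarrow> fock2" where
  "pair_ann k \<theta> M N = (\<integral>x. \<integral>y. k x y * \<theta> (add_mset x M) (add_mset y N) \<partial>half_line \<partial>half_line)"
definition hop_left :: "(real \<Rightarrow> real \<Rightarrow> complex) \<Rightarrow> fock2 \<Rightarrow> fock2" where
  "hop_left k \<theta> M N = (\<Sum>x\<in>#M. \<integral>y. k x y * \<theta> (add_mset y (M - {#x#})) N \<partial>half_line)"
text \<open>The removed particle is the second argument of the kernel, unlike in \<open>hop_left\<close>. With this
convention hopping on the left composes a pair kernel from the left, and hopping on the right from
the right.\<close>

definition hop_right :: "(real \<Rightarrow> real \<Rightarrow> complex) \<Rightarrow> fock2 \<Rightarrow> fock2" where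
  "hop_right k \<theta> M N = (\<Sum>y\<in>#N. \<integral>x. k x y * \<theta> M (add_mset x (N - {#y#})) \<partial>half_line)"

lemma ann_right_swap: "ann_right f \<theta> = swap2 (ann_left f (swap2 \<theta>))"
  by (simp add: fun_eq_iff ann_right_def ann_left_def swap2_def)
lemma cre_right_swap: "cre_right f \<theta> = swap2 (cre_left f (swap2 \<theta>))"
  by (simp add: fun_eq_iff cre_right_def cre_left_def swap2_def)
lemma hop_right_swap: "hop_right k \<theta> = swap2 (hop_left (\<lambda>x y. k y x) (swap2 \<theta>))"
  by (simp add: fun_eq_iff hop_right_def hop_left_def swap2_def)

lemma meas_ann_left:
  assumes "meas \<theta>" "f \<in> borel_measurable half_line" shows "meas (ann_left f \<theta>)"
proof (rule meas_intro)
  fix gs hs assume gh: "\<And>g. g \<in> set gs \<Longrightarrow> g \<in> measurable (particle_measure (length gs) (length hs)) half_line"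
     "\<And>h. h \<in> set hs \<Longrightarrow> h \<in> measurable (particle_measure (length gs) (length hs)) half_line"
  let ?P = "particle_measure (length gs) (length hs)"
  let ?l = "map (\<lambda>g. g \<circ> fst)"
  have "(\<lambda>s. \<theta> (mset (map (\<lambda>g. g s) (snd # ?l gs))) (mset (map (\<lambda>h. h s) (?l hs)))) \<in> borel_measurable (?P \<Otimes>\<^sub>M half_line)"
    by (rule meas_section[OF assms(1)]) (auto intro: gh measurable_comp[OF measurable_fst])
  then have "(\<lambda>s. f (snd s) * \<theta> (mset (map (\<lambda>g. g s) (snd # ?l gs))) (mset (map (\<lambda>h. h s) (?l hs)))) \<in> borel_measurable (?P \<Otimes>\<^sub>M half_line)"
    by (intro borel_measurable_times measurable_compose[OF measurable_snd assms(2)])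
  then have "(\<lambda>s. \<integral>y. (\<lambda>(s,y). f y * \<theta> (mset (map (\<lambda>g. g (s,y)) (snd # ?l gs))) (mset (map (\<lambda>h. h (s,y)) (?l hs)))) (s, y) \<partial>half_line) \<in> borel_measurable ?P"
    by (intro half_line.borel_measurable_lebesgue_integral) (simp add: split_def)
  then show "(\<lambda>s. ann_left f \<theta> (mset (map (\<lambda>g. g s) gs)) (mset (map (\<lambda>h. h s) hs))) \<in> borel_measurable ?P"
    by (simp add: ann_left_def o_def)
qed

lemma meas_cre_left:
  assumes "meas \<theta>" "f \<in> borel_measurable half_line" shows "meas (cre_left f \<theta>)"
proof (rule meas_intro)
  fix gs hs assume gh: "\<And>g. g \<in> set gs \<Longrightarrow> g \<in> measurable (particle_measure (length gs) (length hs)) half_line"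
     "\<And>h. h \<in> set hs \<Longrightarrow> h \<in> measurable (particle_measure (length gs) (length hs)) half_line"
  let ?P = "particle_measure (length gs) (length hs)"
  have "(\<lambda>s. \<Sum>i<length gs. f ((gs ! i) s) * \<theta> (mset (map (\<lambda>g. g s) (take i gs @ drop (Suc i) gs))) (mset (map (\<lambda>h. h s) hs))) \<in> borel_measurable ?P"
    by (intro borel_measurable_sum borel_measurable_times meas_section[OF assms(1)] measurable_compose[OF _ assms(2)])
       (auto intro: gh dest: in_set_takeD in_set_dropD)
  then show "(\<lambda>s. cre_left f \<theta> (mset (map (\<lambda>g. g s) gs)) (mset (map (\<lambda>h. h s) hs))) \<in> borel_measurable ?P"
    unfolding cre_left_def by (subst sum_mset_remove_nth) (simp add: take_map drop_map)
qed

lemma meas_hop_left: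
  assumes "meas \<theta>" "(\<lambda>(x,y). k x y) \<in> borel_measurable (half_line \<Otimes>\<^sub>M half_line)" shows "meas (hop_left k \<theta>)"
proof (rule meas_intro)
  fix gs hs assume gh: "\<And>g. g \<in> set gs \<Longrightarrow> g \<in> measurable (particle_measure (length gs) (length hs)) half_line"
     "\<And>h. h \<in> set hs \<Longrightarrow> h \<in> measurable (particle_measure (length gs) (length hs)) half_line"
  let ?P = "particle_measure (length gs) (length hs)"
  let ?l = "map (\<lambda>g. g \<circ> fst)"
  have "(\<lambda>s. \<integral>y. k ((gs ! i) s) y * \<theta> (add_mset y (mset (map (\<lambda>g. g s) (take i gs @ drop (Suc i) gs)))) (mset (map (\<lambda>h. h s) hs)) \<partial>half_line) \<in> borel_measurable ?P"
    if i: "i < length gs" for i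
  proof -
    have gi: "(gs ! i) \<in> measurable ?P half_line" using i by (auto intro: gh)
    have "(\<lambda>s. (\<lambda>(x,y). k x y) ((gs ! i) (fst s), snd s)) \<in> borel_measurable (?P \<Otimes>\<^sub>M half_line)"
      by (rule measurable_compose[OF _ assms(2)]) (intro measurable_Pair measurable_compose[OF measurable_fst gi] measurable_snd)
    moreover have "(\<lambda>s. \<theta> (mset (map (\<lambda>g. g s) (snd # ?l (take i gs @ drop (Suc i) gs)))) (mset (map (\<lambda>h. h s) (?l hs)))) \<in> borel_measurable (?P \<Otimes>\<^sub>M half_line)"
      by (rule meas_section[OF assms(1)]) (auto intro: gh measurable_comp[OF measurable_fst] dest: in_set_takeD in_set_dropD)
    ultimately have "(\<lambda>(s,y). k ((gs ! i) s) y * \<theta> (add_mset y (mset (map (\<lambda>g. g s) (take i gs @ drop (Suc i) gs)))) (mset (map (\<lambda>h. h s) hs))) \<in> borel_measurable (?P \<Otimes>\<^sub>M half_line)"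
      by (auto simp: o_def split_def)
    then show ?thesis by (rule half_line.borel_measurable_lebesgue_integral)
  qed
  then have "(\<lambda>s. \<Sum>i<length gs. \<integral>y. k ((gs ! i) s) y * \<theta> (add_mset y (mset (map (\<lambda>g. g s) (take i gs @ drop (Suc i) gs)))) (mset (map (\<lambda>h. h s) hs)) \<partial>half_line) \<in> borel_measurable ?P"
    by (intro borel_measurable_sum) auto
  then show "(\<lambda>s. hop_left k \<theta> (mset (map (\<lambda>g. g s) gs)) (mset (map (\<lambda>h. h s) hs))) \<in> borel_measurable ?P"
    unfolding hop_left_def by (subst sum_mset_remove_nth) (simp add: take_map drop_map)
qed

lemma meas_pair_cre:
  assumes "meas \<theta>" "(\<lambda>(x,y). k x y) \<in> borel_measurable (half_line \<Otimes>\<^sub>M half_line)" shows "meas (pair_cre k \<theta>)"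
proof (rule meas_intro)
  fix gs hs assume gh: "\<And>g. g \<in> set gs \<Longrightarrow> g \<in> measurable (particle_measure (length gs) (length hs)) half_line"
     "\<And>h. h \<in> set hs \<Longrightarrow> h \<in> measurable (particle_measure (length gs) (length hs)) half_line"
  let ?P = "particle_measure (length gs) (length hs)"
  have K: "(\<lambda>s. k ((gs!i) s) ((hs!j) s)) \<in> borel_measurable ?P" if "i < length gs" "j < length hs" for i j
    using measurable_compose[OF measurable_Pair[of "gs!i" ?P half_line "hs!j" half_line] assms(2)] gh that by auto
  have "(\<lambda>s. \<Sum>i<length gs. \<Sum>j<length hs. k ((gs!i) s) ((hs!j) s) * \<theta> (mset (map (\<lambda>g. g s) (take i gs @ drop (Suc i) gs))) (mset (map (\<lambda>h. h s) (take j hs @ drop (Suc j) hs)))) \<in> borel_measurable ?P"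
    by (intro borel_measurable_sum borel_measurable_times meas_section[OF assms(1)] K)
       (auto intro: gh dest: in_set_takeD in_set_dropD)
  then show "(\<lambda>s. pair_cre k \<theta> (mset (map (\<lambda>g. g s) gs)) (mset (map (\<lambda>h. h s) hs))) \<in> borel_measurable ?P"
    unfolding pair_cre_def by (subst sum_mset_remove_nth, subst sum_mset_remove_nth) (simp add: take_map drop_map)
qed

lemma meas_pair_ann:
  assumes "meas \<theta>" "(\<lambda>(x,y). k x y) \<in> borel_measurable (half_line \<Otimes>\<^sub>M half_line)" shows "meas (pair_ann k \<theta>)"
proof (rule meas_intro)
  fix gs hs assume gh: "\<And>g. g \<in> set gs \<Longrightarrow> g \<in> measurable (particle_measure (length gs) (length hs)) half_line"
     "\<And>h. h \<in> set hs \<Longrightarrow> h \<in> measurable (particle_measure (length gs) (length hs)) half_line"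
  let ?P = "particle_measure (length gs) (length hs)"
  let ?S = "(?P \<Otimes>\<^sub>M half_line) \<Otimes>\<^sub>M half_line"
  let ?l = "map (\<lambda>g. g \<circ> fst \<circ> fst)"
  have "(\<lambda>s. \<theta> (mset (map (\<lambda>g. g s) ((snd \<circ> fst) # ?l gs))) (mset (map (\<lambda>h. h s) (snd # ?l hs)))) \<in> borel_measurable ?S"
    by (rule meas_section[OF assms(1)]) (auto intro: gh measurable_comp[OF measurable_fst] measurable_comp[OF measurable_comp[OF measurable_fst measurable_fst]] measurable_snd measurable_comp[OF measurable_fst measurable_snd] simp: comp_assoc)
  moreover have "(\<lambda>s. (\<lambda>(x,y). k x y) (snd (fst s), snd s)) \<in> borel_measurable ?S"
    by (rule measurable_compose[OF _ assms(2)]) simp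
  ultimately have "(\<lambda>(s,y). k (snd s) y * \<theta> (add_mset (snd s) (mset (map (\<lambda>g. g (fst s)) gs))) (add_mset y (mset (map (\<lambda>h. h (fst s)) hs)))) \<in> borel_measurable ?S"
    by (auto simp: o_def split_def)
  then have "(\<lambda>s. \<integral>y. k (snd s) y * \<theta> (add_mset (snd s) (mset (map (\<lambda>g. g (fst s)) gs))) (add_mset y (mset (map (\<lambda>h. h (fst s)) hs))) \<partial>half_line) \<in> borel_measurable (?P \<Otimes>\<^sub>M half_line)"
    by (rule half_line.borel_measurable_lebesgue_integral)
  then have "(\<lambda>s. \<integral>x. (\<integral>y. k x y * \<theta> (add_mset x (mset (map (\<lambda>g. g s) gs))) (add_mset y (mset (map (\<lambda>h. h s) hs))) \<partial>half_line) \<partial>half_line) \<in> borel_measurable ?P"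
    by (intro half_line.borel_measurable_lebesgue_integral) (simp add: split_def)
  then show "(\<lambda>s. pair_ann k \<theta> (mset (map (\<lambda>g. g s) gs)) (mset (map (\<lambda>h. h s) hs))) \<in> borel_measurable ?P"
    by (simp add: pair_ann_def)
qed

lemma meas_cmul: "meas \<theta> \<Longrightarrow> meas (\<lambda>M N. c * \<theta> M N)"
  unfolding meas_def component_def split_def by (intro allI borel_measurable_times) auto
lemma meas_add: "meas \<theta> \<Longrightarrow> meas \<theta>' \<Longrightarrow> meas (\<lambda>M N. \<theta> M N + \<theta>' M N)"
  unfolding meas_def component_def split_def by (intro allI borel_measurable_add) auto
lemma meas_diff: "meas \<theta> \<Longrightarrow> meas \<theta>' \<Longrightarrow> meas (\<lambda>M N. \<theta> M N - \<theta>' M N)"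
  unfolding meas_def component_def split_def by (intro allI borel_measurable_diff) auto

section \<open>Bounded vectors supported over the interval\<close>

definition kcomp :: "(real \<Rightarrow> real \<Rightarrow> complex) \<Rightarrow> (real \<Rightarrow> real \<Rightarrow> complex) \<Rightarrow> real \<Rightarrow> real \<Rightarrow> complex" where
  "kcomp f g x y = (\<integral>z. f x z * g z y \<partial>half_line)"

locale levy_interval =
  fixes a b :: real
  assumes a_nonneg: "0 \<le> a" and a_less_b: "a < b"
begin

definition box_fun_le :: "real \<Rightarrow> (real \<Rightarrow> complex) \<Rightarrow> bool" where
  "box_fun_le B f \<longleftrightarrow> f \<in> borel_measurable half_line \<and> (\<forall>x. norm (f x) \<le> B) \<and> (\<forall>x. f x \<noteq> 0 \<longrightarrow> x \<in> {a..<b})"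

definition box_kernel_le :: "real \<Rightarrow> (real \<Rightarrow> real \<Rightarrow> complex) \<Rightarrow> bool" where
  "box_kernel_le B k \<longleftrightarrow> (\<lambda>(x,y). k x y) \<in> borel_measurable (half_line \<Otimes>\<^sub>M half_line) \<and> (\<forall>x y. norm (k x y) \<le> B)
     \<and> (\<forall>x y. k x y \<noteq> 0 \<longrightarrow> x \<in> {a..<b} \<and> y \<in> {a..<b})"

text \<open>A class of vectors stable under all operators that occur, on which all integrals converge absolutely. The
bound and the particle number are explicit because dominated convergence needs them uniformly in
the kernel of the operator.\<close>

definition nice_le :: "real \<Rightarrow> nat \<Rightarrow> fock2 \<Rightarrow> bool" where
  "nice_le C K \<theta> \<longleftrightarrow> meas \<theta> \<and> (\<forall>M N. norm (\<theta> M N) \<le> C)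
     \<and> (\<forall>M N. \<theta> M N \<noteq> 0 \<longrightarrow> set_mset M \<subseteq> {a..<b} \<and> set_mset N \<subseteq> {a..<b} \<and> size M + size N \<le> K)"

definition nice :: "fock2 \<Rightarrow> bool" where "nice \<theta> \<longleftrightarrow> (\<exists>C K. nice_le C K \<theta>)"
definition box_kernel :: "(real \<Rightarrow> real \<Rightarrow> complex) \<Rightarrow> bool" where "box_kernel k \<longleftrightarrow> (\<exists>B. box_kernel_le B k)"
definition box_fun :: "(real \<Rightarrow> complex) \<Rightarrow> bool" where "box_fun f \<longleftrightarrow> (\<exists>B. box_fun_le B f)"

lemma box_fun_le_nonneg: "box_fun_le B f \<Longrightarrow> 0 \<le> B" unfolding box_fun_le_def using norm_ge_zero order_trans by blast
lemma box_kernel_le_nonneg: "box_kernel_le B f \<Longrightarrow> 0 \<le> B" unfolding box_kernel_le_def using norm_ge_zero order_trans by blast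
lemma nice_le_nonneg: "nice_le C K f \<Longrightarrow> 0 \<le> C" unfolding nice_le_def using norm_ge_zero order_trans by blast

lemma box_subset: "{a..<b} \<subseteq> space half_line" using a_nonneg by (auto simp: space_half_line)

lemma emeasure_box: "emeasure half_line {a..<b} = ennreal (b - a)"
  using a_nonneg a_less_b unfolding half_line_def by (subst emeasure_restrict_space) auto

lemma box_sets [measurable]: "{a..<b} \<in> sets half_line"
  using a_nonneg unfolding half_line_def by (auto simp: sets_restrict_space_iff)

lemma box_fun_le_integrable:
  assumes "box_fun_le B f" shows "integrable half_line f"
  by (rule integrableI_bounded_set[where A="{a..<b}" and B=B])
     (use assms in \<open>auto simp: box_fun_le_def emeasure_box\<close>)

lemma box_fun_le_integral_bound:
  assumes "box_fun_le B f" shows "norm (\<integral>x. f x \<partial>half_line) \<le> B * (b - a)"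
proof -
  have i: "integrable half_line (\<lambda>x. B * indicator {a..<b} x :: real)"
    by (intro integrable_mult_right integrable_real_indicator) (auto simp: emeasure_box)
  have "norm (\<integral>x. f x \<partial>half_line) \<le> (\<integral>x. norm (f x) \<partial>half_line)" by (rule integral_norm_bound)
  also have "\<dots> \<le> (\<integral>x. B * indicator {a..<b} x \<partial>half_line)"
  proof (rule integral_mono)
    fix x show "norm (f x) \<le> B * indicator {a..<b} x"
      using assms by (cases "x \<in> {a..<b}") (auto simp: box_fun_le_def)
  qed (use box_fun_le_integrable[OF assms] i in auto)
  also have "\<dots> = B * (b - a)" using a_less_b by (simp add: measure_def emeasure_box)
  finally show ?thesis .
qed

lemma box_kernel_le_section:
  assumes "box_kernel_le B k" shows "box_fun_le B (k x)"
proof (cases "x \<in> {a..<b}")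
  case True
  then have "k x \<in> borel_measurable half_line"
    using measurable_Pair2[of "\<lambda>(x,y). k x y" half_line half_line borel x] assms box_subset by (auto simp: box_kernel_le_def)
  then show ?thesis using assms by (auto simp: box_kernel_le_def box_fun_le_def)
next
  case False
  then have "k x y = 0" for y using assms unfolding box_kernel_le_def by blast
  then have "k x = (\<lambda>_. 0)" by (simp add: fun_eq_iff)
  then show ?thesis using box_kernel_le_nonneg[OF assms] by (simp add: box_fun_le_def)
qed

lemma box_kernel_le_transpose: "box_kernel_le B k \<Longrightarrow> box_kernel_le B (\<lambda>x y. k y x)"
  unfolding box_kernel_le_def using measurable_pair_swap[of "\<lambda>(x,y). k x y" half_line half_line borel] by auto

lemma box_kernel_le_integral:
  assumes "box_kernel_le B k" shows "box_fun_le (B * (b - a)) (\<lambda>x. \<integral>y. k x y \<partial>half_line)"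
  unfolding box_fun_le_def
proof (intro conjI allI impI)
  show "(\<lambda>x. \<integral>y. k x y \<partial>half_line) \<in> borel_measurable half_line"
    using assms by (intro half_line.borel_measurable_lebesgue_integral) (simp add: box_kernel_le_def)
  show "norm (\<integral>y. k x y \<partial>half_line) \<le> B * (b - a)" for x
    by (rule box_fun_le_integral_bound) (rule box_kernel_le_section[OF assms])
  show "x \<in> {a..<b}" if "(\<integral>y. k x y \<partial>half_line) \<noteq> 0" for x
  proof (rule ccontr)
    assume "x \<notin> {a..<b}"
    then have "k x y = 0" for y using assms unfolding box_kernel_le_def by blast
    then have "k x = (\<lambda>_. 0)" by (simp add: fun_eq_iff)
    then show False using that by simp
  qed
qed

lemma box_kernel_le_Fubini:
  assumes "box_kernel_le B k"
  shows "(\<integral>x. (\<integral>y. k x y \<partial>half_line) \<partial>half_line) = (\<integral>y. (\<integral>x. k x y \<partial>half_line) \<partial>half_line)"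
proof -
  have "emeasure (half_line \<Otimes>\<^sub>M half_line) ({a..<b} \<times> {a..<b}) < \<infinity>"
    by (subst half_line.emeasure_pair_measure_Times) (auto simp: emeasure_box ennreal_mult_less_top)
  then have "integrable (half_line \<Otimes>\<^sub>M half_line) (\<lambda>(x,y). k x y)"
    by (intro integrableI_bounded_set[where A="{a..<b} \<times> {a..<b}" and B=B]) (use assms in \<open>auto simp: box_kernel_le_def\<close>)
  then show ?thesis by (rule half_line_pair.Fubini_integral[symmetric])
qed

definition bounded_meas :: "(real \<Rightarrow> real \<Rightarrow> complex) \<Rightarrow> bool" where
  "bounded_meas g \<longleftrightarrow> (\<lambda>(x,y). g x y) \<in> borel_measurable (half_line \<Otimes>\<^sub>M half_line) \<and> (\<exists>B. \<forall>x y. norm (g x y) \<le> B)"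

lemma box_kernel_le_mult_bounded_meas:
  assumes "box_kernel_le B k" "(\<lambda>(x,y). g x y) \<in> borel_measurable (half_line \<Otimes>\<^sub>M half_line)" "\<And>x y. norm (g x y) \<le> D"
  shows "box_kernel_le (B * D) (\<lambda>x y. k x y * g x y)"
  unfolding box_kernel_le_def
proof (intro conjI allI)
  show "(\<lambda>(x, y). k x y * g x y) \<in> borel_measurable (half_line \<Otimes>\<^sub>M half_line)"
    using assms(1,2) unfolding box_kernel_le_def split_def by (intro borel_measurable_times) auto
  show "norm (k x y * g x y) \<le> B * D" for x y
    using assms box_kernel_le_nonneg[OF assms(1)] by (simp add: norm_mult box_kernel_le_def mult_mono)
qed (use assms in \<open>auto simp: box_kernel_le_def\<close>)

lemma box_fun_le_mult:
  assumes "box_fun_le B f" "g \<in> borel_measurable half_line" "\<And>x. norm (g x) \<le> D"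
  shows "box_fun_le (B * D) (\<lambda>x. f x * g x)"
  using assms box_fun_le_nonneg[OF assms(1)] by (auto simp: box_fun_le_def norm_mult mult_mono)

lemma bounded_meas_mult: "bounded_meas f \<Longrightarrow> bounded_meas g \<Longrightarrow> bounded_meas (\<lambda>x y. f x y * g x y)"
proof -
  assume f: "bounded_meas f" and g: "bounded_meas g"
  obtain B where B: "\<And>x y. norm (f x y) \<le> B" using f by (auto simp: bounded_meas_def)
  obtain D where D: "\<And>x y. norm (g x y) \<le> D" using g by (auto simp: bounded_meas_def)
  have "norm (f x y * g x y) \<le> B * D" for x y
    using mult_mono[OF B D, of x y x y] order_trans[OF norm_ge_zero B] by (simp add: norm_mult)
  moreover have "(\<lambda>(x,y). f x y * g x y) \<in> borel_measurable (half_line \<Otimes>\<^sub>M half_line)"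
    using f g unfolding bounded_meas_def split_def by (intro borel_measurable_times) auto
  ultimately show ?thesis unfolding bounded_meas_def by blast
qed

lemma box_kernel_mult: "box_kernel k \<Longrightarrow> bounded_meas g \<Longrightarrow> box_kernel (\<lambda>x y. k x y * g x y)"
  unfolding box_kernel_def bounded_meas_def using box_kernel_le_mult_bounded_meas by blast

lemma box_kernel_bounded_meas: "box_kernel k \<Longrightarrow> bounded_meas k" unfolding box_kernel_def box_kernel_le_def bounded_meas_def by blast

lemma measurable_fst_snd:
  assumes "f \<in> borel_measurable half_line"
  shows "(\<lambda>(x,y). f x) \<in> borel_measurable (half_line \<Otimes>\<^sub>M half_line)"
    "(\<lambda>(x,y). f y) \<in> borel_measurable (half_line \<Otimes>\<^sub>M half_line)"
  unfolding split_def
  by (rule measurable_compose[OF measurable_fst assms]) (rule measurable_compose[OF measurable_snd assms])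

lemma bounded_meas_fst: "box_fun f \<Longrightarrow> bounded_meas (\<lambda>x y. f x)" and bounded_meas_snd: "box_fun f \<Longrightarrow> bounded_meas (\<lambda>x y. f y)"
  unfolding box_fun_def box_fun_le_def bounded_meas_def using measurable_fst_snd by blast+
lemma bounded_meas_const: "bounded_meas (\<lambda>x y. c)" unfolding bounded_meas_def by auto

lemma tensor_box_kernel_le:
  assumes "box_fun_le B f" "box_fun_le D g" shows "box_kernel_le (B * D) (\<lambda>x y. f x * g y)"
  unfolding box_kernel_le_def
proof (intro conjI allI impI)
  show "(\<lambda>(x,y). f x * g y) \<in> borel_measurable (half_line \<Otimes>\<^sub>M half_line)"
    unfolding split_def
    by (rule borel_measurable_times[OF measurable_compose[OF measurable_fst] measurable_compose[OF measurable_snd]])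
       (use assms in \<open>auto simp: box_fun_le_def\<close>)
  show "norm (f x * g y) \<le> B * D" for x y
    using assms box_fun_le_nonneg[OF assms(1)] unfolding norm_mult box_fun_le_def by (intro mult_mono) auto
  show "x \<in> {a..<b}" "y \<in> {a..<b}" if "f x * g y \<noteq> 0" for x y
    using that assms unfolding box_fun_le_def by auto
qed

text \<open>Configurations with a particle off the half-line are invisible to the component measures; there
the support condition makes the vector vanish.\<close>

lemma nice_section:
  assumes "nice \<theta>" and gs: "\<And>g. g \<in> set gs \<Longrightarrow> g \<in> measurable S half_line"
    and hs: "\<And>h. h \<in> set hs \<Longrightarrow> h \<in> measurable S half_line"
  shows "(\<lambda>s. \<theta> (mset (map (\<lambda>g. g s) gs) + M) (mset (map (\<lambda>h. h s) hs) + N)) \<in> borel_measurable S"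
proof (cases "set_mset M \<subseteq> {a..<b} \<and> set_mset N \<subseteq> {a..<b}")
  case True
  obtain xs ys where xy: "M = mset xs" "N = mset ys" using ex_mset[of M] ex_mset[of N] by blast
  have c: "g \<in> measurable S half_line" if g: "g \<in> set (map (\<lambda>x _. x) zs)" and zs: "set zs \<subseteq> {a..<b}" for g zs
  proof -
    from g have "g \<in> (\<lambda>z _. z) ` set zs" by simp
    then obtain z where z: "z \<in> set zs" "g = (\<lambda>_. z)" by (rule imageE) (rule that)
    have "z \<in> space half_line" using z(1) zs box_subset by blast
    then show ?thesis unfolding z(2) by (rule measurable_const)
  qed
  have "(\<lambda>s. \<theta> (mset (map (\<lambda>g. g s) (gs @ map (\<lambda>x _. x) xs))) (mset (map (\<lambda>h. h s) (hs @ map (\<lambda>x _. x) ys)))) \<in> borel_measurable S"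
  proof (rule meas_section)
    show "meas \<theta>" using assms(1) unfolding nice_def nice_le_def by blast
    show "g \<in> measurable S half_line" if "g \<in> set (gs @ map (\<lambda>x _. x) xs)" for g
      using that gs[of g] c[of g xs] True xy by (metis set_append Un_iff set_mset_mset)
    show "h \<in> measurable S half_line" if "h \<in> set (hs @ map (\<lambda>x _. x) ys)" for h
      using that hs[of h] c[of h ys] True xy by (metis set_append Un_iff set_mset_mset)
  qed
  moreover have "map (\<lambda>g. g s) (map (\<lambda>x _. x) zs) = zs" for s :: 'a and zs :: "real list"
    by (induction zs) auto
  ultimately show ?thesis by (simp only: xy map_append mset_append)
next
  case False
  obtain C K where t: "nice_le C K \<theta>" using assms(1) by (auto simp: nice_def)
  have z: "\<theta> (X + M) (Y + N) = 0" for X Y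
  proof (rule ccontr)
    assume "\<theta> (X + M) (Y + N) \<noteq> 0"
    then have "set_mset (X + M) \<subseteq> {a..<b}" "set_mset (Y + N) \<subseteq> {a..<b}" using t unfolding nice_le_def by blast+
    then show False using False by auto
  qed
  show ?thesis unfolding z by (rule measurable_const) simp
qed

lemma nice_bounded: "nice \<theta> \<Longrightarrow> \<exists>C. \<forall>M N. norm (\<theta> M N) \<le> C"
  unfolding nice_def nice_le_def by blast

lemma measurable_nice_left:
  assumes "nice \<theta>" shows "(\<lambda>x. \<theta> (add_mset x M) N) \<in> borel_measurable half_line"
proof -
  have "(\<lambda>s. \<theta> (mset (map (\<lambda>g. g s) [\<lambda>x. x]) + M) (mset (map (\<lambda>h. h s) []) + N)) \<in> borel_measurable half_line"
    by (rule nice_section[OF assms]) (simp_all add: measurable_ident_sets)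
  then show ?thesis by simp
qed

lemma measurable_nice_right:
  assumes "nice \<theta>" shows "(\<lambda>x. \<theta> M (add_mset x N)) \<in> borel_measurable half_line"
proof -
  have "(\<lambda>s. \<theta> (mset (map (\<lambda>g. g s) []) + M) (mset (map (\<lambda>h. h s) [\<lambda>x. x]) + N)) \<in> borel_measurable half_line"
    by (rule nice_section[OF assms]) (simp_all add: measurable_ident_sets)
  then show ?thesis by simp
qed

lemma bounded_meas_nice:
  assumes "nice \<theta>"
  shows "bounded_meas (\<lambda>x y. \<theta> (add_mset x M) (add_mset y N))"
    "bounded_meas (\<lambda>x y. \<theta> (add_mset x M) N)" "bounded_meas (\<lambda>x y. \<theta> M (add_mset y N))"
proof -
  let ?S = "half_line \<Otimes>\<^sub>M half_line"
  have 1: "(\<lambda>s. \<theta> (mset (map (\<lambda>g. g s) [fst]) + M) (mset (map (\<lambda>h. h s) [snd]) + N)) \<in> borel_measurable ?S"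
    by (rule nice_section[OF assms]) simp_all
  have 2: "(\<lambda>s. \<theta> (mset (map (\<lambda>g. g s) [fst]) + M) (mset (map (\<lambda>h. h s) []) + N)) \<in> borel_measurable ?S"
    by (rule nice_section[OF assms]) simp_all
  have 3: "(\<lambda>s. \<theta> (mset (map (\<lambda>g. g s) []) + M) (mset (map (\<lambda>h. h s) [snd]) + N)) \<in> borel_measurable ?S"
    by (rule nice_section[OF assms]) simp_all
  obtain C where "\<And>M N. norm (\<theta> M N) \<le> C" using nice_bounded[OF assms] by blast
  with 1 2 3 show "bounded_meas (\<lambda>x y. \<theta> (add_mset x M) (add_mset y N))"
    "bounded_meas (\<lambda>x y. \<theta> (add_mset x M) N)" "bounded_meas (\<lambda>x y. \<theta> M (add_mset y N))"
    unfolding bounded_meas_def split_def by (auto intro!: exI[of _ C])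
qed

lemma nice_le_nice: "nice_le C K \<theta> \<Longrightarrow> nice \<theta>" by (auto simp: nice_def)
lemma box_kernel_le_box_kernel: "box_kernel_le B k \<Longrightarrow> box_kernel k" by (auto simp: box_kernel_def)
lemma nice_le_norm_le: "nice_le C K \<theta> \<Longrightarrow> norm (\<theta> M N) \<le> C" by (simp add: nice_le_def)

lemma box_fun_le_nice_left: "box_fun_le B f \<Longrightarrow> nice_le C K \<theta> \<Longrightarrow> box_fun_le (B * C) (\<lambda>x. f x * \<theta> (add_mset x M) N)"
  by (intro box_fun_le_mult measurable_nice_left nice_le_nice nice_le_norm_le)
lemma box_fun_le_nice_right: "box_fun_le B f \<Longrightarrow> nice_le C K \<theta> \<Longrightarrow> box_fun_le (B * C) (\<lambda>x. f x * \<theta> M (add_mset x N))"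
  by (intro box_fun_le_mult measurable_nice_right nice_le_nice nice_le_norm_le)
lemma box_kernel_le_nice: "box_kernel_le B k \<Longrightarrow> nice_le C K \<theta> \<Longrightarrow> box_kernel_le (B * C) (\<lambda>x y. k x y * \<theta> (add_mset x M) (add_mset y N))"
  using bounded_meas_nice(1)[OF nice_le_nice, of C K \<theta> M N] unfolding bounded_meas_def by (intro box_kernel_le_mult_bounded_meas nice_le_norm_le) auto

lemma integrable_left: "box_fun f \<Longrightarrow> nice \<theta> \<Longrightarrow> integrable half_line (\<lambda>x. f x * \<theta> (add_mset x M) N)"
  unfolding box_fun_def nice_def by (elim exE, rule box_fun_le_integrable, rule box_fun_le_nice_left)
lemma integrable_right: "box_fun f \<Longrightarrow> nice \<theta> \<Longrightarrow> integrable half_line (\<lambda>x. f x * \<theta> M (add_mset x N))"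
  unfolding box_fun_def nice_def by (elim exE, rule box_fun_le_integrable, rule box_fun_le_nice_right)

lemma norm_sum_mset_le:
  fixes f :: "real \<Rightarrow> complex"
  assumes "\<forall>x\<in>#M. norm (f x) \<le> B" shows "norm (\<Sum>x\<in>#M. f x) \<le> real (size M) * B"
  using assms
proof (induction M)
  case empty show ?case by simp
next
  case (add x M)
  have "norm (\<Sum>x\<in>#add_mset x M. f x) = norm (f x + (\<Sum>x\<in>#M. f x))" by simp
  also have "\<dots> \<le> norm (f x) + norm (\<Sum>x\<in>#M. f x)" by (rule norm_triangle_ineq)
  also have "norm (f x) \<le> B" using add.prems by simp
  also have "norm (\<Sum>x\<in>#M. f x) \<le> real (size M) * B" using add.prems by (intro add.IH) simp
  also have "B + real (size M) * B = real (size (add_mset x M)) * B" by (simp add: distrib_right)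
  finally show ?case by simp
qed

lemma sum_mset_nonzero: "(\<Sum>x\<in>#M. f x) \<noteq> (0::complex) \<Longrightarrow> \<exists>x\<in>#M. f x \<noteq> 0"
  by (induction M) auto

lemma integral_nonzero:
  assumes "(\<integral>x. f x \<partial>S) \<noteq> (0::complex)" shows "\<exists>x. f x \<noteq> 0"
proof (rule ccontr)
  assume "\<nexists>x. f x \<noteq> 0"
  then have "f = (\<lambda>_. 0)" by (simp add: fun_eq_iff)
  then show False using assms by simp
qed

lemma nice_le_support:
  assumes "nice_le C K \<theta>" "\<theta> M N \<noteq> 0"
  shows "set_mset M \<subseteq> {a..<b}" "set_mset N \<subseteq> {a..<b}" "size M + size N \<le> K"
proof -
  have "set_mset M \<subseteq> {a..<b} \<and> set_mset N \<subseteq> {a..<b} \<and> size M + size N \<le> K"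
    by (rule assms(1)[unfolded nice_le_def, THEN conjunct2, THEN conjunct2, rule_format, OF assms(2)])
  then show "set_mset M \<subseteq> {a..<b}" "set_mset N \<subseteq> {a..<b}" "size M + size N \<le> K" by simp_all
qed

lemma nice_le_intro:
  assumes "meas \<theta>" and "0 \<le> C"
    and "\<And>M N. size M + size N \<le> K \<Longrightarrow> norm (\<theta> M N) \<le> C"
    and "\<And>M N. \<theta> M N \<noteq> 0 \<Longrightarrow> set_mset M \<subseteq> {a..<b} \<and> set_mset N \<subseteq> {a..<b} \<and> size M + size N \<le> K"
  shows "nice_le C K \<theta>"
  unfolding nice_le_def
proof (intro conjI allI impI)
  show "norm (\<theta> M N) \<le> C" for M N
  proof (cases "\<theta> M N = 0")
    case False
    show ?thesis using assms(4)[OF False] by (intro assms(3)) simp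
  qed (simp add: assms(2))
  show "meas \<theta>" by (rule assms(1))
  show "set_mset M \<subseteq> {a..<b}" "set_mset N \<subseteq> {a..<b}" "size M + size N \<le> K" if "\<theta> M N \<noteq> 0" for M N
    using assms(4)[OF that] by simp_all
qed

lemma subset_remove:
  assumes "x \<in># M" "set_mset (M - {#x#}) \<subseteq> A" "x \<in> A" shows "set_mset M \<subseteq> A"
proof -
  have "set_mset M = insert x (set_mset (M - {#x#}))"
    using insert_DiffM[OF assms(1)] by (metis set_mset_add_mset_insert)
  then show ?thesis using assms(2,3) by simp
qed

lemma size_remove: "x \<in># M \<Longrightarrow> Suc (size (M - {#x#})) = size M"
  by (rule size_Suc_Diff1)

lemma nice_le_ann_left:
  assumes f: "box_fun_le B f" and t: "nice_le C K \<theta>" shows "nice_le (B * C * (b - a)) K (ann_left f \<theta>)"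
proof (rule nice_le_intro)
  show "meas (ann_left f \<theta>)" using assms by (intro meas_ann_left) (auto simp: nice_le_def box_fun_le_def)
  show "0 \<le> B * C * (b - a)" using box_fun_le_nonneg[OF f] nice_le_nonneg[OF t] a_less_b by simp
  show "norm (ann_left f \<theta> M N) \<le> B * C * (b - a)" for M N
    unfolding ann_left_def by (rule box_fun_le_integral_bound) (rule box_fun_le_nice_left[OF f t])
  fix M N assume "ann_left f \<theta> M N \<noteq> 0"
  then obtain x where "\<theta> (add_mset x M) N \<noteq> 0" unfolding ann_left_def by (drule_tac integral_nonzero) auto
  from nice_le_support[OF t this] show "set_mset M \<subseteq> {a..<b} \<and> set_mset N \<subseteq> {a..<b} \<and> size M + size N \<le> K" by auto
qed

lemma nice_le_cre_left:
  assumes f: "box_fun_le B f" and t: "nice_le C K \<theta>" shows "nice_le (real (Suc K) * (B * C)) (Suc K) (cre_left f \<theta>)"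
proof (rule nice_le_intro)
  note nn = box_fun_le_nonneg[OF f] nice_le_nonneg[OF t]
  show "meas (cre_left f \<theta>)" using assms by (intro meas_cre_left) (auto simp: nice_le_def box_fun_le_def)
  show "0 \<le> real (Suc K) * (B * C)" using nn by simp
  show "norm (cre_left f \<theta> M N) \<le> real (Suc K) * (B * C)" if "size M + size N \<le> Suc K" for M N
  proof -
    have "norm (cre_left f \<theta> M N) \<le> real (size M) * (B * C)" unfolding cre_left_def
      by (intro norm_sum_mset_le ballI) (use f nn nice_le_norm_le[OF t] in \<open>auto simp: norm_mult box_fun_le_def intro!: mult_mono\<close>)
    also have "\<dots> \<le> real (Suc K) * (B * C)" using that nn by (intro mult_right_mono) auto
    finally show ?thesis .
  qed
  fix M N assume "cre_left f \<theta> M N \<noteq> 0"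
  then obtain x where x: "x \<in># M" "f x \<noteq> 0" "\<theta> (M - {#x#}) N \<noteq> 0" unfolding cre_left_def by (drule_tac sum_mset_nonzero) auto
  have "x \<in> {a..<b}" using x f by (auto simp: box_fun_le_def)
  then show "set_mset M \<subseteq> {a..<b} \<and> set_mset N \<subseteq> {a..<b} \<and> size M + size N \<le> Suc K"
    using nice_le_support[OF t x(3)] subset_remove[OF x(1)] size_remove[OF x(1)] by auto
qed

lemma nice_le_swap2:
  assumes "nice_le C K \<theta>" shows "nice_le C K (swap2 \<theta>)"
  unfolding nice_le_def
proof (intro conjI allI impI)
  show "meas (swap2 \<theta>)" using assms by (intro meas_swap2) (simp add: nice_le_def)
  show "norm (swap2 \<theta> M N) \<le> C" for M N using nice_le_norm_le[OF assms] by (simp add: swap2_def)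
  fix M N assume "swap2 \<theta> M N \<noteq> 0"
  then have "\<theta> N M \<noteq> 0" by (simp add: swap2_def)
  from nice_le_support[OF assms this]
  show "set_mset M \<subseteq> {a..<b}" "set_mset N \<subseteq> {a..<b}" "size M + size N \<le> K" by auto
qed

lemma nice_le_ann_right: "box_fun_le B f \<Longrightarrow> nice_le C K \<theta> \<Longrightarrow> nice_le (B * C * (b - a)) K (ann_right f \<theta>)"
  unfolding ann_right_swap by (intro nice_le_swap2 nice_le_ann_left)
lemma nice_le_cre_right: "box_fun_le B f \<Longrightarrow> nice_le C K \<theta> \<Longrightarrow> nice_le (real (Suc K) * (B * C)) (Suc K) (cre_right f \<theta>)"
  unfolding cre_right_swap by (intro nice_le_swap2 nice_le_cre_left)

lemma nice_le_hop_left: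
  assumes k: "box_kernel_le B k" and t: "nice_le C K \<theta>" shows "nice_le (real K * (B * C * (b - a))) K (hop_left k \<theta>)"
proof (rule nice_le_intro)
  note nn = box_kernel_le_nonneg[OF k] nice_le_nonneg[OF t]
  show "meas (hop_left k \<theta>)" using assms by (intro meas_hop_left) (auto simp: nice_le_def box_kernel_le_def)
  have bc: "0 \<le> B * C * (b - a)" using nn a_less_b by (intro mult_nonneg_nonneg) auto
  show "0 \<le> real K * (B * C * (b - a))" by (intro mult_nonneg_nonneg bc) simp
  show "norm (hop_left k \<theta> M N) \<le> real K * (B * C * (b - a))" if "size M + size N \<le> K" for M N
  proof -
    have "norm (\<integral>y. k x y * \<theta> (add_mset y M') N \<partial>half_line) \<le> B * C * (b - a)" for x M'
      by (rule box_fun_le_integral_bound) (rule box_fun_le_nice_left[OF box_kernel_le_section[OF k] t])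
    then have "norm (hop_left k \<theta> M N) \<le> real (size M) * (B * C * (b - a))"
      unfolding hop_left_def by (rule_tac norm_sum_mset_le) blast
    also have "\<dots> \<le> real K * (B * C * (b - a))" using that by (intro mult_right_mono bc) simp
    finally show ?thesis .
  qed
  fix M N assume "hop_left k \<theta> M N \<noteq> 0"
  then have "\<exists>x\<in>#M. (\<integral>y. k x y * \<theta> (add_mset y (M - {#x#})) N \<partial>half_line) \<noteq> 0"
    unfolding hop_left_def by (rule sum_mset_nonzero)
  then obtain x where x: "x \<in># M" "(\<integral>y. k x y * \<theta> (add_mset y (M - {#x#})) N \<partial>half_line) \<noteq> 0" by blast
  obtain y where y: "k x y * \<theta> (add_mset y (M - {#x#})) N \<noteq> 0" using integral_nonzero[OF x(2)] by blast
  then have "k x y \<noteq> 0" by simp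
  then have "x \<in> {a..<b}" using k unfolding box_kernel_le_def by blast
  moreover have nz: "\<theta> (add_mset y (M - {#x#})) N \<noteq> 0" using y by simp
  have "set_mset (M - {#x#}) \<subseteq> {a..<b}" using nice_le_support(1)[OF t nz] by simp
  ultimately have "set_mset M \<subseteq> {a..<b}" using subset_remove[OF x(1)] by blast
  then show "set_mset M \<subseteq> {a..<b} \<and> set_mset N \<subseteq> {a..<b} \<and> size M + size N \<le> K"
    using nice_le_support(2,3)[OF t nz] size_remove[OF x(1)] by simp
qed

lemma nice_le_hop_right: "box_kernel_le B k \<Longrightarrow> nice_le C K \<theta> \<Longrightarrow> nice_le (real K * (B * C * (b - a))) K (hop_right k \<theta>)"
  unfolding hop_right_swap by (rule nice_le_swap2, rule nice_le_hop_left, erule box_kernel_le_transpose, erule nice_le_swap2)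

lemma nice_le_pair_cre:
  assumes k: "box_kernel_le B k" and t: "nice_le C K \<theta>" shows "nice_le (real (K + 2) * (real (K + 2) * (B * C))) (K + 2) (pair_cre k \<theta>)"
proof (rule nice_le_intro)
  note nn = box_kernel_le_nonneg[OF k] nice_le_nonneg[OF t]
  show "meas (pair_cre k \<theta>)" using assms by (intro meas_pair_cre) (auto simp: nice_le_def box_kernel_le_def)
  show "0 \<le> real (K + 2) * (real (K + 2) * (B * C))" using nn by simp
  show "norm (pair_cre k \<theta> M N) \<le> real (K + 2) * (real (K + 2) * (B * C))" if "size M + size N \<le> K + 2" for M N
  proof -
    have kt: "norm (k x y * \<theta> M' N') \<le> B * C" for x y M' N'
      using k nn nice_le_norm_le[OF t] unfolding norm_mult box_kernel_le_def by (intro mult_mono) auto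
    have "norm (pair_cre k \<theta> M N) \<le> real (size M) * (real (size N) * (B * C))" unfolding pair_cre_def
      by (intro norm_sum_mset_le ballI kt)
    also have "\<dots> \<le> real (K + 2) * (real (K + 2) * (B * C))" using that nn by (intro mult_mono) auto
    finally show ?thesis .
  qed
  fix M N assume "pair_cre k \<theta> M N \<noteq> 0"
  then have "\<exists>x\<in>#M. (\<Sum>y\<in>#N. k x y * \<theta> (M - {#x#}) (N - {#y#})) \<noteq> 0"
    unfolding pair_cre_def by (rule sum_mset_nonzero)
  then obtain x where x: "x \<in># M" "(\<Sum>y\<in>#N. k x y * \<theta> (M - {#x#}) (N - {#y#})) \<noteq> 0" by blast
  obtain y where y: "y \<in># N" "k x y * \<theta> (M - {#x#}) (N - {#y#}) \<noteq> 0" using sum_mset_nonzero[OF x(2)] by blast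
  then have "k x y \<noteq> 0" by simp
  then have "x \<in> {a..<b}" "y \<in> {a..<b}" using k unfolding box_kernel_le_def by blast+
  moreover have nz: "\<theta> (M - {#x#}) (N - {#y#}) \<noteq> 0" using y by simp
  ultimately have "set_mset M \<subseteq> {a..<b}" "set_mset N \<subseteq> {a..<b}"
    using subset_remove[OF x(1) nice_le_support(1)[OF t nz]] subset_remove[OF y(1) nice_le_support(2)[OF t nz]] by blast+
  then show "set_mset M \<subseteq> {a..<b} \<and> set_mset N \<subseteq> {a..<b} \<and> size M + size N \<le> K + 2"
    using nice_le_support(3)[OF t nz] size_remove[OF x(1)] size_remove[OF y(1)] by simp
qed

lemma nice_le_pair_ann:
  assumes k: "box_kernel_le B k" and t: "nice_le C K \<theta>" shows "nice_le (B * C * (b - a) * (b - a)) K (pair_ann k \<theta>)"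
proof (rule nice_le_intro)
  note nn = box_kernel_le_nonneg[OF k] nice_le_nonneg[OF t]
  show "meas (pair_ann k \<theta>)" using assms by (intro meas_pair_ann) (auto simp: nice_le_def box_kernel_le_def)
  show "0 \<le> B * C * (b - a) * (b - a)" using nn a_less_b by simp
  show "norm (pair_ann k \<theta> M N) \<le> B * C * (b - a) * (b - a)" for M N
    unfolding pair_ann_def by (rule box_fun_le_integral_bound, rule box_kernel_le_integral, rule box_kernel_le_nice[OF k t])
  fix M N assume "pair_ann k \<theta> M N \<noteq> 0"
  then have "\<exists>x. (\<integral>y. k x y * \<theta> (add_mset x M) (add_mset y N) \<partial>half_line) \<noteq> 0" unfolding pair_ann_def by (rule integral_nonzero)
  then obtain x where x: "(\<integral>y. k x y * \<theta> (add_mset x M) (add_mset y N) \<partial>half_line) \<noteq> 0" by blast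
  obtain y where "k x y * \<theta> (add_mset x M) (add_mset y N) \<noteq> 0" using integral_nonzero[OF x] by blast
  then have "\<theta> (add_mset x M) (add_mset y N) \<noteq> 0" by simp
  from nice_le_support[OF t this] show "set_mset M \<subseteq> {a..<b} \<and> set_mset N \<subseteq> {a..<b} \<and> size M + size N \<le> K" by auto
qed

lemma nice_le_cmul:
  assumes "nice_le C K \<theta>" shows "nice_le (norm c * C) K (\<lambda>M N. c * \<theta> M N)"
  unfolding nice_le_def
proof (intro conjI allI impI)
  show "meas (\<lambda>M N. c * \<theta> M N)" using assms by (intro meas_cmul) (simp add: nice_le_def)
  show "norm (c * \<theta> M N) \<le> norm c * C" for M N using nice_le_norm_le[OF assms] by (simp add: norm_mult mult_left_mono)
  fix M N assume "c * \<theta> M N \<noteq> 0"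
  then have "\<theta> M N \<noteq> 0" by simp
  from nice_le_support[OF assms this]
  show "set_mset M \<subseteq> {a..<b}" "set_mset N \<subseteq> {a..<b}" "size M + size N \<le> K" by auto
qed

lemma nice_le_add: "nice_le C K \<theta> \<Longrightarrow> nice_le C' K' \<theta>' \<Longrightarrow> nice_le (C + C') (max K K') (\<lambda>M N. \<theta> M N + \<theta>' M N)"
proof -
  assume A: "nice_le C K \<theta>" "nice_le C' K' \<theta>'"
  show ?thesis unfolding nice_le_def
  proof (intro conjI allI impI)
    show "meas (\<lambda>M N. \<theta> M N + \<theta>' M N)" using A by (intro meas_add) (auto simp: nice_le_def)
    show "norm (\<theta> M N + \<theta>' M N) \<le> C + C'" for M N
      by (rule norm_triangle_mono[OF nice_le_norm_le nice_le_norm_le]) (rule A)+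
    fix M N assume "\<theta> M N + \<theta>' M N \<noteq> 0"
    then consider "\<theta> M N \<noteq> 0" | "\<theta>' M N \<noteq> 0" by fastforce
    then have "set_mset M \<subseteq> {a..<b} \<and> set_mset N \<subseteq> {a..<b} \<and> size M + size N \<le> max K K'"
    proof cases
      case 1 from nice_le_support[OF A(1) this] show ?thesis by auto
    next
      case 2 from nice_le_support[OF A(2) this] show ?thesis by auto
    qed
    then show "set_mset M \<subseteq> {a..<b}" "set_mset N \<subseteq> {a..<b}" "size M + size N \<le> max K K'" by auto
  qed
qed

lemma nice_add: "nice \<theta> \<Longrightarrow> nice \<theta>' \<Longrightarrow> nice (\<lambda>M N. \<theta> M N + \<theta>' M N)"
  unfolding nice_def by (elim exE, intro exI, rule nice_le_add)
lemma nice_cmul: "nice \<theta> \<Longrightarrow> nice (\<lambda>M N. c * \<theta> M N)"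
  unfolding nice_def by (elim exE, intro exI, rule nice_le_cmul)
lemma nice_zero: "nice (\<lambda>M N. 0)"
  unfolding nice_def nice_le_def meas_def component_def by (intro exI[of _ 0]) auto
lemma nice_sum: "(\<And>j. j \<in> J \<Longrightarrow> nice (F j)) \<Longrightarrow> nice (\<lambda>M N. \<Sum>j\<in>J. F j M N)"
  by (induction J rule: infinite_finite_induct) (auto intro: nice_zero nice_add)
lemma nice_ann_left: "box_fun f \<Longrightarrow> nice \<theta> \<Longrightarrow> nice (ann_left f \<theta>)" unfolding nice_def box_fun_def by (elim exE, intro exI, rule nice_le_ann_left)
lemma nice_ann_right: "box_fun f \<Longrightarrow> nice \<theta> \<Longrightarrow> nice (ann_right f \<theta>)" unfolding nice_def box_fun_def by (elim exE, intro exI, rule nice_le_ann_right)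
lemma nice_cre_left: "box_fun f \<Longrightarrow> nice \<theta> \<Longrightarrow> nice (cre_left f \<theta>)" unfolding nice_def box_fun_def by (elim exE, intro exI, rule nice_le_cre_left)
lemma nice_cre_right: "box_fun f \<Longrightarrow> nice \<theta> \<Longrightarrow> nice (cre_right f \<theta>)" unfolding nice_def box_fun_def by (elim exE, intro exI, rule nice_le_cre_right)
lemma nice_hop_left: "box_kernel k \<Longrightarrow> nice \<theta> \<Longrightarrow> nice (hop_left k \<theta>)" unfolding nice_def box_kernel_def by (elim exE, intro exI, rule nice_le_hop_left)
lemma nice_hop_right: "box_kernel k \<Longrightarrow> nice \<theta> \<Longrightarrow> nice (hop_right k \<theta>)" unfolding nice_def box_kernel_def by (elim exE, intro exI, rule nice_le_hop_right)
lemma nice_pair_cre: "box_kernel k \<Longrightarrow> nice \<theta> \<Longrightarrow> nice (pair_cre k \<theta>)" unfolding nice_def box_kernel_def by (elim exE, intro exI, rule nice_le_pair_cre)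
lemma nice_pair_ann: "box_kernel k \<Longrightarrow> nice \<theta> \<Longrightarrow> nice (pair_ann k \<theta>)" unfolding nice_def box_kernel_def by (elim exE, intro exI, rule nice_le_pair_ann)

end

section \<open>Linearity, composition of kernels and commutation relations\<close>

context levy_interval begin

lemma box_kernel_add: "box_kernel f \<Longrightarrow> box_kernel g \<Longrightarrow> box_kernel (\<lambda>x y. f x y + g x y)"
proof -
  assume "box_kernel f" "box_kernel g"
  then obtain B D where B: "box_kernel_le B f" "box_kernel_le D g" by (auto simp: box_kernel_def)
  have "box_kernel_le (B + D) (\<lambda>x y. f x y + g x y)"
    unfolding box_kernel_le_def
  proof (intro conjI allI impI)
    show "(\<lambda>(x, y). f x y + g x y) \<in> borel_measurable (half_line \<Otimes>\<^sub>M half_line)"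
      using B unfolding box_kernel_le_def split_def by (intro borel_measurable_add) auto
    show "norm (f x y + g x y) \<le> B + D" for x y using B by (intro norm_triangle_mono) (auto simp: box_kernel_le_def)
    show "x \<in> {a..<b}" "y \<in> {a..<b}" if nz: "f x y + g x y \<noteq> 0" for x y
    proof -
      have "f x y \<noteq> 0 \<or> g x y \<noteq> 0" using nz by auto
      then show "x \<in> {a..<b}" "y \<in> {a..<b}" using B unfolding box_kernel_le_def by blast+
    qed
  qed
  then show ?thesis by (auto simp: box_kernel_def)
qed

lemma box_kernel_cmul: "box_kernel f \<Longrightarrow> box_kernel (\<lambda>x y. c * f x y)"
  using box_kernel_mult[OF _ bounded_meas_const[of c]] by (simp add: mult.commute)
lemma box_kernel_zero: "box_kernel (\<lambda>x y. 0)" unfolding box_kernel_def box_kernel_le_def by auto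
lemma box_kernel_sum_mset: "(\<And>z. z \<in># M \<Longrightarrow> box_kernel (F z)) \<Longrightarrow> box_kernel (\<lambda>x y. \<Sum>z\<in>#M. F z x y)"
  by (induction M) (auto intro: box_kernel_zero box_kernel_add)
lemma box_kernel_sum: "(\<And>z. z \<in> J \<Longrightarrow> box_kernel (F z)) \<Longrightarrow> box_kernel (\<lambda>x y. \<Sum>z\<in>J. F z x y)"
  by (induction J rule: infinite_finite_induct) (auto intro: box_kernel_zero box_kernel_add)
lemma box_kernel_diff: "box_kernel f \<Longrightarrow> box_kernel g \<Longrightarrow> box_kernel (\<lambda>x y. f x y - g x y)"
  using box_kernel_add[OF _ box_kernel_cmul, of f g "-1"] by simp
lemma box_kernel_transpose: "box_kernel k \<Longrightarrow> box_kernel (\<lambda>x y. k y x)" unfolding box_kernel_def by (elim exE, rule exI, rule box_kernel_le_transpose)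
lemma box_kernel_section: "box_kernel k \<Longrightarrow> box_fun (k x)" unfolding box_kernel_def box_fun_def by (elim exE, rule exI, rule box_kernel_le_section)
lemma box_kernel_section': "box_kernel k \<Longrightarrow> box_fun (\<lambda>x. k x y)" using box_kernel_section[OF box_kernel_transpose] .
lemma box_kernel_integral: "box_kernel k \<Longrightarrow> box_fun (\<lambda>x. \<integral>y. k x y \<partial>half_line)" unfolding box_kernel_def box_fun_def by (elim exE, rule exI, rule box_kernel_le_integral)
lemma box_kernel_Fubini: "box_kernel k \<Longrightarrow> (\<integral>x. (\<integral>y. k x y \<partial>half_line) \<partial>half_line) = (\<integral>y. (\<integral>x. k x y \<partial>half_line) \<partial>half_line)"
  unfolding box_kernel_def by (elim exE, rule box_kernel_le_Fubini)
lemma box_fun_integrable: "box_fun f \<Longrightarrow> integrable half_line f" unfolding box_fun_def by (elim exE, rule box_fun_le_integrable)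
lemma box_fun_mult: "box_fun f \<Longrightarrow> box_fun g \<Longrightarrow> box_fun (\<lambda>x. f x * g x)"
  unfolding box_fun_def by (elim exE, rule exI, rule box_fun_le_mult) (auto simp: box_fun_le_def)
lemma box_fun_mult_const: "box_fun f \<Longrightarrow> box_fun (\<lambda>x. f x * c)"
  unfolding box_fun_def by (elim exE, rule exI, rule box_fun_le_mult) auto
lemma box_kernel_nice: "box_kernel k \<Longrightarrow> nice \<theta> \<Longrightarrow> box_kernel (\<lambda>x y. k x y * \<theta> (add_mset x M) (add_mset y N))"
  by (intro box_kernel_mult bounded_meas_nice(1))
lemma box_kernel_tensor: "box_fun f \<Longrightarrow> box_fun g \<Longrightarrow> box_kernel (\<lambda>x y. f x * g y)"
  unfolding box_fun_def box_kernel_def by (elim exE, rule exI, rule tensor_box_kernel_le)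

definition int2 :: "(real \<Rightarrow> real \<Rightarrow> complex) \<Rightarrow> complex" where
  "int2 F = (\<integral>x. (\<integral>y. F x y \<partial>half_line) \<partial>half_line)"

lemma int2_add: "box_kernel F \<Longrightarrow> box_kernel G \<Longrightarrow> int2 (\<lambda>x y. F x y + G x y) = int2 F + int2 G"
  by (simp add: int2_def Bochner_Integration.integral_add box_fun_integrable box_kernel_section box_kernel_integral)
lemma int2_cmul: "int2 (\<lambda>x y. c * F x y) = c * int2 F"
  by (simp add: int2_def)
lemma int2_mult_const: "int2 (\<lambda>x y. F x y * c) = int2 F * c"
  by (simp add: int2_def)
lemma int2_sum_mset: "(\<And>z. z \<in># M \<Longrightarrow> box_kernel (F z)) \<Longrightarrow> int2 (\<lambda>x y. \<Sum>z\<in>#M. F z x y) = (\<Sum>z\<in>#M. int2 (F z))"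
proof (induction M)
  case (add z M)
  then show ?case using int2_add[of "F z" "\<lambda>x y. \<Sum>z\<in>#M. F z x y"] by (simp add: box_kernel_sum_mset)
qed (simp add: int2_def)

lemma pair_ann_int2: "pair_ann k \<theta> M N = int2 (\<lambda>x y. k x y * \<theta> (add_mset x M) (add_mset y N))"
  by (simp add: pair_ann_def int2_def)


text \<open>Annihilation is additive only where the integrals converge, so linearity is restricted to nice vectors.\<close>

definition nice_linear :: "(fock2 \<Rightarrow> fock2) \<Rightarrow> bool" where
  "nice_linear X \<longleftrightarrow> (\<forall>\<theta>. nice \<theta> \<longrightarrow> nice (X \<theta>))
     \<and> (\<forall>\<theta> \<theta>'. nice \<theta> \<longrightarrow> nice \<theta>' \<longrightarrow> X (\<lambda>M N. \<theta> M N + \<theta>' M N) = (\<lambda>M N. X \<theta> M N + X \<theta>' M N))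
     \<and> (\<forall>c \<theta>. nice \<theta> \<longrightarrow> X (\<lambda>M N. c * \<theta> M N) = (\<lambda>M N. c * X \<theta> M N))"

lemma nice_linear_nice: "nice_linear X \<Longrightarrow> nice \<theta> \<Longrightarrow> nice (X \<theta>)" by (simp add: nice_linear_def)
lemma nice_linear_add: "nice_linear X \<Longrightarrow> nice \<theta> \<Longrightarrow> nice \<theta>' \<Longrightarrow> X (\<lambda>M N. \<theta> M N + \<theta>' M N) = (\<lambda>M N. X \<theta> M N + X \<theta>' M N)" by (simp add: nice_linear_def)
lemma nice_linear_cmul: "nice_linear X \<Longrightarrow> nice \<theta> \<Longrightarrow> X (\<lambda>M N. c * \<theta> M N) = (\<lambda>M N. c * X \<theta> M N)" by (simp add: nice_linear_def)

lemma nice_linear_sum: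
  assumes "nice_linear X" "finite J" "\<And>j. j \<in> J \<Longrightarrow> nice (F j)"
  shows "X (\<lambda>M N. \<Sum>j\<in>J. F j M N) = (\<lambda>M N. \<Sum>j\<in>J. X (F j) M N)"
  using assms(2,3)
proof (induction J rule: finite_induct)
  case empty
  then show ?case using nice_linear_cmul[OF assms(1) nice_zero, of 0] by simp
next
  case (insert j J)
  have "X (\<lambda>M N. F j M N + (\<Sum>j\<in>J. F j M N)) = (\<lambda>M N. X (F j) M N + X (\<lambda>M N. \<Sum>j\<in>J. F j M N) M N)"
    by (rule nice_linear_add[OF assms(1)]) (use insert in \<open>auto intro: nice_sum\<close>)
  then show ?case using insert by simp
qed

lemma nice_linear_intro:
  assumes "\<And>\<theta>. nice \<theta> \<Longrightarrow> nice (X \<theta>)"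
    and "\<And>\<theta> \<theta>' M N. nice \<theta> \<Longrightarrow> nice \<theta>' \<Longrightarrow> X (\<lambda>M N. \<theta> M N + \<theta>' M N) M N = X \<theta> M N + X \<theta>' M N"
    and "\<And>c \<theta> M N. nice \<theta> \<Longrightarrow> X (\<lambda>M N. c * \<theta> M N) M N = c * X \<theta> M N"
  shows "nice_linear X"
  unfolding nice_linear_def using assms by (intro conjI allI impI ext) auto

lemma integral_left_add:
  "box_fun f \<Longrightarrow> nice \<theta> \<Longrightarrow> nice \<theta>' \<Longrightarrow> (\<integral>x. f x * (\<theta> (add_mset x M) N + \<theta>' (add_mset x M) N) \<partial>half_line)
     = (\<integral>x. f x * \<theta> (add_mset x M) N \<partial>half_line) + (\<integral>x. f x * \<theta>' (add_mset x M) N \<partial>half_line)"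
  unfolding distrib_left by (intro Bochner_Integration.integral_add integrable_left)
lemma integral_right_add:
  "box_fun f \<Longrightarrow> nice \<theta> \<Longrightarrow> nice \<theta>' \<Longrightarrow> (\<integral>x. f x * (\<theta> M (add_mset x N) + \<theta>' M (add_mset x N)) \<partial>half_line)
     = (\<integral>x. f x * \<theta> M (add_mset x N) \<partial>half_line) + (\<integral>x. f x * \<theta>' M (add_mset x N) \<partial>half_line)"
  unfolding distrib_left by (intro Bochner_Integration.integral_add integrable_right)
lemma integral_scale: "(\<integral>x. f x * (c * g x) \<partial>half_line) = c * (\<integral>x. f x * g x \<partial>half_line)" for c :: complex
  unfolding mult.left_commute[of _ c] by simp

lemma nice_linear_ann_left: assumes f: "box_fun f" shows "nice_linear (ann_left f)"
proof (rule nice_linear_intro)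
  show "ann_left f (\<lambda>M N. \<theta> M N + \<theta>' M N) M N = ann_left f \<theta> M N + ann_left f \<theta>' M N"
    if "nice \<theta>" "nice \<theta>'" for \<theta> \<theta>' M N
    unfolding ann_left_def by (rule integral_left_add[OF f that])
qed (simp_all only: nice_ann_left[OF f] ann_left_def integral_scale)
lemma nice_linear_ann_right: assumes f: "box_fun f" shows "nice_linear (ann_right f)"
proof (rule nice_linear_intro)
  show "ann_right f (\<lambda>M N. \<theta> M N + \<theta>' M N) M N = ann_right f \<theta> M N + ann_right f \<theta>' M N"
    if "nice \<theta>" "nice \<theta>'" for \<theta> \<theta>' M N
    unfolding ann_right_def by (rule integral_right_add[OF f that])
qed (simp_all only: nice_ann_right[OF f] ann_right_def integral_scale)
lemma nice_linear_cre_left: "box_fun f \<Longrightarrow> nice_linear (cre_left f)"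
  by (rule nice_linear_intro) (simp_all add: nice_cre_left cre_left_def distrib_left sum_mset.distrib sum_mset_distrib_left mult.left_commute)
lemma nice_linear_cre_right: "box_fun f \<Longrightarrow> nice_linear (cre_right f)"
  by (rule nice_linear_intro) (simp_all add: nice_cre_right cre_right_def distrib_left sum_mset.distrib sum_mset_distrib_left mult.left_commute)
lemma nice_linear_hop_left: assumes k: "box_kernel k" shows "nice_linear (hop_left k)"
proof (rule nice_linear_intro)
  show "hop_left k (\<lambda>M N. \<theta> M N + \<theta>' M N) M N = hop_left k \<theta> M N + hop_left k \<theta>' M N"
    if "nice \<theta>" "nice \<theta>'" for \<theta> \<theta>' M N
    unfolding hop_left_def integral_left_add[OF box_kernel_section[OF k] that] sum_mset.distrib ..
qed (simp_all only: nice_hop_left[OF k] hop_left_def integral_scale sum_mset_distrib_left)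
lemma nice_linear_hop_right: assumes k: "box_kernel k" shows "nice_linear (hop_right k)"
proof (rule nice_linear_intro)
  show "hop_right k (\<lambda>M N. \<theta> M N + \<theta>' M N) M N = hop_right k \<theta> M N + hop_right k \<theta>' M N"
    if "nice \<theta>" "nice \<theta>'" for \<theta> \<theta>' M N
    unfolding hop_right_def integral_right_add[OF box_kernel_section'[OF k] that] sum_mset.distrib ..
qed (simp_all only: nice_hop_right[OF k] hop_right_def integral_scale sum_mset_distrib_left)
lemma nice_linear_pair_cre: "box_kernel k \<Longrightarrow> nice_linear (pair_cre k)"
  by (rule nice_linear_intro) (simp_all add: nice_pair_cre pair_cre_def distrib_left sum_mset.distrib sum_mset_distrib_left mult.left_commute)
lemma nice_linear_pair_ann: "box_kernel k \<Longrightarrow> nice_linear (pair_ann k)"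
  unfolding nice_linear_def
proof (intro conjI allI impI)
  assume k: "box_kernel k"
  show "nice (pair_ann k \<theta>)" if "nice \<theta>" for \<theta> using k that by (rule nice_pair_ann)
  show "pair_ann k (\<lambda>M N. \<theta> M N + \<theta>' M N) = (\<lambda>M N. pair_ann k \<theta> M N + pair_ann k \<theta>' M N)"
    if "nice \<theta>" "nice \<theta>'" for \<theta> \<theta>'
    unfolding pair_ann_int2 distrib_left using int2_add[OF box_kernel_nice[OF k that(1)] box_kernel_nice[OF k that(2)]] by (simp add: fun_eq_iff)
  show "pair_ann k (\<lambda>M N. c * \<theta> M N) = (\<lambda>M N. c * pair_ann k \<theta> M N)" for c \<theta>
    unfolding pair_ann_int2 int2_cmul[symmetric] by (simp add: mult.left_commute)
qed

lemma nice_linear_combine: "nice_linear X \<Longrightarrow> nice_linear Y \<Longrightarrow> nice_linear (\<lambda>\<theta> M N. c * X \<theta> M N + d * Y \<theta> M N)"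
  by (rule nice_linear_intro) (simp_all add: nice_linear_nice nice_linear_add nice_linear_cmul nice_add nice_cmul algebra_simps)


lemma box_kernel_kcomp:
  assumes "box_kernel f" "box_kernel g" shows "box_kernel (kcomp f g)"
proof -
  obtain B D where B: "box_kernel_le B f" and D: "box_kernel_le D g" using assms by (auto simp: box_kernel_def)
  let ?S = "(half_line \<Otimes>\<^sub>M half_line) \<Otimes>\<^sub>M half_line"
  have F: "(\<lambda>s. (\<lambda>(x,y). f x y) (fst (fst s), snd s)) \<in> borel_measurable ?S"
    by (rule measurable_compose[of _ _ "half_line \<Otimes>\<^sub>M half_line"]) (use B in \<open>simp_all add: box_kernel_le_def\<close>)
  have G: "(\<lambda>s. (\<lambda>(x,y). g x y) (snd s, snd (fst s))) \<in> borel_measurable ?S"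
    by (rule measurable_compose[of _ _ "half_line \<Otimes>\<^sub>M half_line"]) (use D in \<open>simp_all add: box_kernel_le_def\<close>)
  have "(\<lambda>(p,z). f (fst p) z * g z (snd p)) \<in> borel_measurable ?S"
    using borel_measurable_times[OF F G] by (simp add: split_def)
  then have "(\<lambda>p. \<integral>z. f (fst p) z * g z (snd p) \<partial>half_line) \<in> borel_measurable (half_line \<Otimes>\<^sub>M half_line)"
    by (rule half_line.borel_measurable_lebesgue_integral)
  moreover have "norm (kcomp f g x y) \<le> B * D * (b - a)" for x y
    unfolding kcomp_def
    by (rule box_fun_le_integral_bound, rule box_fun_le_mult[OF box_kernel_le_section[OF B]]) (use box_kernel_le_section[OF box_kernel_le_transpose[OF D], of y] in \<open>auto simp: box_fun_le_def\<close>)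
  moreover have "x \<in> {a..<b} \<and> y \<in> {a..<b}" if nz: "kcomp f g x y \<noteq> 0" for x y
  proof -
    obtain z where "f x z * g z y \<noteq> 0" using nz unfolding kcomp_def using integral_nonzero by fastforce
    then have "f x z \<noteq> 0" "g z y \<noteq> 0" by auto
    then show ?thesis using B D unfolding box_kernel_le_def by blast
  qed
  ultimately have "box_kernel_le (B * D * (b - a)) (kcomp f g)"
    unfolding box_kernel_le_def by (auto simp: kcomp_def split_def)
  then show ?thesis by (auto simp: box_kernel_def)
qed

lemma kcomp_assoc:
  assumes "box_kernel f" "box_kernel g" "box_kernel h" shows "kcomp (kcomp f g) h = kcomp f (kcomp g h)"
proof (intro ext)
  fix x y
  have "box_kernel (\<lambda>z w. g z w * (f x z * h w y))"
    by (intro box_kernel_mult bounded_meas_mult bounded_meas_fst bounded_meas_snd assms box_kernel_section box_kernel_section')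
  from box_kernel_Fubini[OF this]
  have "(\<integral>z. (\<integral>w. f x z * (g z w * h w y) \<partial>half_line) \<partial>half_line) = (\<integral>w. (\<integral>z. f x z * g z w * h w y \<partial>half_line) \<partial>half_line)"
    by (simp add: mult_ac)
  then show "kcomp (kcomp f g) h x y = kcomp f (kcomp g h) x y"
    unfolding kcomp_def by simp
qed


lemma pair_cre_swap: "pair_cre k \<theta> = swap2 (pair_cre (\<lambda>x y. k y x) (swap2 \<theta>))"
  unfolding pair_cre_def swap2_def by (intro ext) (rule sum_mset.swap)

lemma pair_cre_commute: "pair_cre f (pair_cre g \<theta>) = pair_cre g (pair_cre f \<theta>)"
proof (intro ext)
  fix M N
  let ?H = "\<lambda>f g x x' R. \<Sum>y\<in>#N. \<Sum>y'\<in>#N - {#y#}. f x y * (g x' y' * \<theta> R (N - {#y#} - {#y'#}))"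
  have e: "pair_cre f (pair_cre g \<theta>) M N = (\<Sum>x\<in>#M. \<Sum>x'\<in>#M - {#x#}. ?H f g x x' (M - {#x#} - {#x'#}))" for f g
    unfolding pair_cre_def sum_mset_distrib_left
    by (subst sum_mset.swap[of _ N]) simp
  have H: "?H f g x x' R = ?H g f x' x R" for x x' R
    using sum_mset_remove2_swap[of "\<lambda>y y' R'. f x y * (g x' y' * \<theta> R R')" N] by (simp add: mult.left_commute)
  have "pair_cre f (pair_cre g \<theta>) M N = (\<Sum>x'\<in>#M. \<Sum>x\<in>#M - {#x'#}. ?H f g x x' (M - {#x'#} - {#x#}))"
    unfolding e by (rule sum_mset_remove2_swap)
  also have "\<dots> = pair_cre g (pair_cre f \<theta>) M N" unfolding e H ..
  finally show "pair_cre f (pair_cre g \<theta>) M N = pair_cre g (pair_cre f \<theta>) M N" .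
qed

text \<open>The hopping particle either belongs to the pair just created, which composes the kernels, or is a
spectator.\<close>

lemma hop_left_pair_cre:
  assumes k: "box_kernel k" and f: "box_kernel f" and t: "nice \<theta>"
  shows "hop_left k (pair_cre f \<theta>) = (\<lambda>M N. pair_cre (kcomp k f) \<theta> M N + pair_cre f (hop_left k \<theta>) M N)"
proof (intro ext)
  fix M N
  let ?I = "\<lambda>x R y'. \<integral>y. k x y * \<theta> (add_mset y R) (N - {#y'#}) \<partial>half_line"
  have A: "pair_cre f \<theta> (add_mset y R) N = (\<Sum>y'\<in>#N. f y y' * \<theta> R (N - {#y'#}))
      + (\<Sum>x'\<in>#R. \<Sum>y'\<in>#N. f x' y' * \<theta> (add_mset y (R - {#x'#})) (N - {#y'#}))" for y R
    unfolding pair_cre_def by (rule sum_mset_remove_add)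
  have i1: "integrable half_line (\<lambda>y. k x y * f y y' * c)" for x y' c
    by (intro box_fun_integrable box_fun_mult_const box_fun_mult box_kernel_section box_kernel_section' k f)
  have i2: "integrable half_line (\<lambda>y. f x' y' * (k x y * \<theta> (add_mset y R) N'))" for x x' y' R N'
    by (intro integrable_mult_right integrable_left box_kernel_section k t)
  have B: "(\<integral>y. k x y * pair_cre f \<theta> (add_mset y R) N \<partial>half_line)
     = (\<Sum>y'\<in>#N. kcomp k f x y' * \<theta> R (N - {#y'#})) + (\<Sum>x'\<in>#R. \<Sum>y'\<in>#N. f x' y' * ?I x (R - {#x'#}) y')" for x R
  proof -
    have "(\<integral>y. k x y * pair_cre f \<theta> (add_mset y R) N \<partial>half_line) =
      (\<integral>y. (\<Sum>y'\<in>#N. k x y * f y y' * \<theta> R (N - {#y'#})) + (\<Sum>x'\<in>#R. \<Sum>y'\<in>#N. f x' y' * (k x y * \<theta> (add_mset y (R - {#x'#})) (N - {#y'#}))) \<partial>half_line)"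
      unfolding A by (simp add: distrib_left sum_mset_distrib_left mult_ac)
    also have "\<dots> = (\<integral>y. (\<Sum>y'\<in>#N. k x y * f y y' * \<theta> R (N - {#y'#})) \<partial>half_line)
       + (\<integral>y. (\<Sum>x'\<in>#R. \<Sum>y'\<in>#N. f x' y' * (k x y * \<theta> (add_mset y (R - {#x'#})) (N - {#y'#}))) \<partial>half_line)"
      by (intro Bochner_Integration.integral_add integral_sum_mset(1) i1 i2)
    also have "(\<integral>y. (\<Sum>y'\<in>#N. k x y * f y y' * \<theta> R (N - {#y'#})) \<partial>half_line) = (\<Sum>y'\<in>#N. kcomp k f x y' * \<theta> R (N - {#y'#}))"
      by (subst integral_sum_mset(2)) (simp_all add: i1 kcomp_def)
    also have "(\<integral>y. (\<Sum>x'\<in>#R. \<Sum>y'\<in>#N. f x' y' * (k x y * \<theta> (add_mset y (R - {#x'#})) (N - {#y'#}))) \<partial>half_line)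
       = (\<Sum>x'\<in>#R. \<Sum>y'\<in>#N. f x' y' * ?I x (R - {#x'#}) y')"
      by (subst integral_sum_mset(2), (intro integral_sum_mset(1) i2), subst integral_sum_mset(2), rule i2) simp
    finally show ?thesis .
  qed
  have "hop_left k (pair_cre f \<theta>) M N = pair_cre (kcomp k f) \<theta> M N
     + (\<Sum>x\<in>#M. \<Sum>x'\<in>#M - {#x#}. \<Sum>y'\<in>#N. f x' y' * ?I x (M - {#x#} - {#x'#}) y')"
    unfolding hop_left_def B sum_mset.distrib unfolding pair_cre_def ..
  also have "(\<Sum>x\<in>#M. \<Sum>x'\<in>#M - {#x#}. \<Sum>y'\<in>#N. f x' y' * ?I x (M - {#x#} - {#x'#}) y')
     = (\<Sum>x'\<in>#M. \<Sum>x\<in>#M - {#x'#}. \<Sum>y'\<in>#N. f x' y' * ?I x (M - {#x'#} - {#x#}) y')"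
    by (rule sum_mset_remove2_swap)
  also have "\<dots> = pair_cre f (hop_left k \<theta>) M N"
    unfolding pair_cre_def hop_left_def sum_mset_distrib_left by (subst sum_mset.swap[of _ N]) simp
  finally show "hop_left k (pair_cre f \<theta>) M N = pair_cre (kcomp k f) \<theta> M N + pair_cre f (hop_left k \<theta>) M N" .
qed

lemma nice_swap2: "nice \<theta> \<Longrightarrow> nice (swap2 \<theta>)" unfolding nice_def by (elim exE, intro exI, rule nice_le_swap2)

lemma hop_right_pair_cre:
  assumes k: "box_kernel k" and f: "box_kernel f" and t: "nice \<theta>"
  shows "hop_right k (pair_cre f \<theta>) = (\<lambda>M N. pair_cre (kcomp f k) \<theta> M N + pair_cre f (hop_right k \<theta>) M N)"
proof -
  have s: "swap2 (swap2 \<phi>) = \<phi>" for \<phi> by (simp add: swap2_def)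
  have c: "kcomp (\<lambda>x y. k y x) (\<lambda>x y. f y x) = (\<lambda>x y. kcomp f k y x)"
    by (simp add: kcomp_def fun_eq_iff mult.commute)
  have "hop_right k (pair_cre f \<theta>) = swap2 (hop_left (\<lambda>x y. k y x) (pair_cre (\<lambda>x y. f y x) (swap2 \<theta>)))"
    by (simp add: hop_right_swap pair_cre_swap[of f] s)
  also have "\<dots> = swap2 (\<lambda>M N. pair_cre (\<lambda>x y. kcomp f k y x) (swap2 \<theta>) M N + pair_cre (\<lambda>x y. f y x) (hop_left (\<lambda>x y. k y x) (swap2 \<theta>)) M N)"
    by (simp add: hop_left_pair_cre[OF box_kernel_transpose[OF k] box_kernel_transpose[OF f] nice_swap2[OF t]] c)
  also have "\<dots> = (\<lambda>M N. pair_cre (kcomp f k) \<theta> M N + pair_cre f (hop_right k \<theta>) M N)"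
    unfolding hop_right_swap pair_cre_swap[of f] pair_cre_swap[of "kcomp f k"] s by (simp add: swap2_def)
  finally show ?thesis .
qed

text \<open>The annihilated pair shares both particles with the created pair, or only its right one, or only its
left one, or none; these are the four terms.\<close>

lemma pair_ann_pair_cre:
  assumes k: "box_kernel k" and f: "box_kernel f" and t: "nice \<theta>"
  shows "pair_ann k (pair_cre f \<theta>) = (\<lambda>M N. int2 (\<lambda>x y. k x y * f x y) * \<theta> M N
     + hop_right (kcomp (\<lambda>y x. k x y) f) \<theta> M N + hop_left (kcomp f (\<lambda>y x. k x y)) \<theta> M N
     + pair_cre f (pair_ann k \<theta>) M N)"
proof (intro ext)
  fix M N
  have A: "pair_cre f \<theta> (add_mset x M) (add_mset y N) =
     f x y * \<theta> M N + (\<Sum>y'\<in>#N. f x y' * \<theta> M (add_mset y (N - {#y'#})))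
     + ((\<Sum>x'\<in>#M. f x' y * \<theta> (add_mset x (M - {#x'#})) N)
     + (\<Sum>x'\<in>#M. \<Sum>y'\<in>#N. f x' y' * \<theta> (add_mset x (M - {#x'#})) (add_mset y (N - {#y'#}))))" for x y
  proof -
    have "pair_cre f \<theta> (add_mset x M) (add_mset y N) =
      (\<Sum>y'\<in>#add_mset y N. f x y' * \<theta> M (add_mset y N - {#y'#})) +
      (\<Sum>x'\<in>#M. \<Sum>y'\<in>#add_mset y N. f x' y' * \<theta> (add_mset x (M - {#x'#})) (add_mset y N - {#y'#}))"
      unfolding pair_cre_def
      by (rule sum_mset_remove_add[of "\<lambda>x' M'. \<Sum>y'\<in>#add_mset y N. f x' y' * \<theta> M' (add_mset y N - {#y'#})"])
    also have "\<dots> = (f x y * \<theta> M N + (\<Sum>y'\<in>#N. f x y' * \<theta> M (add_mset y (N - {#y'#})))) +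
      (\<Sum>x'\<in>#M. f x' y * \<theta> (add_mset x (M - {#x'#})) N + (\<Sum>y'\<in>#N. f x' y' * \<theta> (add_mset x (M - {#x'#})) (add_mset y (N - {#y'#}))))"
      by (simp only: sum_mset_remove_add[of "\<lambda>y' N'. f _ y' * \<theta> _ N'"])
    finally show ?thesis by (simp only: sum_mset.distrib)
  qed
  let ?F1 = "\<lambda>x y. k x y * f x y * \<theta> M N"
  let ?F2 = "\<lambda>y' x y. k x y * (f x y' * \<theta> M (add_mset y (N - {#y'#})))"
  let ?F3 = "\<lambda>x' x y. k x y * (f x' y * \<theta> (add_mset x (M - {#x'#})) N)"
  let ?F4 = "\<lambda>x' y' x y. f x' y' * (k x y * \<theta> (add_mset x (M - {#x'#})) (add_mset y (N - {#y'#})))"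
  have k1: "box_kernel ?F1" by (intro box_kernel_mult bounded_meas_const box_kernel_bounded_meas k f)
  have k2: "box_kernel (?F2 y')" for y' by (intro box_kernel_mult bounded_meas_mult bounded_meas_fst bounded_meas_nice(3) box_kernel_section' k f t)
  have k3: "box_kernel (?F3 x')" for x' by (intro box_kernel_mult bounded_meas_mult bounded_meas_snd bounded_meas_nice(2) box_kernel_section k f t)
  have k4: "box_kernel (?F4 x' y')" for x' y' by (intro box_kernel_cmul box_kernel_nice k t)
  have s2: "box_kernel (\<lambda>x y. \<Sum>y'\<in>#N. ?F2 y' x y)" by (rule box_kernel_sum_mset) (rule k2)
  have s3: "box_kernel (\<lambda>x y. \<Sum>x'\<in>#M. ?F3 x' x y)" by (rule box_kernel_sum_mset) (rule k3)
  have s4': "box_kernel (\<lambda>x y. \<Sum>y'\<in>#N. ?F4 x' y' x y)" for x' by (rule box_kernel_sum_mset) (rule k4)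
  have s4: "box_kernel (\<lambda>x y. \<Sum>x'\<in>#M. \<Sum>y'\<in>#N. ?F4 x' y' x y)" by (rule box_kernel_sum_mset) (rule s4')
  have "pair_ann k (pair_cre f \<theta>) M N = int2 (\<lambda>x y. (?F1 x y + (\<Sum>y'\<in>#N. ?F2 y' x y)) + ((\<Sum>x'\<in>#M. ?F3 x' x y) + (\<Sum>x'\<in>#M. \<Sum>y'\<in>#N. ?F4 x' y' x y)))"
    unfolding pair_ann_int2 A by (simp add: distrib_left sum_mset_distrib_left mult_ac)
  also have "\<dots> = (int2 ?F1 + int2 (\<lambda>x y. \<Sum>y'\<in>#N. ?F2 y' x y)) + (int2 (\<lambda>x y. \<Sum>x'\<in>#M. ?F3 x' x y) + int2 (\<lambda>x y. \<Sum>x'\<in>#M. \<Sum>y'\<in>#N. ?F4 x' y' x y))"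
    using int2_add[OF box_kernel_add[OF k1 s2] box_kernel_add[OF s3 s4]] int2_add[OF k1 s2] int2_add[OF s3 s4] by (simp only:)
  also have "int2 ?F1 = int2 (\<lambda>x y. k x y * f x y) * \<theta> M N" by (rule int2_mult_const)
  also have "int2 (\<lambda>x y. \<Sum>y'\<in>#N. ?F2 y' x y) = hop_right (kcomp (\<lambda>y x. k x y) f) \<theta> M N"
  proof -
    have "int2 (?F2 y') = (\<integral>y. kcomp (\<lambda>y x. k x y) f y y' * \<theta> M (add_mset y (N - {#y'#})) \<partial>half_line)" for y'
      unfolding int2_def box_kernel_Fubini[OF k2] kcomp_def by (simp add: mult.assoc[symmetric])
    then show ?thesis by (subst int2_sum_mset) (simp_all add: k2 hop_right_def)
  qed
  also have "int2 (\<lambda>x y. \<Sum>x'\<in>#M. ?F3 x' x y) = hop_left (kcomp f (\<lambda>y x. k x y)) \<theta> M N"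
  proof -
    have "int2 (?F3 x') = (\<integral>x. kcomp f (\<lambda>y x. k x y) x' x * \<theta> (add_mset x (M - {#x'#})) N \<partial>half_line)" for x'
    proof -
      have e: "k x y * (f x' y * c) = f x' y * k x y * c" for x y c by (simp add: mult_ac)
      show ?thesis unfolding int2_def kcomp_def e by simp
    qed
    then show ?thesis by (subst int2_sum_mset) (simp_all add: k3 hop_left_def)
  qed
  also have "int2 (\<lambda>x y. \<Sum>x'\<in>#M. \<Sum>y'\<in>#N. ?F4 x' y' x y) = pair_cre f (pair_ann k \<theta>) M N"
    unfolding int2_sum_mset[OF s4'] int2_sum_mset[OF k4] int2_cmul pair_cre_def pair_ann_int2 ..
  finally show "pair_ann k (pair_cre f \<theta>) M N = int2 (\<lambda>x y. k x y * f x y) * \<theta> M N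
     + hop_right (kcomp (\<lambda>y x. k x y) f) \<theta> M N + hop_left (kcomp f (\<lambda>y x. k x y)) \<theta> M N
     + pair_cre f (pair_ann k \<theta>) M N" by (simp add: add.assoc)
qed

end

section \<open>Powers of the sign kernel and their traces\<close>

text \<open>The coefficient of \<open>s^p\<close> in \<open>2 s exp (2 s u) / (1 + exp (2 s L))\<close>, up to scaling an Euler polynomial.\<close>

definition euler_kernel :: "real \<Rightarrow> nat \<Rightarrow> real \<Rightarrow> real" where
  "euler_kernel L p u = fps_nth (fps_X * (1 - tanh_series L) * fps_exp (2 * u)) p"

lemma euler_kernel_deriv: "(euler_kernel L (Suc p) has_field_derivative 2 * euler_kernel L p u) (at u within S)"
proof -
  let ?A = "fps_nth (fps_X * (1 - tanh_series L))"
  have e: "euler_kernel L q v = (\<Sum>i\<le>q. ?A i * ((2 * v) ^ (q - i) / fact (q - i)))" for q v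
    unfolding euler_kernel_def by (subst fps_mult_nth) (simp add: atMost_atLeast0)
  have "((\<lambda>v. \<Sum>i\<le>Suc p. ?A i * ((2 * v) ^ (Suc p - i) / fact (Suc p - i))) has_field_derivative
     (\<Sum>i\<le>Suc p. if i \<le> p then 2 * (?A i * ((2 * u) ^ (p - i) / fact (p - i))) else 0)) (at u within S)"
  proof (rule DERIV_sum)
    fix i assume i: "i \<in> {..Suc p}"
    show "((\<lambda>v. ?A i * ((2 * v) ^ (Suc p - i) / fact (Suc p - i))) has_field_derivative
       (if i \<le> p then 2 * (?A i * ((2 * u) ^ (p - i) / fact (p - i))) else 0)) (at u within S)"
    proof (cases "i \<le> p")
      case True
      then have s: "Suc p - i = Suc (p - i)" by simp
      have "((\<lambda>v. 2 * v) has_field_derivative 2) (at u within S)"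
        by (auto intro!: derivative_eq_intros)
      from DERIV_cmult[OF DERIV_cdivide[OF DERIV_power_Suc[OF this]]]
      have D: "((\<lambda>v. ?A i * ((2 * v) ^ Suc (p - i) / fact (Suc (p - i)))) has_field_derivative
        ?A i * ((1 + real (p - i)) * (2 * (2 * u) ^ (p - i)) / fact (Suc (p - i)))) (at u within S)" .
      have E: "(1 + real (p - i)) * (2 * (2 * u) ^ (p - i)) / fact (Suc (p - i)) = 2 * ((2 * u) ^ (p - i) / fact (p - i))"
      proof -
        have "(1 + real (p - i)) \<noteq> 0" by linarith
        then show ?thesis by (simp add: fact_Suc power_mult_distrib)
      qed
      show ?thesis
        unfolding s using D[unfolded E] True by (simp only: if_True mult.left_commute[of 2])
    next
      case False
      then have "i = Suc p" using i by simp
      then show ?thesis by simp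
    qed
  qed
  then show ?thesis unfolding e[abs_def] by (simp add: sum_distrib_left)
qed

lemma euler_kernel_antiperiodic:
  "euler_kernel L p L + euler_kernel L p 0 = (if p = 1 then 2 else 0)"
proof -
  have "fps_X * (1 - tanh_series L) * fps_exp (2 * L) + fps_X * (1 - tanh_series L) * fps_exp (2 * 0)
      = fps_X * ((1 - tanh_series L) * (1 + fps_exp (2 * L)))" by (simp add: algebra_simps)
  also have "\<dots> = fps_X * 2" by (simp only: tanh_series_mult)
  finally have "euler_kernel L p L + euler_kernel L p 0 = fps_nth (fps_X * 2) p"
    unfolding euler_kernel_def fps_add_nth[symmetric] by simp
  then show ?thesis by (auto simp: fps_numeral_nth split: nat.splits)
qed

lemma euler_kernel_0: "euler_kernel L (Suc p) 0 = (if p = 0 then 1 else 0) - fps_nth (tanh_series L) p"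
  unfolding euler_kernel_def by simp

lemma euler_kernel_1: "euler_kernel L 1 u = 1"
  unfolding euler_kernel_def by (subst fps_mult_nth) (simp add: tanh_series_nth_0)

lemma continuous_on_euler_kernel: "continuous_on S (euler_kernel L (Suc p))"
  by (rule DERIV_continuous_on, rule euler_kernel_deriv)

context levy_interval begin

definition sgn_kernel :: "real \<Rightarrow> real \<Rightarrow> complex" where
  "sgn_kernel x y = (if x \<in> {a..<b} \<and> y \<in> {a..<b} then of_real (sgn (y - x)) else 0)"

primrec iter_kernel :: "nat \<Rightarrow> real \<Rightarrow> real \<Rightarrow> complex" where
  "iter_kernel 0 = sgn_kernel"
| "iter_kernel (Suc n) = kcomp sgn_kernel (iter_kernel n)"

lemma box_kernel_le_sgn_kernel: "box_kernel_le 1 sgn_kernel"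
  unfolding box_kernel_le_def
proof (intro conjI allI impI)
  have m: "(\<lambda>p::real\<times>real. if fst p \<in> {a..<b} \<and> snd p \<in> {a..<b} then complex_of_real (sgn (snd p - fst p)) else 0) \<in> borel_measurable (borel \<Otimes>\<^sub>M borel)"
    by measurable
  have id: "(\<lambda>x. x) \<in> borel_measurable half_line" by (rule half_line_borel_measurable) simp
  have i: "(\<lambda>p. (fst p, snd p)) \<in> measurable (half_line \<Otimes>\<^sub>M half_line) (borel \<Otimes>\<^sub>M borel)"
    by (rule measurable_Pair[OF measurable_compose[OF measurable_fst id] measurable_compose[OF measurable_snd id]])
  show "(\<lambda>(x, y). sgn_kernel x y) \<in> borel_measurable (half_line \<Otimes>\<^sub>M half_line)"
    using measurable_compose[OF i m] unfolding sgn_kernel_def split_def fst_conv snd_conv .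
qed (auto simp: sgn_kernel_def sgn_if split: if_splits)

lemma box_kernel_sgn_kernel: "box_kernel sgn_kernel" using box_kernel_le_sgn_kernel by (rule box_kernel_le_box_kernel)

lemma box_kernel_iter_kernel: "box_kernel (iter_kernel n)"
  by (induction n) (simp_all add: box_kernel_sgn_kernel box_kernel_kcomp)

lemma sgn_kernel_swap: "sgn_kernel y x = - sgn_kernel x y"
  by (auto simp: sgn_kernel_def sgn_if)

lemma kcomp_iter_kernel: "kcomp (iter_kernel m) (iter_kernel n) = iter_kernel (Suc (m + n))"
  by (induction m) (simp_all add: kcomp_assoc box_kernel_sgn_kernel box_kernel_iter_kernel)

text \<open>The function \<open>sgn (y - x)\<close> for \<open>\<bar>y - x\<bar> < L\<close> extends antiperiodically with period \<open>L\<close>, and so do all its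
convolution powers; hence the sign and the shift by \<open>L\<close> below the diagonal. For \<open>p = 1\<close> there is a jump on
the diagonal, where the sign function takes the value 0.\<close>

definition kernel_fun :: "nat \<Rightarrow> real \<Rightarrow> real \<Rightarrow> real" where
  "kernel_fun p x y = (if x < y then euler_kernel (b - a) p (y - x)
     else if y < x then - euler_kernel (b - a) p (b - a + y - x)
     else if p = 1 then 0 else euler_kernel (b - a) p 0)"

text \<open>This is \<open>- kernel_fun (Suc p) z y / 2\<close>. Antiperiodicity makes its two branches agree at \<open>z = y\<close>.\<close>

definition antideriv :: "nat \<Rightarrow> real \<Rightarrow> real \<Rightarrow> real" where
  "antideriv p y z = (if z \<le> y then - euler_kernel (b - a) (Suc p) (y - z) / 2
     else euler_kernel (b - a) (Suc p) (b - a + y - z) / 2)"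

lemma antideriv_deriv:
  assumes "z \<noteq> y" shows "(antideriv p y has_real_derivative kernel_fun p z y) (at z)"
proof -
  let ?e = "euler_kernel (b - a) (Suc p)"
  have d1: "((\<lambda>z. - ?e (y - z) / 2) has_real_derivative euler_kernel (b - a) p (y - z)) (at z)" for z
  proof -
    have "((\<lambda>z. y - z) has_real_derivative -1) (at z)" by (auto intro!: derivative_eq_intros)
    from DERIV_cdivide[OF DERIV_minus[OF DERIV_chain2[OF euler_kernel_deriv this]], of "b - a" p 2]
    show ?thesis by simp
  qed
  have d2: "((\<lambda>z. ?e (b - a + y - z) / 2) has_real_derivative - euler_kernel (b - a) p (b - a + y - z)) (at z)" for z
  proof -
    have "((\<lambda>z. b - a + y - z) has_real_derivative -1) (at z)" by (auto intro!: derivative_eq_intros)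
    from DERIV_cdivide[OF DERIV_chain2[OF euler_kernel_deriv this], of "b - a" p 2]
    show ?thesis by simp
  qed
  show ?thesis
  proof (cases "z < y")
    case True
    have "(antideriv p y has_real_derivative euler_kernel (b - a) p (y - z)) (at z)"
      by (rule has_field_derivative_transform_within_open[OF d1, of "{..<y}"]) (use True in \<open>auto simp: antideriv_def\<close>)
    then show ?thesis using True by (simp add: kernel_fun_def)
  next
    case False
    have "(antideriv p y has_real_derivative - euler_kernel (b - a) p (b - a + y - z)) (at z)"
      by (rule has_field_derivative_transform_within_open[OF d2, of "{y<..}"]) (use False assms in \<open>auto simp: antideriv_def\<close>)
    then show ?thesis using False assms by (simp add: kernel_fun_def)
  qed
qed

lemma antideriv_continuous: "p \<ge> 1 \<Longrightarrow> continuous_on S (antideriv p y)"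
  unfolding antideriv_def
  by (rule continuous_on_cases_le)
     (use euler_kernel_antiperiodic[of "b - a" "Suc p"] in \<open>auto intro!: continuous_intros continuous_on_compose2[OF continuous_on_euler_kernel[of UNIV]]\<close>)

lemma antideriv_ends:
  assumes "p \<ge> 1" "y \<in> {a..<b}" shows "antideriv p y a + antideriv p y b = 0"
  using assms by (simp add: antideriv_def algebra_simps)

lemma antideriv_kernel_fun:
  assumes "p \<ge> 1" shows "- 2 * antideriv p y x = kernel_fun (Suc p) x y"
  using assms by (auto simp: antideriv_def kernel_fun_def)

lemma sgn_kernel_fun_integral:
  assumes p: "p \<ge> 1" and x: "x \<in> {a..<b}" and y: "y \<in> {a..<b}"
  shows "((\<lambda>z. sgn (z - x) * kernel_fun p z y) has_integral kernel_fun (Suc p) x y) {a..b}"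
proof -
  \<comment> \<open>The sign flips at \<open>x\<close>, so an antiderivative vanishing at \<open>x\<close> stays continuous.\<close>
  let ?G = "\<lambda>z. if z \<le> x then - (antideriv p y z - antideriv p y x) else antideriv p y z - antideriv p y x"
  have "((\<lambda>z. sgn (z - x) * kernel_fun p z y) has_integral (?G b - ?G a)) {a..b}"
  proof (rule fundamental_theorem_of_calculus_strong[of "{x, y}"])
    show "continuous_on {a..b} ?G"
      by (rule continuous_on_cases_le) (auto intro!: continuous_intros antideriv_continuous p)
    fix z assume z: "z \<in> {a..b} - {x, y}"
    have "(?G has_real_derivative sgn (z - x) * kernel_fun p z y) (at z)"
    proof (cases "z < x")
      case True
      have "((\<lambda>z. - (antideriv p y z - antideriv p y x)) has_real_derivative sgn (z - x) * kernel_fun p z y) (at z)"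
        using True z by (auto intro!: derivative_eq_intros antideriv_deriv)
      then show ?thesis
        by (rule has_field_derivative_transform_within_open[of _ _ _ "{..<x}"]) (use True in auto)
    next
      case False
      have "((\<lambda>z. antideriv p y z - antideriv p y x) has_real_derivative sgn (z - x) * kernel_fun p z y) (at z)"
        using False z by (auto intro!: derivative_eq_intros antideriv_deriv)
      then show ?thesis
        by (rule has_field_derivative_transform_within_open[of _ _ _ "{x<..}"]) (use False z in auto)
    qed
    then show "(?G has_vector_derivative sgn (z - x) * kernel_fun p z y) (at z)"
      by (simp add: has_real_derivative_iff_has_vector_derivative)
  qed (use a_less_b in auto)
  moreover have "?G b - ?G a = kernel_fun (Suc p) x y"
    using x antideriv_ends[OF p y] antideriv_kernel_fun[OF p, of y x] by auto
  ultimately show ?thesis by simp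
qed

lemma half_line_integral_eq:
  assumes f: "box_fun f" and i: "((\<lambda>z. g z) has_integral V) {a..b}" and eq: "\<And>z. z \<in> {a..<b} \<Longrightarrow> f z = complex_of_real (g z)"
  shows "(\<integral>z. f z \<partial>half_line) = of_real V"
proof -
  have supp: "indicator {0..} z *\<^sub>R f z = f z" for z
    using f a_nonneg by (cases "f z = 0") (auto simp: box_fun_def box_fun_le_def indicator_def)
  have "integrable lborel f"
    using box_fun_integrable[OF f] unfolding half_line_def by (simp add: integrable_restrict_space supp)
  then have 1: "(f has_integral (\<integral>z. f z \<partial>lborel)) UNIV" by (rule has_integral_integral_lborel)
  have "((\<lambda>z. complex_of_real (g z)) has_integral of_real V) {a..b}"
    using has_integral_linear[OF i bounded_linear_of_real] by (simp add: o_def)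
  then have "(f has_integral of_real V) {a..b}"
    \<comment> \<open>At the end point \<open>b\<close> the function \<open>f\<close> vanishes, but \<open>g\<close> need not.\<close>
    by (rule has_integral_spike_finite[of "{b}", rotated 2]) (auto simp: eq)
  then have 2: "(f has_integral of_real V) UNIV"
  proof (rule has_integral_on_superset)
    show "f x = 0" if "x \<notin> {a..b}" for x
    proof (rule ccontr)
      assume "f x \<noteq> 0"
      then have "x \<in> {a..<b}" using f unfolding box_fun_def box_fun_le_def by blast
      then show False using that by simp
    qed
  qed simp
  have "(\<integral>z. f z \<partial>half_line) = (\<integral>z. f z \<partial>lborel)"
    unfolding half_line_def by (subst integral_restrict_space) (simp_all add: supp)
  also have "\<dots> = of_real V" using 1 2 by (rule has_integral_unique)
  finally show ?thesis .
qed

lemma iter_kernel_eq: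
  "x \<in> {a..<b} \<Longrightarrow> y \<in> {a..<b} \<Longrightarrow> iter_kernel n x y = of_real (kernel_fun (Suc n) x y)"
proof (induction n arbitrary: x y)
  case 0
  then show ?case using euler_kernel_1[of "b - a"] by (simp add: sgn_kernel_def kernel_fun_def sgn_if)
next
  case (Suc n)
  show ?case unfolding iter_kernel.simps kcomp_def
  proof (rule half_line_integral_eq)
    show "box_fun (\<lambda>z. sgn_kernel x z * iter_kernel n z y)"
      by (intro box_fun_mult box_kernel_section box_kernel_section' box_kernel_sgn_kernel box_kernel_iter_kernel)
    show "((\<lambda>z. sgn (z - x) * kernel_fun (Suc n) z y) has_integral kernel_fun (Suc (Suc n)) x y) {a..b}"
      by (rule sgn_kernel_fun_integral) (use Suc in auto)
    show "sgn_kernel x z * iter_kernel n z y = complex_of_real (sgn (z - x) * kernel_fun (Suc n) z y)" if "z \<in> {a..<b}" for z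
      using that Suc by (simp add: sgn_kernel_def)
  qed
qed

definition kernel_trace :: "nat \<Rightarrow> complex" where
  "kernel_trace n = (\<integral>y. iter_kernel n y y \<partial>half_line)"

lemma kernel_trace_eq: "kernel_trace n = of_real (- (b - a) * fps_nth (tanh_series (b - a)) n)"
  unfolding kernel_trace_def
proof (rule half_line_integral_eq)
  have d: "iter_kernel n y y = (if y \<in> {a..<b} then of_real (- fps_nth (tanh_series (b - a)) n) else 0)" for y
  proof (cases "y \<in> {a..<b}")
    case True
    then show ?thesis using euler_kernel_0[of "b - a" n]
      by (subst iter_kernel_eq) (auto simp: kernel_fun_def tanh_series_nth_0)
  next
    case False
    then show ?thesis using box_kernel_iter_kernel[of n] unfolding box_kernel_def box_kernel_le_def by metis
  qed
  show "box_fun (\<lambda>y. iter_kernel n y y)"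
    unfolding d box_fun_def box_fun_le_def
  proof (intro exI[of _ "\<bar>fps_nth (tanh_series (b - a)) n\<bar>"] conjI allI impI)
    show "(\<lambda>y. if y \<in> {a..<b} then complex_of_real (- fps_nth (tanh_series (b - a)) n) else 0) \<in> borel_measurable half_line"
      by (rule half_line_borel_measurable) measurable
  qed (auto split: if_splits)
  show "((\<lambda>y. - fps_nth (tanh_series (b - a)) n) has_integral - (b - a) * fps_nth (tanh_series (b - a)) n) {a..b}"
    using has_integral_const_real[of "- fps_nth (tanh_series (b - a)) n" a b] a_less_b by (simp add: algebra_simps)
  show "iter_kernel n z z = of_real (- fps_nth (tanh_series (b - a)) n)" if "z \<in> {a..<b}" for z
    using that by (simp add: d)
qed

lemma kernel_trace_Suc: "kernel_trace (Suc n) = - int2 (\<lambda>x y. sgn_kernel x y * iter_kernel n x y)"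
proof -
  have k: "box_kernel (\<lambda>x y. sgn_kernel x y * iter_kernel n x y)"
    by (intro box_kernel_mult box_kernel_bounded_meas box_kernel_sgn_kernel box_kernel_iter_kernel)
  show ?thesis
    unfolding kernel_trace_def int2_def box_kernel_Fubini[OF k] iter_kernel.simps kcomp_def
    by (subst sgn_kernel_swap) simp
qed

end

section \<open>Moments of a quadratic operator in the vacuum\<close>

lemma sum_triangle_swap:
  fixes f :: "nat \<Rightarrow> nat \<Rightarrow> 'a::comm_monoid_add"
  shows "(\<Sum>j\<le>n. \<Sum>i\<le>n - j. f j i) = (\<Sum>i\<le>n. \<Sum>j\<le>n - i. f j i)"
proof -
  have "(\<Sum>j\<le>n. \<Sum>i\<le>n - j. f j i) = (\<Sum>(j,i)\<in>Sigma {..n} (\<lambda>j. {..n - j}). f j i)"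
    by (rule sum.Sigma) auto
  also have "\<dots> = (\<Sum>(i,j)\<in>Sigma {..n} (\<lambda>i. {..n - i}). f j i)"
    by (rule sum.reindex_bij_witness[of _ "\<lambda>(i,j). (j,i)" "\<lambda>(j,i). (i,j)"]) auto
  also have "\<dots> = (\<Sum>i\<le>n. \<Sum>j\<le>n - i. f j i)"
    by (rule sum.Sigma[symmetric]) auto
  finally show ?thesis .
qed

lemma sum_triangle_diagonal:
  fixes f :: "nat \<Rightarrow> nat \<Rightarrow> 'a::comm_monoid_add"
  shows "(\<Sum>j\<le>n. \<Sum>i\<le>n - j. f j i) = (\<Sum>m\<le>n. \<Sum>j\<le>m. f j (m - j))"
proof -
  have "(\<Sum>j\<le>n. \<Sum>i\<le>n - j. f j i) = (\<Sum>(j,i)\<in>Sigma {..n} (\<lambda>j. {..n - j}). f j i)"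
    by (rule sum.Sigma) auto
  also have "Sigma {..n} (\<lambda>j. {..n - j}) = {(j,i). j + i \<le> n}" by auto
  also have "(\<Sum>(j,i)\<in>{(j,i). j + i \<le> n}. f j i) = (\<Sum>m\<le>n. \<Sum>j\<le>m. f j (m - j))"
    by (rule sum.triangle_reindex_eq)
  finally show ?thesis .
qed

lemma sum_weighted_square:
  fixes e :: "nat \<Rightarrow> complex"
  shows "2 * (\<Sum>j\<le>m. of_nat j * e j * e (m - j)) = of_nat m * (\<Sum>j\<le>m. e j * e (m - j))"
proof -
  have "(\<Sum>j\<le>m. of_nat j * e j * e (m - j)) = (\<Sum>j\<le>m. of_nat (m - j) * e (m - j) * e j)"
    by (rule sum.reindex_bij_witness[of _ "\<lambda>j. m - j" "\<lambda>j. m - j"]) auto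
  then have "2 * (\<Sum>j\<le>m. of_nat j * e j * e (m - j)) = (\<Sum>j\<le>m. of_nat j * e j * e (m - j) + of_nat (m - j) * e (m - j) * e j)"
    by (simp add: sum.distrib)
  also have "\<dots> = (\<Sum>j\<le>m. of_nat m * (e j * e (m - j)))"
    by (rule sum.cong) (auto simp: of_nat_diff algebra_simps)
  finally show ?thesis by (simp add: sum_distrib_left)
qed

text \<open>The inductive step of \<open>lift_rule\<close>, evaluated at one configuration. The hopping terms contribute the
double sum; symmetrizing it produces the convolution square of \<open>e\<close>, the quadratic term of the Riccati
equation.\<close>

lemma riccati_step:
  fixes e t u :: "nat \<Rightarrow> complex" and c :: "nat \<Rightarrow> nat \<Rightarrow> complex" and \<gamma> :: complex
  assumes rec: "\<And>p. of_nat (Suc p) * e (Suc p) = (if p = 0 then \<gamma> else 0) + e p + \<gamma> * (\<Sum>i\<le>p. e i * e (p - i))"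
  shows "(\<Sum>j\<le>k. of_nat (Suc (k - j)) * (\<gamma> * e j * t j * u (Suc (k - j)) + of_nat (Suc j) * e (Suc j) * c j (Suc (k - j))))
     + (\<Sum>j\<le>k. of_nat (Suc j) * e (Suc j) * (c (Suc j) (k - j) + \<gamma> * t (Suc j) * u (k - j)
           + \<gamma> * (\<Sum>i\<le>k - j. 2 * e i * c (Suc j + i) (k - j - i))))
     = of_nat (Suc k) * (\<Sum>j\<le>Suc k. \<gamma> * e j * t j * u (Suc k - j) + of_nat (Suc j) * e (Suc j) * c j (Suc k - j))"
  (is "?A + ?B = _ * (\<Sum>j\<le>Suc k. ?h j)")
proof -
  let ?n = "Suc k"
  let ?S = "\<lambda>m. \<Sum>j\<le>m. e j * e (m - j)"
  let ?b = "\<lambda>j. of_nat j * e j * (c j (?n - j) + \<gamma> * t j * u (?n - j) + \<gamma> * (\<Sum>i\<le>?n - j. 2 * e i * c (j + i) (?n - j - i)))"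
  have "?A = (\<Sum>j\<le>k. of_nat (?n - j) * ?h j)"
    by (rule sum.cong) (simp_all add: Suc_diff_le del: of_nat_Suc)
  then have A: "?A = (\<Sum>j\<le>?n. of_nat (?n - j) * ?h j)" by simp
  have "?B = (\<Sum>j\<le>k. ?b (Suc j))" by (rule sum.cong) auto
  also have "\<dots> = (\<Sum>j\<le>?n. ?b j)" by (subst sum.atMost_Suc_shift) simp
  also have "\<dots> = (\<Sum>j\<le>?n. of_nat j * e j * (c j (?n - j) + \<gamma> * t j * u (?n - j)))
     + (\<Sum>j\<le>?n. \<Sum>i\<le>?n - j. 2 * \<gamma> * (of_nat j * e j * e i) * c (j + i) (?n - j - i))"
    unfolding sum.distrib[symmetric] by (rule sum.cong) (auto simp: distrib_left sum_distrib_left mult_ac)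
  also have "(\<Sum>j\<le>?n. \<Sum>i\<le>?n - j. 2 * \<gamma> * (of_nat j * e j * e i) * c (j + i) (?n - j - i))
     = (\<Sum>m\<le>?n. \<Sum>j\<le>m. 2 * \<gamma> * (of_nat j * e j * e (m - j)) * c (j + (m - j)) (?n - j - (m - j)))"
    by (rule sum_triangle_diagonal)
  also have "\<dots> = (\<Sum>m\<le>?n. \<gamma> * of_nat m * ?S m * c m (?n - m))"
  proof (rule sum.cong[OF refl])
    fix m
    have "(\<Sum>j\<le>m. 2 * \<gamma> * (of_nat j * e j * e (m - j)) * c (j + (m - j)) (?n - j - (m - j)))
      = (\<Sum>j\<le>m. 2 * \<gamma> * (of_nat j * e j * e (m - j)) * c m (?n - m))"
      by (rule sum.cong) auto
    also have "\<dots> = \<gamma> * (2 * (\<Sum>j\<le>m. of_nat j * e j * e (m - j))) * c m (?n - m)"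
      by (simp add: sum_distrib_left sum_distrib_right mult_ac)
    finally show "(\<Sum>j\<le>m. 2 * \<gamma> * (of_nat j * e j * e (m - j)) * c (j + (m - j)) (?n - j - (m - j)))
      = \<gamma> * of_nat m * ?S m * c m (?n - m)"
      unfolding sum_weighted_square by (simp add: mult_ac)
  qed
  finally have B: "?B = (\<Sum>j\<le>?n. of_nat j * e j * (c j (?n - j) + \<gamma> * t j * u (?n - j)) + \<gamma> * of_nat j * ?S j * c j (?n - j))"
    by (simp only: sum.distrib)
  show ?thesis unfolding A B sum_distrib_left[of "of_nat ?n"] sum.distrib[symmetric]
  proof (rule sum.cong[OF refl])
    fix j assume j: "j \<in> {..?n}"
    have "of_nat j * (of_nat (Suc j) * e (Suc j)) = of_nat j * e j + of_nat j * (\<gamma> * ?S j)"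
      unfolding rec by (cases j) (simp_all add: distrib_left)
    then have "of_nat j * ?h j = of_nat j * e j * (c j (?n - j) + \<gamma> * t j * u (?n - j)) + \<gamma> * of_nat j * ?S j * c j (?n - j)"
      by (simp only: distrib_left distrib_right mult.assoc[symmetric]) (simp add: algebra_simps)
    moreover have "of_nat (?n - j) * ?h j + of_nat j * ?h j = of_nat ?n * ?h j"
      using j by (simp only: distrib_right[symmetric] of_nat_add[symmetric]) simp
    ultimately show "of_nat (?n - j) * ?h j + (of_nat j * e j * (c j (?n - j) + \<gamma> * t j * u (?n - j)) + \<gamma> * of_nat j * ?S j * c j (?n - j)) = of_nat ?n * ?h j"
      by simp
  qed
qed

context levy_interval begin

text \<open>Up to the factor \<open>i\<close>, the shape of every Levy sum after normal ordering.\<close>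

definition levy_op :: "complex \<Rightarrow> complex \<Rightarrow> complex \<Rightarrow> (real \<Rightarrow> real \<Rightarrow> complex) \<Rightarrow> fock2 \<Rightarrow> fock2" where
  "levy_op \<alpha> \<beta> \<gamma> k \<theta> = (\<lambda>M N. \<alpha> * hop_left k \<theta> M N + \<beta> * hop_right k \<theta> M N + \<gamma> * (pair_cre k \<theta> M N - pair_ann k \<theta> M N))"

lemma nice_linear_levy_op:
  assumes "box_kernel k" shows "nice_linear (levy_op \<alpha> \<beta> \<gamma> k)"
proof -
  have "nice_linear (\<lambda>\<theta> M N. 1 * (\<alpha> * hop_left k \<theta> M N + \<beta> * hop_right k \<theta> M N) + \<gamma> * (1 * pair_cre k \<theta> M N + (-1) * pair_ann k \<theta> M N))"
    by (intro nice_linear_combine nice_linear_hop_left nice_linear_hop_right nice_linear_pair_cre nice_linear_pair_ann assms)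
  then show ?thesis by (simp add: levy_op_def[abs_def])
qed

definition cre_op :: "nat \<Rightarrow> fock2 \<Rightarrow> fock2" where "cre_op q = pair_cre (iter_kernel q)"
definition hop_op :: "nat \<Rightarrow> fock2 \<Rightarrow> fock2" where
  "hop_op q \<theta> = (\<lambda>M N. hop_left (iter_kernel q) \<theta> M N + hop_right (iter_kernel q) \<theta> M N)"

lemma nice_linear_cre_op: "nice_linear (cre_op q)" unfolding cre_op_def by (intro nice_linear_pair_cre box_kernel_iter_kernel)
lemma nice_linear_hop_op: "nice_linear (hop_op q)"
  using nice_linear_combine[OF nice_linear_hop_left nice_linear_hop_right, OF box_kernel_iter_kernel box_kernel_iter_kernel, of 1 q 1 q]
  by (simp add: hop_op_def[abs_def])

lemma cre_op_commute: "cre_op p (cre_op q \<theta>) = cre_op q (cre_op p \<theta>)"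
  unfolding cre_op_def by (rule pair_cre_commute)

lemma hop_op_cre_op:
  assumes "nice \<theta>"
  shows "hop_op q (cre_op p \<theta>) = (\<lambda>M N. cre_op p (hop_op q \<theta>) M N + 2 * cre_op (Suc (p + q)) \<theta> M N)"
proof -
  let ?L = "hop_left (iter_kernel q) \<theta>" and ?R = "hop_right (iter_kernel q) \<theta>"
  have "cre_op p (hop_op q \<theta>) = (\<lambda>M N. cre_op p ?L M N + cre_op p ?R M N)"
    unfolding hop_op_def by (rule nice_linear_add[OF nice_linear_cre_op]) (intro nice_hop_left nice_hop_right box_kernel_iter_kernel assms)+
  then show ?thesis
    unfolding hop_op_def cre_op_def hop_left_pair_cre[OF box_kernel_iter_kernel box_kernel_iter_kernel assms] hop_right_pair_cre[OF box_kernel_iter_kernel box_kernel_iter_kernel assms]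
      kcomp_iter_kernel by (simp add: fun_eq_iff add.commute)
qed

lemma kcomp_uminus: "kcomp (\<lambda>x y. - f x y) g = (\<lambda>x y. - kcomp f g x y)" "kcomp f (\<lambda>x y. - g x y) = (\<lambda>x y. - kcomp f g x y)"
  by (simp_all add: kcomp_def fun_eq_iff)
lemma sum_mset_uminus: "(\<Sum>x\<in>#M. - f x) = - (\<Sum>x\<in>#M. f x)" for f :: "'a \<Rightarrow> complex"
  by (induction M) auto
lemma hop_uminus: "hop_left (\<lambda>x y. - k x y) \<theta> M N = - hop_left k \<theta> M N" "hop_right (\<lambda>x y. - k x y) \<theta> M N = - hop_right k \<theta> M N"
  by (simp_all add: hop_left_def hop_right_def sum_mset_uminus)

lemma levy_op_cre_op:
  assumes t: "nice \<theta>" and s: "\<alpha> + \<beta> = 1"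
  shows "levy_op \<alpha> \<beta> \<gamma> sgn_kernel (cre_op p \<theta>) = (\<lambda>M N. cre_op p (levy_op \<alpha> \<beta> \<gamma> sgn_kernel \<theta>) M N
     + cre_op (Suc p) \<theta> M N + \<gamma> * kernel_trace (Suc p) * \<theta> M N + \<gamma> * hop_op (Suc p) \<theta> M N)"
proof -
  let ?K = sgn_kernel
  have k: "kcomp ?K (iter_kernel p) = iter_kernel (Suc p)" "kcomp (iter_kernel p) ?K = iter_kernel (Suc p)"
    using kcomp_iter_kernel[of 0 p] kcomp_iter_kernel[of p 0] by simp_all
  have sw: "(\<lambda>y x. ?K x y) = (\<lambda>y x. - ?K y x)" by (intro ext) (rule sgn_kernel_swap)
  note n = nice_hop_left[OF box_kernel_sgn_kernel t] nice_hop_right[OF box_kernel_sgn_kernel t] nice_pair_cre[OF box_kernel_sgn_kernel t] nice_pair_ann[OF box_kernel_sgn_kernel t]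
  have L: "cre_op p (levy_op \<alpha> \<beta> \<gamma> ?K \<theta>) = (\<lambda>M N. \<alpha> * cre_op p (hop_left ?K \<theta>) M N + \<beta> * cre_op p (hop_right ?K \<theta>) M N
     + \<gamma> * (cre_op p (pair_cre ?K \<theta>) M N - cre_op p (pair_ann ?K \<theta>) M N))"
  proof -
    have eq: "levy_op \<alpha> \<beta> \<gamma> ?K \<theta> = (\<lambda>M N. (\<alpha> * hop_left ?K \<theta> M N + \<beta> * hop_right ?K \<theta> M N) + (\<gamma> * pair_cre ?K \<theta> M N + (-\<gamma>) * pair_ann ?K \<theta> M N))"
      by (simp add: levy_op_def fun_eq_iff algebra_simps)
    show ?thesis unfolding eq
      by (simp only: nice_linear_add[OF nice_linear_cre_op] nice_linear_cmul[OF nice_linear_cre_op] nice_add nice_cmul n) (simp add: fun_eq_iff algebra_simps)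
  qed
  have c: "pair_cre ?K (cre_op p \<theta>) = cre_op p (pair_cre ?K \<theta>)"
    unfolding cre_op_def by (rule pair_cre_commute)
  have an: "pair_ann ?K (cre_op p \<theta>) = (\<lambda>M N. - kernel_trace (Suc p) * \<theta> M N - hop_op (Suc p) \<theta> M N + cre_op p (pair_ann ?K \<theta>) M N)"
    unfolding cre_op_def pair_ann_pair_cre[OF box_kernel_sgn_kernel box_kernel_iter_kernel t] sw kcomp_uminus k hop_uminus hop_op_def kernel_trace_Suc
    by (simp add: fun_eq_iff)
  have hl: "hop_left ?K (cre_op p \<theta>) = (\<lambda>M N. cre_op (Suc p) \<theta> M N + cre_op p (hop_left ?K \<theta>) M N)"
    unfolding cre_op_def hop_left_pair_cre[OF box_kernel_sgn_kernel box_kernel_iter_kernel t] k ..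
  have hr: "hop_right ?K (cre_op p \<theta>) = (\<lambda>M N. cre_op (Suc p) \<theta> M N + cre_op p (hop_right ?K \<theta>) M N)"
    unfolding cre_op_def hop_right_pair_cre[OF box_kernel_sgn_kernel box_kernel_iter_kernel t] k ..
  have ab: "\<alpha> * z + \<beta> * z = z" for z using s by (simp add: distrib_right[symmetric])
  show ?thesis unfolding L unfolding levy_op_def[of \<alpha> \<beta> \<gamma> ?K "cre_op p \<theta>"] c an hl hr by (simp add: fun_eq_iff algebra_simps ab)
qed

lemma hop_vacuum: "hop_left k vacuum = (\<lambda>M N. 0)" "hop_right k vacuum = (\<lambda>M N. 0)"
  by (simp_all add: hop_left_def hop_right_def vacuum_def fun_eq_iff)
lemma pair_ann_vacuum: "pair_ann k vacuum = (\<lambda>M N. 0)"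
  by (simp add: pair_ann_def vacuum_def fun_eq_iff)

lemma nice_le_vacuum: "nice_le 1 0 vacuum"
proof -
  have "meas vacuum"
    unfolding meas_def
  proof (intro allI)
    fix n k
    have c: "config n x = {#} \<longleftrightarrow> n = 0" for n x
      by (metis size_config size_eq_0_iff_empty)
    have "component n k vacuum = (\<lambda>_. if n = 0 \<and> k = 0 then 1 else 0)"
      by (simp add: component_def vacuum_def c fun_eq_iff)
    then show "component n k vacuum \<in> borel_measurable (particle_measure n k)" by simp
  qed
  then show ?thesis by (auto simp: nice_le_def vacuum_def split: if_splits)
qed

lemma nice_vacuum: "nice vacuum" using nice_le_vacuum by (rule nice_le_nice)

text \<open>The coefficients of \<open>exp (z D)\<close> applied to the vacuum.\<close>

primrec taylor :: "complex \<Rightarrow> complex \<Rightarrow> real \<Rightarrow> nat \<Rightarrow> fock2" where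
  "taylor \<alpha> \<beta> g 0 = vacuum"
| "taylor \<alpha> \<beta> g (Suc n) = (\<lambda>M N. levy_op \<alpha> \<beta> (of_real g) sgn_kernel (taylor \<alpha> \<beta> g n) M N / of_nat (Suc n))"

end

locale levy_recursion = levy_interval +
  fixes \<alpha> \<beta> :: complex and g :: real
  assumes \<alpha>\<beta>: "\<alpha> + \<beta> = 1"
begin

abbreviation "\<gamma> \<equiv> complex_of_real g"
abbreviation "D \<equiv> levy_op \<alpha> \<beta> \<gamma> sgn_kernel"
abbreviation "w \<equiv> taylor \<alpha> \<beta> g"
abbreviation "e n \<equiv> complex_of_real (eta g n)"

lemma nice_linear_D: "nice_linear D" by (intro nice_linear_levy_op box_kernel_sgn_kernel)

lemma nice_w: "nice (w n)"
proof (induction n)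
  case (Suc n)
  then show ?case using nice_cmul[OF nice_linear_nice[OF nice_linear_D Suc], of "inverse (of_nat (Suc n))"]
    by (simp add: divide_inverse mult.commute del: of_nat_Suc)
qed (simp add: nice_vacuum)

lemma D_w: "D (w n) = (\<lambda>M N. of_nat (Suc n) * w (Suc n) M N)"
  by (simp add: fun_eq_iff del: of_nat_Suc)

lemma e_rec: "of_nat (Suc p) * e (Suc p) = (if p = 0 then \<gamma> else 0) + e p + \<gamma> * (\<Sum>i\<le>p. e i * e (p - i))"
proof -
  have "real (Suc p) * eta g (Suc p) = (if p = 0 then g else 0) + eta g p + g * (\<Sum>i\<le>p. eta g i * eta g (p - i))"
    by simp
  then have "complex_of_real (real (Suc p) * eta g (Suc p)) = complex_of_real ((if p = 0 then g else 0) + eta g p + g * (\<Sum>i\<le>p. eta g i * eta g (p - i)))"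
    by (rule arg_cong)
  then show ?thesis by (simp del: eta.simps of_nat_Suc split: if_splits)
qed

definition lift :: "nat \<Rightarrow> fock2 \<Rightarrow> fock2" where
  "lift j \<theta> = (\<lambda>M N. \<gamma> * e j * kernel_trace j * \<theta> M N + of_nat (Suc j) * e (Suc j) * cre_op j \<theta> M N)"

lemma nice_linear_lift: "nice_linear (lift j)"
proof -
  have "nice_linear (\<lambda>\<theta>. \<theta>)" by (rule nice_linear_intro) auto
  from nice_linear_combine[OF this nice_linear_cre_op] show ?thesis unfolding lift_def[abs_def] .
qed

lemma D_lift:
  assumes t: "nice \<theta>"
  shows "D (lift j \<theta>) M N = lift j (D \<theta>) M N + of_nat (Suc j) * e (Suc j) * (cre_op (Suc j) \<theta> M N
     + \<gamma> * kernel_trace (Suc j) * \<theta> M N + \<gamma> * hop_op (Suc j) \<theta> M N)"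
proof -
  have "D (lift j \<theta>) = (\<lambda>M N. \<gamma> * e j * kernel_trace j * D \<theta> M N + of_nat (Suc j) * e (Suc j) * D (cre_op j \<theta>) M N)"
    unfolding lift_def by (simp only: nice_linear_add[OF nice_linear_D] nice_linear_cmul[OF nice_linear_D] nice_cmul nice_linear_nice[OF nice_linear_cre_op] t)
  then show ?thesis unfolding levy_op_cre_op[OF t \<alpha>\<beta>] lift_def by (simp add: algebra_simps del: eta.simps of_nat_Suc)
qed

lemma hop_lift:
  assumes t: "nice \<theta>"
  shows "hop_op q (lift j \<theta>) M N = lift j (hop_op q \<theta>) M N + 2 * (of_nat (Suc j) * e (Suc j)) * cre_op (Suc (j + q)) \<theta> M N"
proof -
  have "hop_op q (lift j \<theta>) = (\<lambda>M N. \<gamma> * e j * kernel_trace j * hop_op q \<theta> M N + of_nat (Suc j) * e (Suc j) * hop_op q (cre_op j \<theta>) M N)"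
    unfolding lift_def by (simp only: nice_linear_add[OF nice_linear_hop_op] nice_linear_cmul[OF nice_linear_hop_op] nice_cmul nice_linear_nice[OF nice_linear_cre_op] t)
  then show ?thesis unfolding hop_op_cre_op[OF t] lift_def by (simp add: algebra_simps del: eta.simps of_nat_Suc)
qed

lemma cre_lift:
  assumes t: "nice \<theta>" shows "lift j (cre_op p \<theta>) = cre_op p (lift j \<theta>)"
  unfolding lift_def
  by (simp only: nice_linear_add[OF nice_linear_cre_op] nice_linear_cmul[OF nice_linear_cre_op] nice_cmul nice_linear_nice[OF nice_linear_cre_op] t cre_op_commute[of p j])

text \<open>The coefficient of \<open>z^n\<close> in the derivative of \<open>G(z) exp (\<Sum>p. \<eta> p z^p C p) vacuum\<close>: the factor \<open>G'/G\<close> gives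
the scalar part of \<open>lift\<close>, and the exponent gives the creation part. Note that \<open>cre_op j\<close> is \<open>C (j + 1)\<close>.\<close>

definition lift_rule :: "nat \<Rightarrow> bool" where
  "lift_rule n \<longleftrightarrow> (\<lambda>M N. of_nat (Suc n) * w (Suc n) M N) = (\<lambda>M N. \<Sum>j\<le>n. lift j (w (n - j)) M N)"
text \<open>Hopping annihilates the vacuum, and its commutator with a pair creation is a pair creation; hence it
acts on the exponential above as multiplication by \<open>2 (\<Sum>i. \<eta> i z^i cre_op (q + i))\<close>.\<close>

definition hop_rule :: "nat \<Rightarrow> bool" where
  "hop_rule n \<longleftrightarrow> (\<forall>q. hop_op q (w n) = (\<lambda>M N. \<Sum>i\<le>n. 2 * e i * cre_op (q + i) (w (n - i)) M N))"

lemma lift_rule_0: "lift_rule 0"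
proof -
  have "D vacuum = (\<lambda>M N. \<gamma> * cre_op 0 vacuum M N)"
    by (simp add: levy_op_def hop_vacuum pair_ann_vacuum cre_op_def)
  then show ?thesis unfolding lift_rule_def by (simp add: lift_def fun_eq_iff)
qed

lemma hop_rule_0: "hop_rule 0"
  unfolding hop_rule_def by (simp add: hop_op_def hop_vacuum)

lemma lift_rule_Suc:
  assumes l: "lift_rule k" and h: "\<And>m. m \<le> k \<Longrightarrow> hop_rule m"
  shows "lift_rule (Suc k)"
  unfolding lift_rule_def
proof (intro ext)
  fix M N
  have "of_nat (Suc k) * D (w (Suc k)) M N = D (\<lambda>M N. of_nat (Suc k) * w (Suc k) M N) M N"
    by (simp only: nice_linear_cmul[OF nice_linear_D nice_w])
  also have "\<dots> = D (\<lambda>M N. \<Sum>j\<le>k. lift j (w (k - j)) M N) M N"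
    using l unfolding lift_rule_def by (simp only:)
  also have "\<dots> = (\<Sum>j\<le>k. D (lift j (w (k - j))) M N)"
    by (subst nice_linear_sum[OF nice_linear_D]) (auto intro: nice_linear_nice[OF nice_linear_lift] nice_w)
  also have "\<dots> = (\<Sum>j\<le>k. of_nat (Suc (k - j)) * (\<gamma> * e j * kernel_trace j * w (Suc (k - j)) M N + of_nat (Suc j) * e (Suc j) * cre_op j (w (Suc (k - j))) M N))
     + (\<Sum>j\<le>k. of_nat (Suc j) * e (Suc j) * (cre_op (Suc j) (w (k - j)) M N + \<gamma> * kernel_trace (Suc j) * w (k - j) M N
           + \<gamma> * (\<Sum>i\<le>k - j. 2 * e i * cre_op (Suc j + i) (w (k - j - i)) M N)))"
    unfolding sum.distrib[symmetric]
  proof (rule sum.cong[OF refl])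
    fix j assume "j \<in> {..k}"
    have "lift j (D (w (k - j))) M N = of_nat (Suc (k - j)) * lift j (w (Suc (k - j))) M N"
      unfolding D_w by (simp only: nice_linear_cmul[OF nice_linear_lift nice_w])
    moreover have "hop_op (Suc j) (w (k - j)) M N = (\<Sum>i\<le>k - j. 2 * e i * cre_op (Suc j + i) (w (k - j - i)) M N)"
      using h[of "k - j"] unfolding hop_rule_def by simp
    ultimately show "D (lift j (w (k - j))) M N = of_nat (Suc (k - j)) * (\<gamma> * e j * kernel_trace j * w (Suc (k - j)) M N + of_nat (Suc j) * e (Suc j) * cre_op j (w (Suc (k - j))) M N)
     + of_nat (Suc j) * e (Suc j) * (cre_op (Suc j) (w (k - j)) M N + \<gamma> * kernel_trace (Suc j) * w (k - j) M N
           + \<gamma> * (\<Sum>i\<le>k - j. 2 * e i * cre_op (Suc j + i) (w (k - j - i)) M N))"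
      unfolding D_lift[OF nice_w] by (simp only: lift_def)
  qed
  also have "\<dots> = of_nat (Suc k) * (\<Sum>j\<le>Suc k. \<gamma> * e j * kernel_trace j * w (Suc k - j) M N + of_nat (Suc j) * e (Suc j) * cre_op j (w (Suc k - j)) M N)"
    by (rule riccati_step) (rule e_rec)
  finally have "D (w (Suc k)) M N = (\<Sum>j\<le>Suc k. \<gamma> * e j * kernel_trace j * w (Suc k - j) M N + of_nat (Suc j) * e (Suc j) * cre_op j (w (Suc k - j)) M N)"
    by (subst (asm) mult_cancel_left) (simp del: of_nat_Suc)
  then show "of_nat (Suc (Suc k)) * w (Suc (Suc k)) M N = (\<Sum>j\<le>Suc k. lift j (w (Suc k - j)) M N)"
    unfolding D_w lift_def .
qed

lemma hop_rule_Suc: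
  assumes l: "\<And>m. m \<le> k \<Longrightarrow> lift_rule m" and h: "\<And>m. m \<le> k \<Longrightarrow> hop_rule m"
  shows "hop_rule (Suc k)"
  unfolding hop_rule_def
proof (intro allI ext)
  fix q M N
  have "of_nat (Suc k) * hop_op q (w (Suc k)) M N = hop_op q (\<lambda>M N. of_nat (Suc k) * w (Suc k) M N) M N"
    by (simp only: nice_linear_cmul[OF nice_linear_hop_op nice_w])
  also have "\<dots> = hop_op q (\<lambda>M N. \<Sum>j\<le>k. lift j (w (k - j)) M N) M N"
    using l[OF order_refl] unfolding lift_rule_def by (simp only:)
  also have "\<dots> = (\<Sum>j\<le>k. hop_op q (lift j (w (k - j))) M N)"
    by (subst nice_linear_sum[OF nice_linear_hop_op]) (auto intro: nice_linear_nice[OF nice_linear_lift] nice_w)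
  also have "\<dots> = (\<Sum>j\<le>k. \<Sum>i\<le>k - j. 2 * e i * cre_op (q + i) (lift j (w (k - j - i))) M N)
      + (\<Sum>j\<le>k. 2 * (of_nat (Suc j) * e (Suc j)) * cre_op (Suc (j + q)) (w (k - j)) M N)"
    unfolding sum.distrib[symmetric]
  proof (rule sum.cong[OF refl])
    fix j assume "j \<in> {..k}"
    have "lift j (hop_op q (w (k - j))) M N = lift j (\<lambda>M N. \<Sum>i\<le>k - j. 2 * e i * cre_op (q + i) (w (k - j - i)) M N) M N"
      using h[of "k - j"] unfolding hop_rule_def by simp
    also have "\<dots> = (\<Sum>i\<le>k - j. lift j (\<lambda>M N. 2 * e i * cre_op (q + i) (w (k - j - i)) M N) M N)"
      by (subst nice_linear_sum[OF nice_linear_lift]) (auto intro!: nice_cmul nice_linear_nice[OF nice_linear_cre_op] nice_w)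
    also have "\<dots> = (\<Sum>i\<le>k - j. 2 * e i * cre_op (q + i) (lift j (w (k - j - i))) M N)"
      by (simp only: nice_linear_cmul[OF nice_linear_lift nice_linear_nice[OF nice_linear_cre_op nice_w]] cre_lift[OF nice_w])
    finally show "hop_op q (lift j (w (k - j))) M N = (\<Sum>i\<le>k - j. 2 * e i * cre_op (q + i) (lift j (w (k - j - i))) M N)
       + 2 * (of_nat (Suc j) * e (Suc j)) * cre_op (Suc (j + q)) (w (k - j)) M N"
      unfolding hop_lift[OF nice_w] by simp
  qed
  also have "(\<Sum>j\<le>k. \<Sum>i\<le>k - j. 2 * e i * cre_op (q + i) (lift j (w (k - j - i))) M N)
      = (\<Sum>i\<le>k. \<Sum>j\<le>k - i. 2 * e i * cre_op (q + i) (lift j (w (k - j - i))) M N)"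
    by (rule sum_triangle_swap)
  also have "\<dots> = (\<Sum>i\<le>k. of_nat (Suc k - i) * (2 * e i * cre_op (q + i) (w (Suc k - i)) M N))"
  proof (rule sum.cong[OF refl])
    fix i assume i: "i \<in> {..k}"
    have "(\<Sum>j\<le>k - i. 2 * e i * cre_op (q + i) (lift j (w (k - j - i))) M N)
      = 2 * e i * (\<Sum>j\<le>k - i. cre_op (q + i) (lift j (w (k - i - j))) M N)"
      unfolding sum_distrib_left by (rule sum.cong) (simp_all add: add.commute)
    also have "(\<Sum>j\<le>k - i. cre_op (q + i) (lift j (w (k - i - j))) M N) = cre_op (q + i) (\<lambda>M N. \<Sum>j\<le>k - i. lift j (w (k - i - j)) M N) M N"
      by (subst nice_linear_sum[OF nice_linear_cre_op]) (auto intro: nice_linear_nice[OF nice_linear_lift] nice_w)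
    also have "\<dots> = cre_op (q + i) (\<lambda>M N. of_nat (Suc (k - i)) * w (Suc (k - i)) M N) M N"
      using l[of "k - i"] unfolding lift_rule_def by simp
    also have "\<dots> = of_nat (Suc (k - i)) * cre_op (q + i) (w (Suc (k - i))) M N"
      by (simp only: nice_linear_cmul[OF nice_linear_cre_op nice_w])
    also have "Suc (k - i) = Suc k - i" using i by (simp add: Suc_diff_le)
    finally show "(\<Sum>j\<le>k - i. 2 * e i * cre_op (q + i) (lift j (w (k - j - i))) M N) = of_nat (Suc k - i) * (2 * e i * cre_op (q + i) (w (Suc k - i)) M N)"
      by (simp only: mult_ac)
  qed
  also have "\<dots> = (\<Sum>i\<le>Suc k. of_nat (Suc k - i) * (2 * e i * cre_op (q + i) (w (Suc k - i)) M N))" by simp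
  also have "(\<Sum>j\<le>k. 2 * (of_nat (Suc j) * e (Suc j)) * cre_op (Suc (j + q)) (w (k - j)) M N)
      = (\<Sum>i\<le>Suc k. of_nat i * (2 * e i * cre_op (q + i) (w (Suc k - i)) M N))"
    by (subst sum.atMost_Suc_shift) (simp add: add.commute mult_ac del: eta.simps of_nat_Suc)
  also have "(\<Sum>i\<le>Suc k. of_nat (Suc k - i) * (2 * e i * cre_op (q + i) (w (Suc k - i)) M N)) + \<dots>
      = (\<Sum>i\<le>Suc k. of_nat (Suc k) * (2 * e i * cre_op (q + i) (w (Suc k - i)) M N))"
    unfolding sum.distrib[symmetric]
  proof (rule sum.cong[OF refl])
    fix i assume i: "i \<in> {..Suc k}"
    show "of_nat (Suc k - i) * (2 * e i * cre_op (q + i) (w (Suc k - i)) M N) + of_nat i * (2 * e i * cre_op (q + i) (w (Suc k - i)) M N)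
       = of_nat (Suc k) * (2 * e i * cre_op (q + i) (w (Suc k - i)) M N)"
      using i by (simp only: distrib_right[symmetric] of_nat_add[symmetric]) simp
  qed
  finally show "hop_op q (w (Suc k)) M N = (\<Sum>i\<le>Suc k. 2 * e i * cre_op (q + i) (w (Suc k - i)) M N)"
    unfolding sum_distrib_left[symmetric] by (subst (asm) mult_cancel_left) (simp del: of_nat_Suc)
qed

text \<open>The rules support each other: applying \<open>D\<close> to a creation operator produces a hop, and the action of a
hop on \<open>w (n + 1)\<close> is computed from the expansion of \<open>w (n + 1)\<close> in creation operators.\<close>

lemma lift_hop_rule: "lift_rule n \<and> hop_rule n"
proof (induction n rule: less_induct)
  case (less n)
  show ?case
  proof (cases n)
    case 0 then show ?thesis by (simp add: lift_rule_0 hop_rule_0)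
  next
    case (Suc k)
    have l: "lift_rule m" and h: "hop_rule m" if "m \<le> k" for m using less[of m] that Suc by auto
    show ?thesis unfolding Suc using lift_rule_Suc[OF l[OF order_refl] h] hop_rule_Suc[OF l h] by blast
  qed
qed

lemma taylor_vacuum_component:
  "w n {#} {#} = of_real (vac_moment (\<lambda>j. - (b - a) * fps_nth (tanh_series (b - a)) (j - 1)) g n)"
proof (induction n rule: less_induct)
  case (less n)
  let ?\<tau> = "\<lambda>j. - (b - a) * fps_nth (tanh_series (b - a)) (j - 1)"
  show ?case
  proof (cases n)
    case 0 then show ?thesis by (simp add: vacuum_def)
  next
    case (Suc k)
    have "of_nat (Suc k) * w (Suc k) {#} {#} = (\<Sum>j\<le>k. lift j (w (k - j)) {#} {#})"
      using lift_hop_rule[of k] unfolding lift_rule_def by (auto dest!: fun_cong[where x="{#}"] simp del: taylor.simps of_nat_Suc)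
    also have "\<dots> = (\<Sum>j\<le>k. of_real (g * eta g j * ?\<tau> (Suc j) * vac_moment ?\<tau> g (k - j)))"
    proof (rule sum.cong[OF refl])
      fix j assume "j \<in> {..k}"
      have "w (k - j) {#} {#} = of_real (vac_moment ?\<tau> g (k - j))" using less[of "k - j"] Suc by simp
      then show "lift j (w (k - j)) {#} {#} = of_real (g * eta g j * ?\<tau> (Suc j) * vac_moment ?\<tau> g (k - j))"
        by (simp add: lift_def cre_op_def pair_cre_def kernel_trace_eq del: eta.simps taylor.simps vac_moment.simps)
    qed
    also have "\<dots> = of_real (real (Suc k) * vac_moment ?\<tau> g (Suc k))"
      unfolding vac_moment.simps of_real_sum[symmetric] by simp
    finally have "of_nat (Suc k) * w (Suc k) {#} {#} = of_nat (Suc k) * of_real (vac_moment ?\<tau> g (Suc k))"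
      by (simp only: of_real_mult of_real_of_nat_eq)
    then show ?thesis unfolding Suc by (subst (asm) mult_cancel_left) (simp del: of_nat_Suc vac_moment.simps taylor.simps)
  qed
qed

end

section \<open>Independence of the choice of representatives\<close>

text \<open>The Levy area of a vector is an arbitrary representative of its class, so the next application of the
area must not depend on that choice.\<close>

definition ae_eq :: "fock2 \<Rightarrow> fock2 \<Rightarrow> bool" where
  "ae_eq \<psi> \<psi>' \<longleftrightarrow> (\<forall>n k. AE z in particle_measure n k. component n k \<psi> z = component n k \<psi>' z)"

lemma sigma_finite_particles: "sigma_finite_measure (Pi\<^sub>M {..<n::nat} (\<lambda>_. half_line))"
  by (rule half_lines.sigma_finite) simp

lemma pair_sigma_finite_particles:
  "pair_sigma_finite (Pi\<^sub>M {..<n::nat} (\<lambda>_. half_line)) (Pi\<^sub>M {..<k::nat} (\<lambda>_. half_line))"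
  unfolding pair_sigma_finite_def using sigma_finite_particles by blast

lemma distr_PiM_half_line_reindex:
  fixes I J :: "nat set"
  assumes fin: "finite I" and bij: "bij_betw \<sigma> J I"
  shows "distr (Pi\<^sub>M I (\<lambda>_. half_line)) (Pi\<^sub>M J (\<lambda>_. half_line)) (\<lambda>x. \<lambda>j\<in>J. x (\<sigma> j)) = Pi\<^sub>M J (\<lambda>_. half_line)"
proof (rule half_lines.PiM_eqI)
  show fJ: "finite J" using bij fin bij_betw_finite by blast
  have img: "\<sigma> j \<in> I" if "j \<in> J" for j using bij that bij_betwE by blast
  have m: "(\<lambda>x. \<lambda>j\<in>J. x (\<sigma> j)) \<in> measurable (Pi\<^sub>M I (\<lambda>_. half_line)) (Pi\<^sub>M J (\<lambda>_. half_line))"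
    by (rule measurable_restrict) (rule measurable_component_singleton, rule img)
  fix A :: "nat \<Rightarrow> real set" assume A: "\<And>j. j \<in> J \<Longrightarrow> A j \<in> sets half_line"
  let ?\<tau> = "the_inv_into J \<sigma>"
  have \<tau>: "?\<tau> (\<sigma> j) = j" if "j \<in> J" for j using bij that by (simp add: bij_betw_def the_inv_into_f_f)
  have eq: "(\<lambda>x. \<lambda>j\<in>J. x (\<sigma> j)) -` Pi\<^sub>E J A \<inter> space (Pi\<^sub>M I (\<lambda>_. half_line)) = Pi\<^sub>E I (\<lambda>i. A (?\<tau> i))"
  proof (intro set_eqI iffI)
    fix x assume x: "x \<in> (\<lambda>x. \<lambda>j\<in>J. x (\<sigma> j)) -` Pi\<^sub>E J A \<inter> space (Pi\<^sub>M I (\<lambda>_. half_line))"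
    have "x i \<in> A (?\<tau> i)" if "i \<in> I" for i
    proof -
      obtain j where j: "j \<in> J" "i = \<sigma> j" using bij \<open>i \<in> I\<close> unfolding bij_betw_def by blast
      then have "(\<lambda>j\<in>J. x (\<sigma> j)) j \<in> A j" using x by blast
      then show ?thesis using j \<tau> by simp
    qed
    moreover have "x \<in> extensional I" using x by (auto simp: space_PiM PiE_def)
    ultimately show "x \<in> Pi\<^sub>E I (\<lambda>i. A (?\<tau> i))" by (auto simp: PiE_def)
  next
    fix x assume x: "x \<in> Pi\<^sub>E I (\<lambda>i. A (?\<tau> i))"
    have xj: "x (\<sigma> j) \<in> A j" if "j \<in> J" for j
    proof -
      have "x (\<sigma> j) \<in> A (?\<tau> (\<sigma> j))" using x img[OF that] by blast
      then show ?thesis using \<tau>[OF that] by simp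
    qed
    have "x i \<in> space half_line" if "i \<in> I" for i
    proof -
      obtain j where j: "j \<in> J" "i = \<sigma> j" using bij \<open>i \<in> I\<close> unfolding bij_betw_def by blast
      then show ?thesis using xj[of j] A[of j] sets.sets_into_space by blast
    qed
    moreover have "x \<in> extensional I" using x by (simp add: PiE_def)
    ultimately show "x \<in> (\<lambda>x. \<lambda>j\<in>J. x (\<sigma> j)) -` Pi\<^sub>E J A \<inter> space (Pi\<^sub>M I (\<lambda>_. half_line))"
      using xj by (auto simp: space_PiM PiE_def)
  qed
  have "emeasure (distr (Pi\<^sub>M I (\<lambda>_. half_line)) (Pi\<^sub>M J (\<lambda>_. half_line)) (\<lambda>x. \<lambda>j\<in>J. x (\<sigma> j))) (Pi\<^sub>E J A)
     = emeasure (Pi\<^sub>M I (\<lambda>_. half_line)) (Pi\<^sub>E I (\<lambda>i. A (?\<tau> i)))"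
    by (subst emeasure_distr[OF m]) (use A fJ eq in \<open>auto intro!: sets_PiM_I_finite\<close>)
  also have "\<dots> = (\<Prod>i\<in>I. emeasure half_line (A (?\<tau> i)))"
  proof (rule half_lines.emeasure_PiM[OF fin])
    fix i assume "i \<in> I"
    then obtain j where "j \<in> J" "i = \<sigma> j" using bij unfolding bij_betw_def by blast
    then show "A (?\<tau> i) \<in> sets half_line" using A \<tau> by simp
  qed
  also have "\<dots> = (\<Prod>j\<in>J. emeasure half_line (A (?\<tau> (\<sigma> j))))"
    by (rule prod.reindex_bij_betw[OF bij, symmetric])
  also have "\<dots> = (\<Prod>j\<in>J. emeasure half_line (A j))"
    by (rule prod.cong) (simp_all add: \<tau>)
  finally show "emeasure (distr (Pi\<^sub>M I (\<lambda>_. half_line)) (Pi\<^sub>M J (\<lambda>_. half_line)) (\<lambda>x. \<lambda>j\<in>J. x (\<sigma> j))) (Pi\<^sub>E J A)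
     = (\<Prod>j\<in>J. emeasure half_line (A j))" .
qed simp


text \<open>The last left particle is integrated out first.\<close>

lemma nn_integral_particle_Suc:
  assumes f: "f \<in> borel_measurable (particle_measure (Suc n) k)"
  shows "(\<integral>\<^sup>+z. f z \<partial>particle_measure (Suc n) k) =
    (\<integral>\<^sup>+z. (\<integral>\<^sup>+u. f ((fst z)(n := u), snd z) \<partial>half_line) \<partial>particle_measure n k)"
proof -
  let ?A = "Pi\<^sub>M {..<n} (\<lambda>_. half_line)" and ?A' = "Pi\<^sub>M {..<Suc n} (\<lambda>_. half_line)" and ?B = "Pi\<^sub>M {..<k} (\<lambda>_. half_line)"
  interpret A': pair_sigma_finite ?A' ?B by (rule pair_sigma_finite_particles)
  interpret A: pair_sigma_finite ?A ?B by (rule pair_sigma_finite_particles)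
  have ins: "{..<Suc n} = insert n {..<n}" by auto
  have f': "f \<in> borel_measurable (?A' \<Otimes>\<^sub>M ?B)" using f by (simp add: particle_measure_def)
  have up: "(\<lambda>s. ((fst (fst s))(n := snd s), snd (fst s))) \<in> measurable ((?A \<Otimes>\<^sub>M ?B) \<Otimes>\<^sub>M half_line) (?A' \<Otimes>\<^sub>M ?B)"
  proof (intro measurable_Pair)
    have "(\<lambda>s. (fst (fst s))(n := snd s)) \<in> measurable ((?A \<Otimes>\<^sub>M ?B) \<Otimes>\<^sub>M half_line) (Pi\<^sub>M (insert n {..<n}) (\<lambda>_. half_line))"
      by (rule measurable_fun_upd[of _ "{..<n}"]) (auto intro: measurable_compose[OF measurable_fst measurable_fst])
    then show "(\<lambda>s. (fst (fst s))(n := snd s)) \<in> measurable ((?A \<Otimes>\<^sub>M ?B) \<Otimes>\<^sub>M half_line) ?A'" unfolding ins .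
    show "(\<lambda>s. snd (fst s)) \<in> measurable ((?A \<Otimes>\<^sub>M ?B) \<Otimes>\<^sub>M half_line) ?B"
      by (rule measurable_compose[OF measurable_fst measurable_snd])
  qed
  have h: "(\<lambda>z. \<integral>\<^sup>+u. f ((fst z)(n := u), snd z) \<partial>half_line) \<in> borel_measurable (?A \<Otimes>\<^sub>M ?B)"
    using half_line.borel_measurable_nn_integral[of "\<lambda>z u. f ((fst z)(n := u), snd z)" "?A \<Otimes>\<^sub>M ?B"]
      measurable_compose[OF up f'] by (simp add: split_def)
  have "(\<integral>\<^sup>+z. f z \<partial>particle_measure (Suc n) k) = (\<integral>\<^sup>+y. (\<integral>\<^sup>+x. f (x, y) \<partial>?A') \<partial>?B)"
    unfolding particle_measure_def by (rule A'.nn_integral_snd[symmetric]) (use f' in simp)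
  also have "\<dots> = (\<integral>\<^sup>+y. (\<integral>\<^sup>+x. (\<integral>\<^sup>+u. f (x(n := u), y) \<partial>half_line) \<partial>?A) \<partial>?B)"
  proof (rule nn_integral_cong)
    fix y assume y: "y \<in> space ?B"
    have "(\<lambda>x. f (x, y)) \<in> borel_measurable ?A'" using measurable_Pair1[OF f' y] .
    then show "(\<integral>\<^sup>+x. f (x, y) \<partial>?A') = (\<integral>\<^sup>+x. (\<integral>\<^sup>+u. f (x(n := u), y) \<partial>half_line) \<partial>?A)"
      unfolding ins by (intro half_lines.product_nn_integral_insert) auto
  qed
  also have "\<dots> = (\<integral>\<^sup>+z. (\<integral>\<^sup>+u. f ((fst z)(n := u), snd z) \<partial>half_line) \<partial>particle_measure n k)"
    unfolding particle_measure_def using A.nn_integral_snd[OF h] by simp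
  finally show ?thesis .
qed

lemma measurable_component_eq:
  assumes "meas \<psi>" "meas \<psi>'"
  shows "{z \<in> space (particle_measure n k). component n k \<psi> z \<noteq> component n k \<psi>' z} \<in> sets (particle_measure n k)"
    "{z \<in> space (particle_measure n k). component n k \<psi> z = component n k \<psi>' z} \<in> sets (particle_measure n k)"
proof -
  have [measurable]: "component n k \<psi> \<in> borel_measurable (particle_measure n k)" "component n k \<psi>' \<in> borel_measurable (particle_measure n k)"
    using assms by (auto simp: meas_def)
  show "{z \<in> space (particle_measure n k). component n k \<psi> z \<noteq> component n k \<psi>' z} \<in> sets (particle_measure n k)"
    "{z \<in> space (particle_measure n k). component n k \<psi> z = component n k \<psi>' z} \<in> sets (particle_measure n k)"
    by measurable
qed

lemma config_upd: "config (Suc n) (x(n := u)) = add_mset u (config n x)"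
proof -
  have "image_mset (x(n := u)) (mset_set {..<n}) = image_mset x (mset_set {..<n})"
    by (rule image_mset_cong) auto
  then show ?thesis by (simp add: config_def lessThan_Suc)
qed

text \<open>By Fubini, almost every section of a null set is null.\<close>

lemma ae_eq_add:
  assumes m: "meas \<psi>" "meas \<psi>'" and e: "ae_eq \<psi> \<psi>'"
  shows "AE z in particle_measure n k. AE u in half_line. \<psi> (add_mset u (config n (fst z))) (config k (snd z)) = \<psi>' (add_mset u (config n (fst z))) (config k (snd z))"
proof -
  let ?A = "Pi\<^sub>M {..<n} (\<lambda>_. half_line)" and ?A' = "Pi\<^sub>M {..<Suc n} (\<lambda>_. half_line)" and ?B = "Pi\<^sub>M {..<k} (\<lambda>_. half_line)"
  let ?N = "{z \<in> space (particle_measure (Suc n) k). component (Suc n) k \<psi> z \<noteq> component (Suc n) k \<psi>' z}"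
  have N[measurable]: "?N \<in> sets (particle_measure (Suc n) k)" by (rule measurable_component_eq(1)[OF m])
  have "AE z in particle_measure (Suc n) k. component (Suc n) k \<psi> z = component (Suc n) k \<psi>' z" using e by (simp add: ae_eq_def)
  then have "emeasure (particle_measure (Suc n) k) ?N = 0"
    by (subst (asm) AE_iff_measurable[OF N refl]) 
  then have "(\<integral>\<^sup>+z. indicator ?N z \<partial>particle_measure (Suc n) k) = 0" by simp
  then have z: "(\<integral>\<^sup>+z. (\<integral>\<^sup>+u. indicator ?N ((fst z)(n := u), snd z) \<partial>half_line) \<partial>particle_measure n k) = 0"
    by (subst (asm) nn_integral_particle_Suc) simp_all
  have ins: "{..<Suc n} = insert n {..<n}" by auto
  have up: "(\<lambda>s. ((fst (fst s))(n := snd s), snd (fst s))) \<in> measurable (particle_measure n k \<Otimes>\<^sub>M half_line) (particle_measure (Suc n) k)"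
    unfolding particle_measure_def
  proof (intro measurable_Pair)
    have "(\<lambda>s. (fst (fst s))(n := snd s)) \<in> measurable ((?A \<Otimes>\<^sub>M ?B) \<Otimes>\<^sub>M half_line) (Pi\<^sub>M (insert n {..<n}) (\<lambda>_. half_line))"
      by (rule measurable_fun_upd[of _ "{..<n}"]) (auto intro: measurable_compose[OF measurable_fst measurable_fst])
    then show "(\<lambda>s. (fst (fst s))(n := snd s)) \<in> measurable ((?A \<Otimes>\<^sub>M ?B) \<Otimes>\<^sub>M half_line) ?A'" unfolding ins .
    show "(\<lambda>s. snd (fst s)) \<in> measurable ((?A \<Otimes>\<^sub>M ?B) \<Otimes>\<^sub>M half_line) ?B"
      by (rule measurable_compose[OF measurable_fst measurable_snd])
  qed
  have I: "(\<lambda>s. indicator ?N ((fst (fst s))(n := snd s), snd (fst s)) :: ennreal) \<in> borel_measurable (particle_measure n k \<Otimes>\<^sub>M half_line)"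
    by (rule measurable_compose[OF up]) simp
  have h: "(\<lambda>z. \<integral>\<^sup>+u. indicator ?N ((fst z)(n := u), snd z) \<partial>half_line) \<in> borel_measurable (particle_measure n k)"
    using half_line.borel_measurable_nn_integral[of "\<lambda>z u. indicator ?N ((fst z)(n := u), snd z)" "particle_measure n k"] I
    by (simp add: split_def)
  have "AE z in particle_measure n k. (\<integral>\<^sup>+u. indicator ?N ((fst z)(n := u), snd z) \<partial>half_line) = 0"
    using z by (subst (asm) nn_integral_0_iff_AE[OF h])
  then show ?thesis
  proof (rule AE_mp, rule_tac AE_I2, rule_tac impI)
    fix z assume zs: "z \<in> space (particle_measure n k)" and 0: "(\<integral>\<^sup>+u. indicator ?N ((fst z)(n := u), snd z) \<partial>half_line) = 0"
    have "(\<lambda>u. indicator ?N ((fst z)(n := u), snd z) :: ennreal) \<in> borel_measurable half_line"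
      using measurable_Pair2[OF I zs] by simp
    from nn_integral_0_iff_AE[OF this] 0 have "AE u in half_line. (indicator ?N ((fst z)(n := u), snd z) :: ennreal) = 0" by simp
    then show "AE u in half_line. \<psi> (add_mset u (config n (fst z))) (config k (snd z)) = \<psi>' (add_mset u (config n (fst z))) (config k (snd z))"
    proof (rule AE_mp, intro AE_I2 impI)
      fix u assume u: "u \<in> space half_line" and i: "(indicator ?N ((fst z)(n := u), snd z) :: ennreal) = 0"
      have "((fst z)(n := u), snd z) \<in> space (particle_measure (Suc n) k)"
        using measurable_space[OF up, of "(z, u)"] zs u by (simp add: space_pair_measure)
      then have "component (Suc n) k \<psi> ((fst z)(n := u), snd z) = component (Suc n) k \<psi>' ((fst z)(n := u), snd z)"
        using i by (auto simp: indicator_def split: if_splits)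
      then show "\<psi> (add_mset u (config n (fst z))) (config k (snd z)) = \<psi>' (add_mset u (config n (fst z))) (config k (snd z))"
        by (simp add: component_def config_upd)
    qed
  qed
qed

lemma ae_eq_ann_left:
  assumes m: "meas \<psi>" "meas \<psi>'" and e: "ae_eq \<psi> \<psi>'" and f: "f \<in> borel_measurable half_line"
  shows "ae_eq (ann_left f \<psi>) (ann_left f \<psi>')"
  unfolding ae_eq_def
proof (intro allI)
  fix n k
  have sec: "(\<lambda>u. \<phi> (add_mset u (config n (fst z))) (config k (snd z))) \<in> borel_measurable half_line"
    if "meas \<phi>" "z \<in> space (particle_measure n k)" for \<phi> z
  proof -
    have "(\<lambda>s. \<phi> (mset (map (\<lambda>g. g s) ((\<lambda>u. u) # map (\<lambda>i _. fst z i) [0..<n]))) (mset (map (\<lambda>h. h s) (map (\<lambda>i _. snd z i) [0..<k])))) \<in> borel_measurable half_line"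
    proof (rule meas_section[OF that(1)])
      have sp: "fst z i \<in> space half_line" if "i < n" for i
        using \<open>z \<in> space (particle_measure n k)\<close> that by (auto simp: particle_measure_def space_pair_measure space_PiM)
      have sp': "snd z i \<in> space half_line" if "i < k" for i
        using \<open>z \<in> space (particle_measure n k)\<close> that by (auto simp: particle_measure_def space_pair_measure space_PiM)
      show "g \<in> measurable half_line half_line" if "g \<in> set ((\<lambda>u. u) # map (\<lambda>i _. fst z i) [0..<n])" for g
        using that by (auto simp: sp)
      show "h \<in> measurable half_line half_line" if "h \<in> set (map (\<lambda>i _. snd z i) [0..<k])" for h
        using that by (auto simp: sp')
    qed
    then show ?thesis by (simp add: config_conv_mset o_def)
  qed
  show "AE z in particle_measure n k. component n k (ann_left f \<psi>) z = component n k (ann_left f \<psi>') z"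
    using ae_eq_add[OF m e, of n k]
  proof (rule AE_mp, intro AE_I2 impI)
    fix z assume zs: "z \<in> space (particle_measure n k)"
      and AE: "AE u in half_line. \<psi> (add_mset u (config n (fst z))) (config k (snd z)) = \<psi>' (add_mset u (config n (fst z))) (config k (snd z))"
    have "ann_left f \<psi> (config n (fst z)) (config k (snd z)) = ann_left f \<psi>' (config n (fst z)) (config k (snd z))"
      unfolding ann_left_def
      by (rule integral_cong_AE) (use AE in \<open>auto intro!: borel_measurable_times f sec m zs\<close>)
    then show "component n k (ann_left f \<psi>) z = component n k (ann_left f \<psi>') z"
      by (simp add: component_def split_def)
  qed
qed

text \<open>The preimage of a null set under forgetting one particle is null, although the forgotten coordinate
ranges over a set of infinite measure.\<close>

lemma ae_eq_remove:
  assumes m: "meas \<psi>" "meas \<psi>'" and e: "ae_eq \<psi> \<psi>'" and i: "i \<le> n"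
  shows "AE z in particle_measure (Suc n) k. \<psi> (config (Suc n) (fst z) - {#fst z i#}) (config k (snd z)) = \<psi>' (config (Suc n) (fst z) - {#fst z i#}) (config k (snd z))"
proof -
  \<comment> \<open>The gap at \<open>i\<close> is filled with the last coordinate; the multiset of the others does not notice.\<close>
  let ?I = "{..<Suc n} - {i}" and ?\<sigma> = "\<lambda>j. if j = i then n else j"
  let ?M = "\<lambda>I. Pi\<^sub>M I (\<lambda>_. half_line)"
  let ?r = "\<lambda>x. \<lambda>j\<in>{..<n}. x (?\<sigma> j)"
  let ?N = "{z \<in> space (particle_measure n k). component n k \<psi> z \<noteq> component n k \<psi>' z}"
  have N[measurable]: "?N \<in> sets (particle_measure n k)" by (rule measurable_component_eq(1)[OF m])
  have e0: "emeasure (particle_measure n k) ?N = 0"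
  proof -
    have "AE z in particle_measure n k. component n k \<psi> z = component n k \<psi>' z" using e by (simp add: ae_eq_def)
    then show ?thesis by (subst (asm) AE_iff_measurable[OF N refl])
  qed
  have bij: "bij_betw ?\<sigma> {..<n} ?I"
    by (rule bij_betwI[where g="\<lambda>j. if j = n then i else j"]) (use i in auto)
  have r: "?r \<in> measurable (?M ?I) (?M {..<n})" 
    by (rule measurable_restrict) (rule measurable_component_singleton, use i in auto)
  have r': "?r \<in> measurable (?M {..<Suc n}) (?M {..<n})" 
    by (rule measurable_restrict) (rule measurable_component_singleton, use i in auto)
  have R: "(\<lambda>z. (?r (fst z), snd z)) \<in> measurable (particle_measure (Suc n) k) (particle_measure n k)"
    unfolding particle_measure_def by (rule measurable_Pair[OF measurable_compose[OF measurable_fst r'] measurable_snd])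
  have conf: "config (Suc n) x - {#x i#} = config n (?r x)" for x :: "nat \<Rightarrow> real"
  proof -
    have "config (Suc n) x = add_mset (x i) (image_mset x (mset_set ?I))"
    proof -
      have "{..<Suc n} = insert i ?I" using i by auto
      then have "mset_set {..<Suc n} = add_mset i (mset_set ?I)" by (metis Diff_iff finite_Diff finite_lessThan insertI1 mset_set.insert)
      then show ?thesis by (simp add: config_def)
    qed
    moreover have "image_mset x (mset_set ?I) = config n (?r x)"
    proof -
      have "mset_set ?I = image_mset ?\<sigma> (mset_set {..<n})"
        using bij by (simp add: bij_betw_def image_mset_mset_set)
      then have "image_mset x (mset_set ?I) = image_mset (x \<circ> ?\<sigma>) (mset_set {..<n})" by (simp add: image_mset.compositionality)
      also have "\<dots> = config n (?r x)" unfolding config_def by (rule image_mset_cong) auto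
      finally show ?thesis .
    qed
    ultimately show ?thesis by simp
  qed
  interpret P: pair_sigma_finite "?M {..<n}" "?M {..<k}" by (rule pair_sigma_finite_particles)
  interpret P': pair_sigma_finite "?M {..<Suc n}" "?M {..<k}" by (rule pair_sigma_finite_particles)
  have Nm: "(indicator ?N :: _ \<Rightarrow> ennreal) \<in> borel_measurable (?M {..<n} \<Otimes>\<^sub>M ?M {..<k})"
    using N unfolding particle_measure_def by simp
  have "(\<integral>\<^sup>+y. (\<integral>\<^sup>+x. indicator ?N (x, y) \<partial>?M {..<n}) \<partial>?M {..<k}) = (0::ennreal)"
    unfolding P.nn_integral_snd[OF Nm] using e0 N unfolding particle_measure_def by simp
  moreover have ym: "(\<lambda>y. \<integral>\<^sup>+x. indicator ?N (x, y) \<partial>?M {..<n} :: ennreal) \<in> borel_measurable (?M {..<k})"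
    using P.M1.borel_measurable_nn_integral_fst[of "\<lambda>p. indicator ?N (snd p, fst p)" "?M {..<k}"]
      measurable_compose[OF measurable_pair_swap' Nm] by (simp add: split_def)
  ultimately have y0: "AE y in ?M {..<k}. (\<integral>\<^sup>+x. indicator ?N (x, y) \<partial>?M {..<n}) = (0::ennreal)"
    by (subst (asm) nn_integral_0_iff_AE[OF ym])
  have INm: "(\<lambda>z. indicator ?N (?r (fst z), snd z) :: ennreal) \<in> borel_measurable (?M {..<Suc n} \<Otimes>\<^sub>M ?M {..<k})"
    using measurable_compose[OF R[unfolded particle_measure_def] Nm] .
  have "(\<integral>\<^sup>+y. (\<integral>\<^sup>+x. indicator ?N (?r x, y) \<partial>?M {..<Suc n}) \<partial>?M {..<k}) = (\<integral>\<^sup>+y. (0::ennreal) \<partial>?M {..<k})"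
  proof (rule nn_integral_cong_AE, use y0 in \<open>rule AE_mp\<close>, intro AE_I2 impI)
    fix y assume y: "y \<in> space (?M {..<k})" and z: "(\<integral>\<^sup>+x. indicator ?N (x, y) \<partial>?M {..<n}) = (0::ennreal)"
    have ins: "insert i ?I = {..<Suc n}" using i by auto
    have s1: "(\<lambda>x. indicator ?N (x, y) :: ennreal) \<in> borel_measurable (?M {..<n})" by (rule measurable_Pair1[OF Nm y])
    have s2: "(\<lambda>x. indicator ?N (?r x, y) :: ennreal) \<in> borel_measurable (?M {..<Suc n})"
      using measurable_compose[OF r' s1] .
    have "(\<integral>\<^sup>+x. indicator ?N (?r x, y) \<partial>?M {..<Suc n}) = (\<integral>\<^sup>+x. (\<integral>\<^sup>+u. indicator ?N (?r (x(i := u)), y) \<partial>half_line) \<partial>?M ?I)"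
      by (rule half_lines.product_nn_integral_insert[where I="?I" and i=i, unfolded ins]) (use s2 in simp_all)
    also have "\<dots> = (\<integral>\<^sup>+x. (\<integral>\<^sup>+u. indicator ?N (?r x, y) \<partial>half_line) \<partial>?M ?I)"
    proof -
      have rr: "?r (x(i := u)) = ?r x" for x u using i by (auto simp: fun_eq_iff)
      show ?thesis unfolding rr ..
    qed
    also have "\<dots> = 0"
    proof -
      have s3: "(\<lambda>x. indicator ?N (?r x, y) :: ennreal) \<in> borel_measurable (?M ?I)" using measurable_compose[OF r s1] .
      have "(\<integral>\<^sup>+x. indicator ?N (?r x, y) \<partial>?M ?I) = (\<integral>\<^sup>+x. indicator ?N (x, y) \<partial>distr (?M ?I) (?M {..<n}) ?r)"
        by (subst nn_integral_distr[OF r]) (simp_all only: measurable_distr_eq1 s1)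
      also have "\<dots> = (0::ennreal)" unfolding distr_PiM_half_line_reindex[OF _ bij, simplified] by (rule z)
      finally have "AE x in ?M ?I. (indicator ?N (?r x, y) :: ennreal) = 0"
        by (subst (asm) nn_integral_0_iff_AE[OF s3])
      then have "(\<integral>\<^sup>+x. (\<integral>\<^sup>+u. indicator ?N (?r x, y) \<partial>half_line) \<partial>?M ?I) = (\<integral>\<^sup>+x. (0::ennreal) \<partial>?M ?I)"
        by (intro nn_integral_cong_AE) (auto elim!: AE_mp)
      then show ?thesis by simp
    qed
    finally show "(\<integral>\<^sup>+x. indicator ?N (?r x, y) \<partial>?M {..<Suc n}) = (0::ennreal)" .
  qed
  then have "(\<integral>\<^sup>+z. indicator ?N (?r (fst z), snd z) \<partial>particle_measure (Suc n) k) = (0::ennreal)"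
    unfolding particle_measure_def[of "Suc n" k] using P'.nn_integral_snd[OF INm] by simp
  then have "AE z in particle_measure (Suc n) k. (indicator ?N (?r (fst z), snd z) :: ennreal) = 0"
    using INm by (subst (asm) nn_integral_0_iff_AE) (simp_all add: particle_measure_def)
  then show ?thesis
  proof (rule AE_mp, intro AE_I2 impI)
    fix z assume z: "z \<in> space (particle_measure (Suc n) k)" and i0: "(indicator ?N (?r (fst z), snd z) :: ennreal) = 0"
    have "(?r (fst z), snd z) \<in> space (particle_measure n k)" using measurable_space[OF R z] .
    then have "component n k \<psi> (?r (fst z), snd z) = component n k \<psi>' (?r (fst z), snd z)"
      using i0 by (auto simp: indicator_def split: if_splits)
    then show "\<psi> (config (Suc n) (fst z) - {#fst z i#}) (config k (snd z)) = \<psi>' (config (Suc n) (fst z) - {#fst z i#}) (config k (snd z))"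
      unfolding conf by (simp add: component_def)
  qed
qed

lemma ae_eq_cre_left:
  assumes m: "meas \<psi>" "meas \<psi>'" and e: "ae_eq \<psi> \<psi>'"
  shows "ae_eq (cre_left f \<psi>) (cre_left f \<psi>')"
  unfolding ae_eq_def
proof (intro allI)
  fix n k
  show "AE z in particle_measure n k. component n k (cre_left f \<psi>) z = component n k (cre_left f \<psi>') z"
  proof (cases n)
    case 0
    then show ?thesis by (simp add: component_def cre_left_def config_def split_def)
  next
    case (Suc l)
    have "AE z in particle_measure n k. \<forall>i\<in>{..<n}. \<psi> (config n (fst z) - {#fst z i#}) (config k (snd z)) = \<psi>' (config n (fst z) - {#fst z i#}) (config k (snd z))"
      unfolding Suc by (rule AE_finite_allI) (auto intro!: ae_eq_remove m e)
    then show ?thesis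
    proof (rule AE_mp, intro AE_I2 impI)
      fix z assume z: "\<forall>i\<in>{..<n}. \<psi> (config n (fst z) - {#fst z i#}) (config k (snd z)) = \<psi>' (config n (fst z) - {#fst z i#}) (config k (snd z))"
      have "cre_left f \<psi> (config n (fst z)) (config k (snd z)) = cre_left f \<psi>' (config n (fst z)) (config k (snd z))"
        unfolding cre_left_def
      proof (rule arg_cong[where f=sum_mset], rule image_mset_cong)
        fix x assume "x \<in># config n (fst z)"
        then obtain i where "i < n" "x = fst z i" by (auto simp: config_def)
        then show "f x * \<psi> (config n (fst z) - {#x#}) (config k (snd z)) = f x * \<psi>' (config n (fst z) - {#x#}) (config k (snd z))"
          using z by simp
      qed
      then show "component n k (cre_left f \<psi>) z = component n k (cre_left f \<psi>') z" by (simp add: component_def split_def)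
    qed
  qed
qed

lemma ae_eq_swap2:
  assumes m: "meas \<psi>" "meas \<psi>'" and e: "ae_eq \<psi> \<psi>'" shows "ae_eq (swap2 \<psi>) (swap2 \<psi>')"
  unfolding ae_eq_def
proof (intro allI)
  fix n k :: nat
  interpret P: pair_sigma_finite "Pi\<^sub>M {..<k} (\<lambda>_. half_line)" "Pi\<^sub>M {..<n} (\<lambda>_. half_line)" by (rule pair_sigma_finite_particles)
  have "AE z in particle_measure k n. component k n \<psi> z = component k n \<psi>' z" using e by (simp add: ae_eq_def)
  then have "AE z in particle_measure n k. component k n \<psi> (snd z, fst z) = component k n \<psi>' (snd z, fst z)"
    unfolding particle_measure_def
    by (subst (asm) P.distr_pair_swap, subst (asm) AE_distr_iff)
       (use measurable_component_eq(2)[OF m, of k n] in \<open>auto simp: split_def particle_measure_def\<close>)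
  then show "AE z in particle_measure n k. component n k (swap2 \<psi>) z = component n k (swap2 \<psi>') z"
    by (simp add: component_def swap2_def split_def)
qed


definition regular_op :: "(fock2 \<Rightarrow> fock2) \<Rightarrow> bool" where
  "regular_op X \<longleftrightarrow> (\<forall>\<psi>. meas \<psi> \<longrightarrow> meas (X \<psi>)) \<and>
     (\<forall>\<psi> \<psi>'. meas \<psi> \<longrightarrow> meas \<psi>' \<longrightarrow> ae_eq \<psi> \<psi>' \<longrightarrow> ae_eq (X \<psi>) (X \<psi>'))"

lemma regular_ann_left: "f \<in> borel_measurable half_line \<Longrightarrow> regular_op (ann_left f)"
  unfolding regular_op_def by (simp add: meas_ann_left ae_eq_ann_left)
lemma regular_cre_left: "f \<in> borel_measurable half_line \<Longrightarrow> regular_op (cre_left f)"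
  unfolding regular_op_def by (simp add: meas_cre_left ae_eq_cre_left)
lemma regular_swap2: "regular_op swap2"
  unfolding regular_op_def by (simp add: meas_swap2 ae_eq_swap2)
lemma regular_comp: "regular_op X \<Longrightarrow> regular_op Y \<Longrightarrow> regular_op (\<lambda>\<psi>. X (Y \<psi>))"
  unfolding regular_op_def by simp
lemma regular_ann_right: "f \<in> borel_measurable half_line \<Longrightarrow> regular_op (ann_right f)"
  using regular_comp[OF regular_swap2 regular_comp[OF regular_ann_left regular_swap2]] by (simp add: ann_right_swap[abs_def])
lemma regular_cre_right: "f \<in> borel_measurable half_line \<Longrightarrow> regular_op (cre_right f)"
  using regular_comp[OF regular_swap2 regular_comp[OF regular_cre_left regular_swap2]] by (simp add: cre_right_swap[abs_def])

lemma component_scale: "component n k (\<lambda>M N. c (size M) (size N) * \<psi> M N) = (\<lambda>z. c n k * component n k \<psi> z)"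
  by (simp add: component_def fun_eq_iff size_config)

lemma meas_scale: "meas \<psi> \<Longrightarrow> meas (\<lambda>M N. c (size M) (size N) * \<psi> M N)"
  unfolding meas_def component_scale by (intro allI borel_measurable_times) auto

lemma regular_scale: "regular_op X \<Longrightarrow> regular_op (\<lambda>\<psi> M N. c (size M) (size N) * X \<psi> M N)"
  unfolding regular_op_def ae_eq_def using meas_scale by (auto simp: component_scale)

lemma component_add: "component n k (\<lambda>M N. \<psi> M N + \<phi> M N) = (\<lambda>z. component n k \<psi> z + component n k \<phi> z)"
  by (simp add: component_def fun_eq_iff)
lemma component_diff: "component n k (\<lambda>M N. \<psi> M N - \<phi> M N) = (\<lambda>z. component n k \<psi> z - component n k \<phi> z)"
  by (simp add: component_def fun_eq_iff)

lemma ae_eq_add_vec: "ae_eq \<psi> \<psi>' \<Longrightarrow> ae_eq \<phi> \<phi>' \<Longrightarrow> ae_eq (\<lambda>M N. \<psi> M N + \<phi> M N) (\<lambda>M N. \<psi>' M N + \<phi>' M N)"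
  unfolding ae_eq_def component_add
proof (intro allI)
  fix n k
  assume "\<forall>n k. AE z in particle_measure n k. component n k \<psi> z = component n k \<psi>' z"
    "\<forall>n k. AE z in particle_measure n k. component n k \<phi> z = component n k \<phi>' z"
  then have "AE z in particle_measure n k. component n k \<psi> z = component n k \<psi>' z"
    "AE z in particle_measure n k. component n k \<phi> z = component n k \<phi>' z" by blast+
  then show "AE z in particle_measure n k. component n k \<psi> z + component n k \<phi> z = component n k \<psi>' z + component n k \<phi>' z"
    by eventually_elim simp
qed

lemma regular_add: "regular_op X \<Longrightarrow> regular_op Y \<Longrightarrow> regular_op (\<lambda>\<psi> M N. X \<psi> M N + Y \<psi> M N)"
  unfolding regular_op_def using meas_add ae_eq_add_vec by simp
lemma regular_cmul: "regular_op X \<Longrightarrow> regular_op (\<lambda>\<psi> M N. c * X \<psi> M N)"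
  using regular_scale[of X "\<lambda>_ _. c"] .
lemma regular_diff: "regular_op X \<Longrightarrow> regular_op Y \<Longrightarrow> regular_op (\<lambda>\<psi> M N. X \<psi> M N - Y \<psi> M N)"
  using regular_add[OF _ regular_cmul[of Y "-1"], of X] by simp
lemma regular_sum: "finite J \<Longrightarrow> (\<And>j. j \<in> J \<Longrightarrow> regular_op (X j)) \<Longrightarrow> regular_op (\<lambda>\<psi> M N. \<Sum>j\<in>J. X j \<psi> M N)"
proof (induction J rule: finite_induct)
  case empty
  have "meas (\<lambda>M N. 0)" unfolding meas_def component_def by simp
  then show ?case by (simp add: regular_op_def ae_eq_def)
next
  case (insert j J)
  then show ?case using regular_add[of "X j" "\<lambda>\<psi> M N. \<Sum>j\<in>J. X j \<psi> M N"] by simp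
qed

abbreviation ind :: "real \<Rightarrow> real \<Rightarrow> real \<Rightarrow> complex" where "ind s t \<equiv> indicator {s..<t}"

lemma tensor_simps:
  "tensor_left (ann_proc t) \<psi> M N = of_real (sqrt (real (size M + 1))) * ann_left (ind 0 t) \<psi> M N"
  "tensor_right (ann_proc t) \<psi> M N = of_real (sqrt (real (size N + 1))) * ann_right (ind 0 t) \<psi> M N"
  "tensor_left (cre_proc t) \<psi> M N = inverse (of_real (sqrt (real (size M)))) * cre_left (ind 0 t) \<psi> M N"
  "tensor_right (cre_proc t) \<psi> M N = inverse (of_real (sqrt (real (size N)))) * cre_right (ind 0 t) \<psi> M N"
proof -
  have c: "cnj (ind 0 t x) = ind 0 t x" for x by (simp add: indicator_def)
  show "tensor_left (ann_proc t) \<psi> M N = of_real (sqrt (real (size M + 1))) * ann_left (ind 0 t) \<psi> M N"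
    "tensor_right (ann_proc t) \<psi> M N = of_real (sqrt (real (size N + 1))) * ann_right (ind 0 t) \<psi> M N"
    "tensor_left (cre_proc t) \<psi> M N = inverse (of_real (sqrt (real (size M)))) * cre_left (ind 0 t) \<psi> M N"
    "tensor_right (cre_proc t) \<psi> M N = inverse (of_real (sqrt (real (size N)))) * cre_right (ind 0 t) \<psi> M N"
    unfolding tensor_left_def tensor_right_def ann_proc_def cre_proc_def annihilation_def creation_def
      ann_left_def ann_right_def cre_left_def cre_right_def c by (simp_all add: divide_inverse mult.commute)
qed

definition left_mode :: "complex \<Rightarrow> complex \<Rightarrow> real \<Rightarrow> fock2 \<Rightarrow> fock2" where
  "left_mode p q t \<psi> = (\<lambda>M N. p * tensor_left (ann_proc t) \<psi> M N + q * tensor_left (cre_proc t) \<psi> M N)"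
definition right_mode :: "complex \<Rightarrow> complex \<Rightarrow> real \<Rightarrow> fock2 \<Rightarrow> fock2" where
  "right_mode p q t \<psi> = (\<lambda>M N. p * tensor_right (ann_proc t) \<psi> M N + q * tensor_right (cre_proc t) \<psi> M N)"

lemma Q_proc_eq: "Q_proc \<sigma> t = (\<lambda>\<psi> M N. left_mode (c_plus \<sigma>) (c_plus \<sigma>) t \<psi> M N + right_mode (c_minus \<sigma>) (c_minus \<sigma>) t \<psi> M N)"
  by (simp add: fun_eq_iff Q_proc_def left_mode_def right_mode_def tensor_left_def tensor_right_def algebra_simps)
lemma P_proc_eq: "P_proc \<sigma> t = (\<lambda>\<psi> M N. left_mode (- \<i> * c_plus \<sigma>) (\<i> * c_plus \<sigma>) t \<psi> M N + right_mode (\<i> * c_minus \<sigma>) (- \<i> * c_minus \<sigma>) t \<psi> M N)"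
  by (simp add: fun_eq_iff P_proc_def left_mode_def right_mode_def tensor_left_def tensor_right_def algebra_simps)

lemma ind_measurable: "ind s t \<in> borel_measurable half_line"
  by (rule half_line_borel_measurable) simp

lemma regular_mode: "regular_op (left_mode p q t)" "regular_op (right_mode p q t)"
  unfolding left_mode_def right_mode_def tensor_simps
  using regular_add[OF regular_cmul[OF regular_scale[OF regular_ann_left, OF ind_measurable]] regular_cmul[OF regular_scale[OF regular_cre_left, OF ind_measurable]],
      of p "\<lambda>m n. of_real (sqrt (real (m + 1)))" 0 t q "\<lambda>m n. inverse (of_real (sqrt (real m)))" 0 t]
    regular_add[OF regular_cmul[OF regular_scale[OF regular_ann_right, OF ind_measurable]] regular_cmul[OF regular_scale[OF regular_cre_right, OF ind_measurable]],
      of p "\<lambda>m n. of_real (sqrt (real (n + 1)))" 0 t q "\<lambda>m n. inverse (of_real (sqrt (real n)))" 0 t]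
  by blast+

lemma regular_Q: "regular_op (Q_proc \<sigma> t)" and regular_P: "regular_op (P_proc \<sigma> t)"
  unfolding Q_proc_eq P_proc_eq by (intro regular_add regular_mode)+

lemma regular_incr: "(\<And>t. regular_op (X t)) \<Longrightarrow> regular_op (incr X s t)"
  unfolding incr_def[abs_def] by (rule regular_diff)

lemma regular_levy_sum: "regular_op (levy_sum \<sigma> a n t)"
  unfolding levy_sum_def[abs_def]
  by (rule regular_cmul, rule regular_sum, simp, rule regular_diff; rule regular_comp; rule regular_incr; rule regular_P regular_Q)

section \<open>Levy sums as quadratic operators\<close>

definition to_fock :: "fock2 \<Rightarrow> fock2" where
  "to_fock \<theta> = (\<lambda>M N. inverse (of_real (sqrt (fact (size M)) * sqrt (fact (size N)))) * \<theta> M N)"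

lemma sqrt_fact_Suc: "sqrt (fact (Suc n)) = sqrt (real (Suc n)) * sqrt (fact n)"
  by (simp add: real_sqrt_mult fact_Suc del: of_nat_Suc)

lemma ann_left_to_fock: "of_real (sqrt (real (size M + 1))) * ann_left f (to_fock \<theta>) M N = to_fock (ann_left f \<theta>) M N"
proof -
  let ?c = "inverse (complex_of_real (sqrt (fact (Suc (size M))) * sqrt (fact (size N))))"
  have "ann_left f (to_fock \<theta>) M N = ?c * ann_left f \<theta> M N"
    unfolding ann_left_def to_fock_def size_add_mset mult.left_commute[of _ ?c] by simp
  moreover have "complex_of_real (sqrt (real (size M + 1))) * ?c = inverse (of_real (sqrt (fact (size M)) * sqrt (fact (size N))))"
    unfolding sqrt_fact_Suc by (simp add: field_simps del: of_nat_Suc fact_Suc)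
  ultimately show ?thesis by (simp add: to_fock_def mult.assoc[symmetric] del: of_nat_Suc fact_Suc)
qed

lemma cre_left_to_fock: "inverse (of_real (sqrt (real (size M)))) * cre_left f (to_fock \<theta>) M N = to_fock (cre_left f \<theta>) M N"
proof -
  let ?d = "inverse (complex_of_real (sqrt (fact (size M)) * sqrt (fact (size N))))"
  have e: "inverse (of_real (sqrt (real (size M)))) * (f x * to_fock \<theta> (M - {#x#}) N) = ?d * (f x * \<theta> (M - {#x#}) N)"
    if "x \<in># M" for x
  proof -
    have s: "size M = Suc (size (M - {#x#}))" using size_Suc_Diff1[OF that] by simp
    show ?thesis unfolding to_fock_def s sqrt_fact_Suc by (simp add: field_simps del: of_nat_Suc fact_Suc)
  qed
  have "inverse (of_real (sqrt (real (size M)))) * cre_left f (to_fock \<theta>) M N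
     = (\<Sum>x\<in>#M. inverse (of_real (sqrt (real (size M)))) * (f x * to_fock \<theta> (M - {#x#}) N))"
    unfolding cre_left_def by (rule sum_mset_distrib_left)
  also have "\<dots> = (\<Sum>x\<in>#M. ?d * (f x * \<theta> (M - {#x#}) N))"
    by (rule arg_cong[where f=sum_mset], rule image_mset_cong, rule e)
  also have "\<dots> = to_fock (cre_left f \<theta>) M N"
    unfolding to_fock_def cre_left_def by (rule sum_mset_distrib_left[symmetric])
  finally show ?thesis .
qed

lemma swap2_to_fock: "swap2 (to_fock \<theta>) = to_fock (swap2 \<theta>)"
  by (simp add: swap2_def to_fock_def fun_eq_iff mult.commute)

lemma to_fock_swap2: "to_fock \<phi> N M = to_fock (swap2 \<phi>) M N"
  by (simp add: swap2_def to_fock_def mult.commute)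

lemma ann_right_apply: "ann_right f \<theta> M N = ann_left f (swap2 \<theta>) N M"
  by (simp add: ann_right_def ann_left_def swap2_def)
lemma cre_right_apply: "cre_right f \<theta> M N = cre_left f (swap2 \<theta>) N M"
  by (simp add: cre_right_def cre_left_def swap2_def)

lemma ann_right_to_fock: "of_real (sqrt (real (size N + 1))) * ann_right f (to_fock \<theta>) M N = to_fock (ann_right f \<theta>) M N"
proof -
  have "of_real (sqrt (real (size N + 1))) * ann_right f (to_fock \<theta>) M N = of_real (sqrt (real (size N + 1))) * ann_left f (to_fock (swap2 \<theta>)) N M"
    by (simp only: ann_right_apply swap2_to_fock)
  also have "\<dots> = to_fock (ann_left f (swap2 \<theta>)) N M" by (rule ann_left_to_fock)
  also have "\<dots> = to_fock (ann_right f \<theta>) M N" unfolding ann_right_swap by (rule to_fock_swap2)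
  finally show ?thesis .
qed
lemma cre_right_to_fock: "inverse (of_real (sqrt (real (size N)))) * cre_right f (to_fock \<theta>) M N = to_fock (cre_right f \<theta>) M N"
proof -
  have "inverse (of_real (sqrt (real (size N)))) * cre_right f (to_fock \<theta>) M N = inverse (of_real (sqrt (real (size N)))) * cre_left f (to_fock (swap2 \<theta>)) N M"
    by (simp only: cre_right_apply swap2_to_fock)
  also have "\<dots> = to_fock (cre_left f (swap2 \<theta>)) N M" by (rule cre_left_to_fock)
  also have "\<dots> = to_fock (cre_right f \<theta>) M N" unfolding cre_right_swap by (rule to_fock_swap2)
  finally show ?thesis .
qed

lemma to_fock_nice_linear: "to_fock (\<lambda>M N. c * \<theta> M N + d * \<phi> M N) M N = c * to_fock \<theta> M N + d * to_fock \<phi> M N"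
  by (simp add: to_fock_def algebra_simps)

text \<open>The modes in which \<open>Q = lower + raise\<close> and \<open>P = -i (lower - raise)\<close>.\<close>

definition lower :: "real \<Rightarrow> (real \<Rightarrow> complex) \<Rightarrow> fock2 \<Rightarrow> fock2" where
  "lower \<sigma> f \<theta> = (\<lambda>M N. of_real (c_plus \<sigma>) * ann_left f \<theta> M N + of_real (c_minus \<sigma>) * cre_right f \<theta> M N)"
definition raise :: "real \<Rightarrow> (real \<Rightarrow> complex) \<Rightarrow> fock2 \<Rightarrow> fock2" where
  "raise \<sigma> f \<theta> = (\<lambda>M N. of_real (c_plus \<sigma>) * cre_left f \<theta> M N + of_real (c_minus \<sigma>) * ann_right f \<theta> M N)"

lemma Q_to_fock: "Q_proc \<sigma> t (to_fock \<theta>) M N = to_fock (lower \<sigma> (ind 0 t) \<theta>) M N + to_fock (raise \<sigma> (ind 0 t) \<theta>) M N"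
  unfolding Q_proc_eq left_mode_def right_mode_def tensor_simps ann_left_to_fock cre_left_to_fock ann_right_to_fock cre_right_to_fock lower_def raise_def to_fock_nice_linear
  by (simp add: algebra_simps)
lemma P_to_fock: "P_proc \<sigma> t (to_fock \<theta>) M N = - \<i> * to_fock (lower \<sigma> (ind 0 t) \<theta>) M N + \<i> * to_fock (raise \<sigma> (ind 0 t) \<theta>) M N"
  unfolding P_proc_eq left_mode_def right_mode_def tensor_simps ann_left_to_fock cre_left_to_fock ann_right_to_fock cre_right_to_fock lower_def raise_def to_fock_nice_linear
  by (simp add: algebra_simps)

context levy_interval begin

lemma box_fun_ind: assumes "a \<le> s" "t \<le> b" shows "box_fun (ind s t)"
  unfolding box_fun_def box_fun_le_def using assms ind_measurable by (intro exI[of _ 1]) (auto simp: indicator_def)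

lemma ann_left_ind_diff:
  assumes t: "nice \<theta>" and st: "0 \<le> s" "s \<le> t"
  shows "ann_left (ind 0 t) \<theta> M N - ann_left (ind 0 s) \<theta> M N = ann_left (ind s t) \<theta> M N"
proof -
  have i: "integrable half_line (\<lambda>x. ind u v x * \<theta> (add_mset x M) N)" for u v
  proof -
    have "integrable half_line (\<lambda>x. ind (max u a) (min v b) x * \<theta> (add_mset x M) N)"
      by (rule integrable_left[OF box_fun_ind t]) auto
    moreover have "ind (max u a) (min v b) x * \<theta> (add_mset x M) N = ind u v x * \<theta> (add_mset x M) N" for x
    proof (cases "x \<in> {a..<b}")
      case False
      obtain C K where "nice_le C K \<theta>" using t by (auto simp: nice_def)
      then have "\<theta> (add_mset x M) N = 0" using nice_le_support(1)[of C K \<theta> "add_mset x M" N] False by auto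
      then show ?thesis by simp
    qed (auto simp: indicator_def)
    ultimately show ?thesis by simp
  qed
  have "ind 0 t x * c - ind 0 s x * c = ind s t x * c" for x c using st by (auto simp: indicator_def)
  then show ?thesis unfolding ann_left_def Bochner_Integration.integral_diff[OF i i, symmetric] by simp
qed

lemma cre_left_ind_diff:
  assumes "0 \<le> s" "s \<le> t"
  shows "cre_left (ind 0 t) \<theta> M N - cre_left (ind 0 s) \<theta> M N = cre_left (ind s t) \<theta> M N"
proof -
  have e: "ind 0 t x * c = ind 0 s x * c + ind s t x * c" for x c using assms by (auto simp: indicator_def)
  show ?thesis unfolding cre_left_def e sum_mset.distrib by simp
qed

lemma ann_right_ind_diff:
  "nice \<theta> \<Longrightarrow> 0 \<le> s \<Longrightarrow> s \<le> t \<Longrightarrow> ann_right (ind 0 t) \<theta> M N - ann_right (ind 0 s) \<theta> M N = ann_right (ind s t) \<theta> M N"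
  unfolding ann_right_apply by (rule ann_left_ind_diff[OF nice_swap2])
lemma cre_right_ind_diff:
  "0 \<le> s \<Longrightarrow> s \<le> t \<Longrightarrow> cre_right (ind 0 t) \<theta> M N - cre_right (ind 0 s) \<theta> M N = cre_right (ind s t) \<theta> M N"
  unfolding cre_right_apply by (rule cre_left_ind_diff)

lemma lower_ind_diff:
  assumes "nice \<theta>" "0 \<le> s" "s \<le> t"
  shows "to_fock (lower \<sigma> (ind 0 t) \<theta>) M N - to_fock (lower \<sigma> (ind 0 s) \<theta>) M N = to_fock (lower \<sigma> (ind s t) \<theta>) M N"
  unfolding to_fock_def lower_def ann_left_ind_diff[OF assms, symmetric] cre_right_ind_diff[OF assms(2,3), symmetric]
  by (simp add: algebra_simps)
lemma raise_ind_diff: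
  assumes "nice \<theta>" "0 \<le> s" "s \<le> t"
  shows "to_fock (raise \<sigma> (ind 0 t) \<theta>) M N - to_fock (raise \<sigma> (ind 0 s) \<theta>) M N = to_fock (raise \<sigma> (ind s t) \<theta>) M N"
  unfolding to_fock_def raise_def cre_left_ind_diff[OF assms(2,3), symmetric] ann_right_ind_diff[OF assms, symmetric]
  by (simp add: algebra_simps)

definition Q_op :: "real \<Rightarrow> (real \<Rightarrow> complex) \<Rightarrow> fock2 \<Rightarrow> fock2" where
  "Q_op \<sigma> f \<theta> = (\<lambda>M N. 1 * lower \<sigma> f \<theta> M N + 1 * raise \<sigma> f \<theta> M N)"
definition P_op :: "real \<Rightarrow> (real \<Rightarrow> complex) \<Rightarrow> fock2 \<Rightarrow> fock2" where
  "P_op \<sigma> f \<theta> = (\<lambda>M N. - \<i> * lower \<sigma> f \<theta> M N + \<i> * raise \<sigma> f \<theta> M N)"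

lemma incr_Q: assumes "nice \<theta>" "0 \<le> s" "s \<le> t" shows "incr (Q_proc \<sigma>) s t (to_fock \<theta>) = to_fock (Q_op \<sigma> (ind s t) \<theta>)"
proof (intro ext)
  fix M N
  show "incr (Q_proc \<sigma>) s t (to_fock \<theta>) M N = to_fock (Q_op \<sigma> (ind s t) \<theta>) M N"
    unfolding incr_def Q_to_fock Q_op_def to_fock_nice_linear lower_ind_diff[OF assms, symmetric] raise_ind_diff[OF assms, symmetric]
    by (simp add: algebra_simps)
qed
lemma incr_P: assumes "nice \<theta>" "0 \<le> s" "s \<le> t" shows "incr (P_proc \<sigma>) s t (to_fock \<theta>) = to_fock (P_op \<sigma> (ind s t) \<theta>)"
proof (intro ext)
  fix M N
  show "incr (P_proc \<sigma>) s t (to_fock \<theta>) M N = to_fock (P_op \<sigma> (ind s t) \<theta>) M N"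
    unfolding incr_def P_to_fock P_op_def to_fock_nice_linear lower_ind_diff[OF assms, symmetric] raise_ind_diff[OF assms, symmetric]
    by (simp add: algebra_simps)
qed

lemma nice_linear_lower: "box_fun f \<Longrightarrow> nice_linear (lower \<sigma> f)" unfolding lower_def[abs_def] by (intro nice_linear_combine nice_linear_ann_left nice_linear_cre_right)
lemma nice_linear_raise: "box_fun f \<Longrightarrow> nice_linear (raise \<sigma> f)" unfolding raise_def[abs_def] by (intro nice_linear_combine nice_linear_cre_left nice_linear_ann_right)
lemma nice_linear_Q_op: "box_fun f \<Longrightarrow> nice_linear (Q_op \<sigma> f)" unfolding Q_op_def[abs_def] by (intro nice_linear_combine nice_linear_lower nice_linear_raise)
lemma nice_linear_P_op: "box_fun f \<Longrightarrow> nice_linear (P_op \<sigma> f)" unfolding P_op_def[abs_def] by (intro nice_linear_combine nice_linear_lower nice_linear_raise)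


lemma cre_ann_left: "cre_left s (ann_left d \<theta>) = hop_left (\<lambda>x y. s x * d y) \<theta>"
  by (simp add: cre_left_def ann_left_def hop_left_def fun_eq_iff mult.assoc)
lemma ann_cre_left:
  assumes s: "box_fun s" and t: "nice \<theta>" and sd: "\<And>x. s x * d x = 0"
  shows "ann_left s (cre_left d \<theta>) = hop_left (\<lambda>x y. d x * s y) \<theta>"
proof (intro ext)
  fix M N
  have e: "s x * cre_left d \<theta> (add_mset x M) N = (\<Sum>y\<in>#M. d y * (s x * \<theta> (add_mset x (M - {#y#})) N))" for x
  proof -
    have "cre_left d \<theta> (add_mset x M) N = d x * \<theta> M N + (\<Sum>y\<in>#M. d y * \<theta> (add_mset x (M - {#y#})) N)"
      unfolding cre_left_def by (rule sum_mset_remove_add[of "\<lambda>x' M'. d x' * \<theta> M' N"])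
    then have "s x * cre_left d \<theta> (add_mset x M) N = (s x * d x) * \<theta> M N + s x * (\<Sum>y\<in>#M. d y * \<theta> (add_mset x (M - {#y#})) N)"
      by (simp only: distrib_left mult.assoc)
    then show ?thesis unfolding sd sum_mset_distrib_left by (simp only: mult.left_commute mult_zero_left add_0)
  qed
  show "ann_left s (cre_left d \<theta>) M N = hop_left (\<lambda>x y. d x * s y) \<theta> M N"
    unfolding ann_left_def[of s "cre_left d \<theta>"] e hop_left_def
    by (subst integral_sum_mset(2)) (simp_all add: integrable_left s t mult.assoc)
qed
lemma ann_cre_right:
  assumes s: "box_fun s" and t: "nice \<theta>" and sd: "\<And>x. s x * d x = 0"
  shows "ann_right s (cre_right d \<theta>) = hop_right (\<lambda>x y. s x * d y) \<theta>"
proof -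
  have ss: "swap2 (swap2 \<phi>) = \<phi>" for \<phi> by (simp add: swap2_def)
  show ?thesis unfolding ann_right_swap cre_right_swap hop_right_swap ss ann_cre_left[OF s nice_swap2[OF t] sd] by (simp add: mult.commute)
qed
lemma cre_ann_right: "cre_right s (ann_right d \<theta>) = hop_right (\<lambda>x y. d x * s y) \<theta>"
  by (intro ext) (simp only: cre_right_def ann_right_def hop_right_def mult.assoc integral_scale)
lemma cre_left_right: "cre_left s (cre_right d \<theta>) = pair_cre (\<lambda>x y. s x * d y) \<theta>"
  by (simp add: cre_left_def cre_right_def pair_cre_def fun_eq_iff sum_mset_distrib_left mult.assoc)
lemma cre_right_left: "cre_right s (cre_left d \<theta>) = pair_cre (\<lambda>x y. d x * s y) \<theta>"
  unfolding cre_left_def cre_right_def pair_cre_def fun_eq_iff sum_mset_distrib_left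
  by (subst sum_mset.swap) (simp add: mult_ac)
lemma ann_left_right: "ann_left s (ann_right d \<theta>) = pair_ann (\<lambda>x y. s x * d y) \<theta>"
  by (simp add: ann_left_def ann_right_def pair_ann_def fun_eq_iff mult.assoc)
lemma ann_right_left:
  assumes "box_fun s" "box_fun d" "nice \<theta>"
  shows "ann_right s (ann_left d \<theta>) = pair_ann (\<lambda>x y. d x * s y) \<theta>"
proof (intro ext)
  fix M N
  have k: "box_kernel (\<lambda>x y. d x * s y * \<theta> (add_mset x M) (add_mset y N))" by (intro box_kernel_nice box_kernel_tensor assms)
  show "ann_right s (ann_left d \<theta>) M N = pair_ann (\<lambda>x y. d x * s y) \<theta> M N"
    unfolding pair_ann_def box_kernel_Fubini[OF k] by (simp only: ann_right_def ann_left_def mult.assoc integral_scale)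
qed


lemma hop_left_kadd: "box_kernel k \<Longrightarrow> box_kernel l \<Longrightarrow> nice \<theta> \<Longrightarrow> hop_left (\<lambda>x y. k x y + l x y) \<theta> M N = hop_left k \<theta> M N + hop_left l \<theta> M N"
  by (simp add: hop_left_def distrib_right integrable_left box_kernel_section sum_mset.distrib)
lemma hop_right_kadd: "box_kernel k \<Longrightarrow> box_kernel l \<Longrightarrow> nice \<theta> \<Longrightarrow> hop_right (\<lambda>x y. k x y + l x y) \<theta> M N = hop_right k \<theta> M N + hop_right l \<theta> M N"
  unfolding hop_right_swap swap2_def by (rule hop_left_kadd[OF box_kernel_transpose box_kernel_transpose nice_swap2[unfolded swap2_def]])
lemma pair_cre_kadd: "pair_cre (\<lambda>x y. k x y + l x y) \<theta> M N = pair_cre k \<theta> M N + pair_cre l \<theta> M N"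
  by (simp add: pair_cre_def distrib_right sum_mset.distrib)
lemma pair_ann_kadd: "box_kernel k \<Longrightarrow> box_kernel l \<Longrightarrow> nice \<theta> \<Longrightarrow> pair_ann (\<lambda>x y. k x y + l x y) \<theta> M N = pair_ann k \<theta> M N + pair_ann l \<theta> M N"
  by (simp add: pair_ann_int2 distrib_right int2_add box_kernel_nice)

lemma levy_op_kadd:
  "box_kernel k \<Longrightarrow> box_kernel l \<Longrightarrow> nice \<theta> \<Longrightarrow> levy_op \<alpha> \<beta> \<gamma> (\<lambda>x y. k x y + l x y) \<theta> M N = levy_op \<alpha> \<beta> \<gamma> k \<theta> M N + levy_op \<alpha> \<beta> \<gamma> l \<theta> M N"
  unfolding levy_op_def by (simp add: hop_left_kadd hop_right_kadd pair_cre_kadd pair_ann_kadd algebra_simps)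

lemma levy_op_kuminus: "levy_op \<alpha> \<beta> \<gamma> (\<lambda>x y. - k x y) \<theta> M N = - levy_op \<alpha> \<beta> \<gamma> k \<theta> M N"
  unfolding levy_op_def hop_uminus by (simp add: pair_cre_def pair_ann_def sum_mset_uminus algebra_simps)

lemma levy_op_kdiff:
  "box_kernel k \<Longrightarrow> box_kernel l \<Longrightarrow> nice \<theta> \<Longrightarrow> levy_op \<alpha> \<beta> \<gamma> (\<lambda>x y. k x y - l x y) \<theta> M N = levy_op \<alpha> \<beta> \<gamma> k \<theta> M N - levy_op \<alpha> \<beta> \<gamma> l \<theta> M N"
  using levy_op_kadd[of k "\<lambda>x y. - l x y" \<theta> \<alpha> \<beta> \<gamma> M N] box_kernel_cmul[of l "-1"] by (simp add: levy_op_kuminus)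

lemma levy_op_kzero: "levy_op \<alpha> \<beta> \<gamma> (\<lambda>x y. 0) \<theta> M N = 0"
  by (simp add: levy_op_def hop_left_def hop_right_def pair_cre_def pair_ann_def)

lemma levy_op_ksum:
  assumes t: "nice \<theta>" and J: "finite J" and k: "\<And>j. j \<in> J \<Longrightarrow> box_kernel (k j)"
  shows "levy_op \<alpha> \<beta> \<gamma> (\<lambda>x y. \<Sum>j\<in>J. k j x y) \<theta> M N = (\<Sum>j\<in>J. levy_op \<alpha> \<beta> \<gamma> (k j) \<theta> M N)"
  using J k
proof (induction J rule: finite_induct)
  case (insert j J)
  have "levy_op \<alpha> \<beta> \<gamma> (\<lambda>x y. k j x y + (\<Sum>j\<in>J. k j x y)) \<theta> M N = levy_op \<alpha> \<beta> \<gamma> (k j) \<theta> M N + levy_op \<alpha> \<beta> \<gamma> (\<lambda>x y. \<Sum>j\<in>J. k j x y) \<theta> M N"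
    by (rule levy_op_kadd[OF _ _ t]) (use insert in \<open>auto intro: box_kernel_sum\<close>)
  then show ?case using insert by simp
qed (simp add: levy_op_kzero)

text \<open>One finds \<open>P s Q d - Q s P d = 2 i (raise s lower d - lower s raise d)\<close>. Only the second product has
to be reordered, and its contraction is the integral of \<open>s d\<close>, which vanishes.\<close>

lemma levy_step:
  assumes s: "box_fun s" and d: "box_fun d" and t: "nice \<theta>" and sd: "\<And>x. s x * d x = 0"
  shows "(1/2) * (P_op \<sigma> s (Q_op \<sigma> d \<theta>) M N - Q_op \<sigma> s (P_op \<sigma> d \<theta>) M N)
     = \<i> * levy_op (of_real (c_plus \<sigma> ^ 2)) (of_real (c_minus \<sigma> ^ 2)) (of_real (c_plus \<sigma> * c_minus \<sigma>)) (\<lambda>x y. s x * d y - d x * s y) \<theta> M N"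
proof -
  have ds: "d x * s x = 0" for x using sd[of x] by (simp add: mult.commute)
  note n = nice_linear_nice[OF nice_linear_lower[OF d] t] nice_linear_nice[OF nice_linear_raise[OF d] t]
  have QP: "X (Q_op \<sigma> d \<theta>) = (\<lambda>M N. 1 * X (lower \<sigma> d \<theta>) M N + 1 * X (raise \<sigma> d \<theta>) M N)"
    "X (P_op \<sigma> d \<theta>) = (\<lambda>M N. - \<i> * X (lower \<sigma> d \<theta>) M N + \<i> * X (raise \<sigma> d \<theta>) M N)" if "nice_linear X" for X
    unfolding Q_op_def P_op_def by (simp_all only: nice_linear_add[OF that] nice_linear_cmul[OF that] nice_cmul n)
  have A: "(1/2) * (P_op \<sigma> s (Q_op \<sigma> d \<theta>) M N - Q_op \<sigma> s (P_op \<sigma> d \<theta>) M N)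
     = \<i> * (raise \<sigma> s (lower \<sigma> d \<theta>) M N - lower \<sigma> s (raise \<sigma> d \<theta>) M N)"
    unfolding P_op_def[of \<sigma> s] Q_op_def[of \<sigma> s] QP[OF nice_linear_lower[OF s]] QP[OF nice_linear_raise[OF s]]
    by (simp add: algebra_simps)
  let ?p = "complex_of_real (c_plus \<sigma>)" and ?q = "complex_of_real (c_minus \<sigma>)"
  note m = nice_ann_left[OF d t] nice_ann_right[OF d t] nice_cre_left[OF d t] nice_cre_right[OF d t]
  have X: "X (lower \<sigma> d \<theta>) = (\<lambda>M N. ?p * X (ann_left d \<theta>) M N + ?q * X (cre_right d \<theta>) M N)"
    "X (raise \<sigma> d \<theta>) = (\<lambda>M N. ?p * X (cre_left d \<theta>) M N + ?q * X (ann_right d \<theta>) M N)" if "nice_linear X" for X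
    unfolding lower_def raise_def by (simp_all only: nice_linear_add[OF that] nice_linear_cmul[OF that] nice_cmul m)
  have ks: "box_kernel (\<lambda>x y. s x * d y)" "box_kernel (\<lambda>x y. d x * s y)" by (intro box_kernel_tensor s d)+
  have R: "raise \<sigma> s (lower \<sigma> d \<theta>) M N = ?p^2 * hop_left (\<lambda>x y. s x * d y) \<theta> M N + ?p * ?q * pair_cre (\<lambda>x y. s x * d y) \<theta> M N
     + ?p * ?q * pair_ann (\<lambda>x y. d x * s y) \<theta> M N + ?q^2 * hop_right (\<lambda>x y. s x * d y) \<theta> M N"
    unfolding raise_def[of \<sigma> s] X[OF nice_linear_cre_left[OF s]] X[OF nice_linear_ann_right[OF s]] cre_ann_left cre_left_right
      ann_right_left[OF s d t] ann_cre_right[OF s t sd] by (simp add: algebra_simps power2_eq_square)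
  have L: "lower \<sigma> s (raise \<sigma> d \<theta>) M N = ?p^2 * hop_left (\<lambda>x y. d x * s y) \<theta> M N + ?p * ?q * pair_cre (\<lambda>x y. d x * s y) \<theta> M N
     + ?p * ?q * pair_ann (\<lambda>x y. s x * d y) \<theta> M N + ?q^2 * hop_right (\<lambda>x y. d x * s y) \<theta> M N"
    unfolding lower_def[of \<sigma> s] X[OF nice_linear_ann_left[OF s]] X[OF nice_linear_cre_right[OF s]] ann_cre_left[OF s t sd] cre_right_left
      ann_left_right cre_ann_right by (simp add: algebra_simps power2_eq_square)
  show ?thesis unfolding A R L levy_op_kdiff[OF ks t] unfolding levy_op_def by (simp add: algebra_simps)
qed

definition step_kernel :: "nat \<Rightarrow> (nat \<Rightarrow> real) \<Rightarrow> real \<Rightarrow> real \<Rightarrow> complex" where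
  "step_kernel n t x y = (\<Sum>j<n. ind a (t j) x * ind (t j) (t (Suc j)) y - ind (t j) (t (Suc j)) x * ind a (t j) y)"

lemma partition_mono:
  assumes "is_partition a b n t" "i \<le> j" "j \<le> n" shows "t i \<le> t j"
  using assms(2,3)
proof (induction j rule: dec_induct)
  case (step j)
  then have "t j < t (Suc j)" using assms(1) by (simp add: is_partition_def)
  then show ?case using step by simp
qed simp

lemma partition_bounds:
  assumes "is_partition a b n t" "j \<le> n" shows "a \<le> t j" "t j \<le> b"
  using partition_mono[OF assms(1), of 0 j] partition_mono[OF assms(1), of j n] assms by (auto simp: is_partition_def)

lemma levy_sum_to_fock:
  assumes p: "is_partition a b n t" and th: "nice \<theta>"
  shows "levy_sum \<sigma> a n t (to_fock \<theta>) = to_fock (\<lambda>M N. \<i> * levy_op (of_real (c_plus \<sigma> ^ 2)) (of_real (c_minus \<sigma> ^ 2)) (of_real (c_plus \<sigma> * c_minus \<sigma>)) (step_kernel n t) \<theta> M N)"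
proof (intro ext)
  fix M N :: "real multiset"
  let ?op = "levy_op (of_real (c_plus \<sigma> ^ 2)) (of_real (c_minus \<sigma> ^ 2)) (of_real (c_plus \<sigma> * c_minus \<sigma>))"
  let ?s = "\<lambda>j. ind a (t j)" and ?d = "\<lambda>j. ind (t j) (t (Suc j))"
  let ?c = "inverse (complex_of_real (sqrt (fact (size M)) * sqrt (fact (size N))))"
  have tm: "(1/2) * (incr (P_proc \<sigma>) a (t j) (incr (Q_proc \<sigma>) (t j) (t (Suc j)) (to_fock \<theta>)) M N
     - incr (Q_proc \<sigma>) a (t j) (incr (P_proc \<sigma>) (t j) (t (Suc j)) (to_fock \<theta>)) M N)
     = ?c * (\<i> * ?op (\<lambda>x y. ?s j x * ?d j y - ?d j x * ?s j y) \<theta> M N)" if j: "j < n" for j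
  proof -
    have b: "a \<le> t j" "t j \<le> t (Suc j)" "t (Suc j) \<le> b"
      using partition_bounds[OF p, of j] partition_bounds[OF p, of "Suc j"] partition_mono[OF p, of j "Suc j"] j by auto
    have 0: "0 \<le> t j" using b a_nonneg by simp
    have s: "box_fun (?s j)" and d: "box_fun (?d j)" using b by (auto intro!: box_fun_ind)
    have sd: "?s j x * ?d j x = 0" for x by (auto simp: indicator_def)
    show ?thesis
      unfolding incr_Q[OF th 0 b(2)] incr_P[OF th 0 b(2)] incr_P[OF nice_linear_nice[OF nice_linear_Q_op[OF d] th] a_nonneg b(1)]
        incr_Q[OF nice_linear_nice[OF nice_linear_P_op[OF d] th] a_nonneg b(1)]
      unfolding levy_step[OF s d th sd, symmetric] to_fock_def by (simp add: algebra_simps)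
  qed
  have k: "box_kernel (\<lambda>x y. ?s j x * ?d j y - ?d j x * ?s j y)" if "j \<in> {..<n}" for j
    using partition_bounds[OF p, of j] partition_bounds[OF p, of "Suc j"] that by (intro box_kernel_diff box_kernel_tensor box_fun_ind) auto
  have "levy_sum \<sigma> a n t (to_fock \<theta>) M N = (\<Sum>j<n. ?c * (\<i> * ?op (\<lambda>x y. ?s j x * ?d j y - ?d j x * ?s j y) \<theta> M N))"
    unfolding levy_sum_def sum_distrib_left by (rule sum.cong[OF refl]) (use tm in simp)
  also have "\<dots> = ?c * (\<i> * (\<Sum>j<n. ?op (\<lambda>x y. ?s j x * ?d j y - ?d j x * ?s j y) \<theta> M N))"
    by (simp only: sum_distrib_left)
  also have "(\<Sum>j<n. ?op (\<lambda>x y. ?s j x * ?d j y - ?d j x * ?s j y) \<theta> M N) = ?op (step_kernel n t) \<theta> M N"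
    unfolding step_kernel_def[abs_def] by (rule levy_op_ksum[OF th _ k, symmetric]) auto
  finally show "levy_sum \<sigma> a n t (to_fock \<theta>) M N = to_fock (\<lambda>M N. \<i> * ?op (step_kernel n t) \<theta> M N) M N"
    unfolding to_fock_def .
qed

lemma box_kernel_step_kernel: assumes p: "is_partition a b n t" shows "box_kernel (step_kernel n t)"
proof -
  have "box_kernel (\<lambda>x y. ind a (t j) x * ind (t j) (t (Suc j)) y - ind (t j) (t (Suc j)) x * ind a (t j) y)" if "j \<in> {..<n}" for j
    using partition_bounds[OF p, of j] partition_bounds[OF p, of "Suc j"] that by (intro box_kernel_diff box_kernel_tensor box_fun_ind) auto
  then show ?thesis unfolding step_kernel_def[abs_def] by (rule box_kernel_sum)
qed

lemma partition_cell:
  assumes p: "is_partition a b n t" and y: "y \<in> {a..<b}"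
  obtains i where "i < n" "t i \<le> y" "y < t (Suc i)"
proof -
  have t0: "t 0 = a" "t n = b" using p by (auto simp: is_partition_def)
  define i where "i = (LEAST i. y < t (Suc i))"
  have ex: "\<exists>i. y < t (Suc i)"
  proof (cases n)
    case 0 then show ?thesis using t0 y by simp
  next
    case (Suc m) then show ?thesis using t0 y by (intro exI[of _ m]) simp
  qed
  have 1: "y < t (Suc i)" unfolding i_def using ex by (rule LeastI_ex)
  have 2: "t i \<le> y"
  proof (cases i)
    case 0 then show ?thesis using t0 y by simp
  next
    case (Suc l)
    then have "\<not> y < t (Suc l)" using not_less_Least[of l "\<lambda>i. y < t (Suc i)"] by (simp add: i_def)
    then show ?thesis using Suc by simp
  qed
  have "i < n"
  proof (rule ccontr)
    assume "\<not> i < n"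
    then have "n \<le> i" by simp
    moreover have "n \<noteq> 0" using t0 y by (cases n) auto
    then obtain m where m: "n = Suc m" by (cases n) auto
    have "i \<le> m" unfolding i_def by (rule Least_le) (use m t0 y in simp)
    ultimately show False using m by simp
  qed
  with 1 2 show ?thesis using that by blast
qed

lemma step_sum_cell:
  assumes p: "is_partition a b n t" and i: "i < n" "t i \<le> y" "y < t (Suc i)"
  shows "(\<Sum>j<n. ind a (t j) x * ind (t j) (t (Suc j)) y) = ind a (t i) x"
proof -
  have "ind (t j) (t (Suc j)) y = (if j = i then 1 else 0)" if "j < n" for j
  proof -
    consider "j = i" | "j < i" | "i < j" by linarith
    then show ?thesis
    proof cases
      case 2 then show ?thesis using partition_mono[OF p, of "Suc j" i] i by (auto simp: indicator_def)
    next
      case 3 then show ?thesis using partition_mono[OF p, of "Suc i" j] i that by (auto simp: indicator_def)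
    qed (use i in auto)
  qed
  then have "(\<Sum>j<n. ind a (t j) x * ind (t j) (t (Suc j)) y) = (\<Sum>j<n. if j = i then ind a (t i) x else 0)"
    by (intro sum.cong) auto
  then show ?thesis using i by simp
qed

lemma step_kernel_split: "step_kernel n t x y = (\<Sum>j<n. ind a (t j) x * ind (t j) (t (Suc j)) y) - (\<Sum>j<n. ind a (t j) y * ind (t j) (t (Suc j)) x)"
  unfolding step_kernel_def sum_subtractf by (simp add: mult.commute)

text \<open>The step kernel compares the cells of \<open>x\<close> and \<open>y\<close> instead of the points themselves; the two
comparisons differ only inside a common cell.\<close>

lemma step_kernel_near:
  assumes p: "is_partition a b n t" and mesh: "\<forall>j<n. t (Suc j) - t j < \<delta>"
  shows "box_kernel_le 2 (\<lambda>x y. step_kernel n t x y - sgn_kernel x y)"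
    and "\<delta> \<le> \<bar>x - y\<bar> \<Longrightarrow> step_kernel n t x y - sgn_kernel x y = 0"
proof -
  let ?u = "\<lambda>x y. \<Sum>j<n. ind a (t j) x * ind (t j) (t (Suc j)) y"
  obtain B where B: "box_kernel_le B (step_kernel n t)" using box_kernel_step_kernel[OF p] by (auto simp: box_kernel_def)
  have out: "step_kernel n t x y = 0" if "\<not> (x \<in> {a..<b} \<and> y \<in> {a..<b})" for x y
    using B that unfolding box_kernel_le_def by blast
  have u: "?u x y = 0 \<or> (?u x y = 1 \<and> x < y)" if yb: "y \<in> {a..<b}" for x y
  proof -
    obtain i where i: "i < n" "t i \<le> y" "y < t (Suc i)" using partition_cell[OF p yb] .
    show ?thesis unfolding step_sum_cell[OF p i] using i by (auto simp: indicator_def)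
  qed
  have u1: "?u x y = 1" if yb: "y \<in> {a..<b}" and xb: "x \<in> {a..<b}" "\<delta> \<le> y - x" for x y
  proof -
    obtain i where i: "i < n" "t i \<le> y" "y < t (Suc i)" using partition_cell[OF p yb] .
    have "t (Suc i) - t i < \<delta>" using mesh i by blast
    then have "x < t i" using i xb by simp
    then show ?thesis unfolding step_sum_cell[OF p i] using xb by (simp add: indicator_def)
  qed
  have "norm (step_kernel n t x y) \<le> 1" for x y
  proof (cases "x \<in> {a..<b} \<and> y \<in> {a..<b}")
    case True
    then show ?thesis unfolding step_kernel_split using u[of y x] u[of x y] by auto
  qed (simp add: out)
  moreover have "norm (sgn_kernel x y) \<le> 1" for x y using box_kernel_le_sgn_kernel by (simp add: box_kernel_le_def)
  ultimately have n2: "norm (step_kernel n t x y - sgn_kernel x y) \<le> 2" for x y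
    by (smt (verit) norm_triangle_ineq4)
  have "box_kernel (\<lambda>x y. step_kernel n t x y - sgn_kernel x y)" by (intro box_kernel_diff box_kernel_step_kernel p box_kernel_sgn_kernel)
  then show "box_kernel_le 2 (\<lambda>x y. step_kernel n t x y - sgn_kernel x y)"
    using n2 unfolding box_kernel_def box_kernel_le_def by blast
  show "step_kernel n t x y - sgn_kernel x y = 0" if d: "\<delta> \<le> \<bar>x - y\<bar>"
  proof (cases "x \<in> {a..<b} \<and> y \<in> {a..<b}")
    case True
    have "n \<noteq> 0"
    proof
      assume "n = 0"
      then show False using p a_less_b by (simp add: is_partition_def)
    qed
    then have "0 < \<delta>" using mesh p unfolding is_partition_def by (metis diff_gt_0_iff_gt gr0I less_trans)
    then consider "\<delta> \<le> y - x" "x < y" | "\<delta> \<le> x - y" "y < x" using d by (cases "x < y") auto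
    then show ?thesis
    proof cases
      case 1
      have "?u y x = 0" using u[of x y] 1 True by auto
      then show ?thesis unfolding step_kernel_split using u1[of y x] 1 True by (simp add: sgn_kernel_def)
    next
      case 2
      have "?u x y = 0" using u[of y x] 2 True by auto
      then show ?thesis unfolding step_kernel_split using u1[of x y] 2 True by (simp add: sgn_kernel_def)
    qed
  next
    case False
    then show ?thesis using out[OF False] by (auto simp: sgn_kernel_def)
  qed
qed

end

section \<open>The Fock norm and uniqueness of the limit\<close>

lemma fock_norm_finite:
  assumes "\<And>M N. size M + size N > K \<Longrightarrow> \<psi> M N = 0"
  shows "fock_norm \<psi> = sqrt (\<Sum>(n,k)\<in>{..K}\<times>{..K}. \<integral>z. (norm (component n k \<psi> z))\<^sup>2 \<partial>particle_measure n k)"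
proof -
  let ?f = "\<lambda>(n, k). \<integral>z. cnj (component n k \<psi> z) * component n k \<psi> z \<partial>particle_measure n k"
  have e: "?f (n,k) = of_real (\<integral>z. (norm (component n k \<psi> z))\<^sup>2 \<partial>particle_measure n k)" for n k
  proof -
    have "cnj c * c = of_real ((norm c)\<^sup>2)" for c by (simp only: complex_norm_square mult.commute)
    then show ?thesis by (simp only: prod.case integral_complex_of_real)
  qed
  have z: "?f (n,k) = 0" if "(n,k) \<notin> {..K}\<times>{..K}" for n k
  proof -
    have "component n k \<psi> z = 0" for z
      unfolding component_def split_def by (rule assms) (use that in \<open>auto simp: size_config\<close>)
    then show ?thesis by simp
  qed
  have "fock_inner \<psi> \<psi> = infsum ?f ({..K}\<times>{..K})"
    unfolding fock_inner_def
  proof (rule infsum_cong_neutral)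
    show "?f x = 0" if "x \<in> UNIV - {..K}\<times>{..K}" for x using z[of "fst x" "snd x"] that by (cases x) auto
  qed auto
  also have "\<dots> = (\<Sum>p\<in>{..K}\<times>{..K}. ?f p)" by (rule infsum_finite) simp
  also have "\<dots> = of_real (\<Sum>(n,k)\<in>{..K}\<times>{..K}. \<integral>z. (norm (component n k \<psi> z))\<^sup>2 \<partial>particle_measure n k)"
    unfolding of_real_sum by (rule sum.cong[OF refl]) (use e in auto)
  finally show ?thesis unfolding fock_norm_def by simp
qed

lemma finite_particle_meas: "\<psi> \<in> finite_particle \<Longrightarrow> meas \<psi>"
  by (simp add: finite_particle_def meas_def)

lemma component_integral_le_fock_norm:
  assumes "\<psi> \<in> finite_particle"
  shows "(\<integral>z. (norm (component n k \<psi> z))\<^sup>2 \<partial>particle_measure n k) \<le> (fock_norm \<psi>)\<^sup>2"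
proof -
  obtain K where K: "\<And>M N. size M + size N > K \<Longrightarrow> \<psi> M N = 0" using assms unfolding finite_particle_def by blast
  let ?K = "K + n + k"
  have K': "\<psi> M N = 0" if "size M + size N > ?K" for M N using K[of M N] that by simp
  let ?S = "\<Sum>(n,k)\<in>{..?K}\<times>{..?K}. \<integral>z. (norm (component n k \<psi> z))\<^sup>2 \<partial>particle_measure n k"
  have nn: "0 \<le> ?S" by (rule sum_nonneg) auto
  have "fock_norm \<psi> = sqrt ?S" by (rule fock_norm_finite) (rule K')
  then have "(fock_norm \<psi>)\<^sup>2 = ?S" using nn by simp
  moreover have "(case (n,k) of (n,k) \<Rightarrow> \<integral>z. (norm (component n k \<psi> z))\<^sup>2 \<partial>particle_measure n k) \<le> ?S"
    by (rule member_le_sum) auto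
  ultimately show ?thesis by simp
qed

lemma norm_diff_sq_le: "(norm (x - y :: complex))\<^sup>2 \<le> 2 * (norm x)\<^sup>2 + 2 * (norm y)\<^sup>2"
proof -
  have "(norm (x - y))\<^sup>2 \<le> (norm x + norm y)\<^sup>2" by (intro power_mono norm_triangle_ineq4) simp
  also have "\<dots> \<le> 2 * (norm x)\<^sup>2 + 2 * (norm y)\<^sup>2"
    using sum_squares_bound[of "norm x" "norm y"] by (simp add: power2_sum)
  finally show ?thesis .
qed

lemma finite_particle_diff:
  assumes "\<psi> \<in> finite_particle" "\<phi> \<in> finite_particle"
  shows "(\<lambda>M N. \<psi> M N - \<phi> M N) \<in> finite_particle"
proof -
  obtain K L where K: "\<And>M N. size M + size N > K \<Longrightarrow> \<psi> M N = 0" and L: "\<And>M N. size M + size N > L \<Longrightarrow> \<phi> M N = 0"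
    using assms unfolding finite_particle_def by blast
  have m: "component n k (\<lambda>M N. \<psi> M N - \<phi> M N) \<in> borel_measurable (particle_measure n k)" for n k
    using meas_diff[OF finite_particle_meas finite_particle_meas, OF assms] by (simp add: meas_def)
  have "integrable (particle_measure n k) (\<lambda>z. (norm (component n k (\<lambda>M N. \<psi> M N - \<phi> M N) z))\<^sup>2)" for n k
  proof (rule Bochner_Integration.integrable_bound)
    show "integrable (particle_measure n k) (\<lambda>z. 2 * (norm (component n k \<psi> z))\<^sup>2 + 2 * (norm (component n k \<phi> z))\<^sup>2)"
      using assms unfolding finite_particle_def by auto
    show "(\<lambda>z. (norm (component n k (\<lambda>M N. \<psi> M N - \<phi> M N) z))\<^sup>2) \<in> borel_measurable (particle_measure n k)"
      using m[of n k] by simp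
    show "AE z in particle_measure n k. norm ((norm (component n k (\<lambda>M N. \<psi> M N - \<phi> M N) z))\<^sup>2)
      \<le> norm (2 * (norm (component n k \<psi> z))\<^sup>2 + 2 * (norm (component n k \<phi> z))\<^sup>2)"
      by (rule AE_I2) (use norm_diff_sq_le in \<open>simp add: component_diff\<close>)
  qed
  moreover have "\<exists>K. \<forall>M N. size M + size N > K \<longrightarrow> \<psi> M N - \<phi> M N = 0"
    using K L by (intro exI[of _ "K + L"]) auto
  ultimately show ?thesis using m unfolding finite_particle_def by blast
qed

lemma fock_norm_cong:
  assumes "meas \<psi>" "meas \<psi>'" "ae_eq \<psi> \<psi>'" shows "fock_norm \<psi> = fock_norm \<psi>'"
proof -
  have "(\<integral>z. cnj (component n k \<psi> z) * component n k \<psi> z \<partial>particle_measure n k)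
     = (\<integral>z. cnj (component n k \<psi>' z) * component n k \<psi>' z \<partial>particle_measure n k)" for n k
  proof (rule integral_cong_AE)
    have m: "component n k \<psi> \<in> borel_measurable (particle_measure n k)" "component n k \<psi>' \<in> borel_measurable (particle_measure n k)"
      using assms by (auto simp: meas_def)
    have c: "cnj \<in> borel_measurable borel" by (rule borel_measurable_continuous_onI) (intro continuous_intros)
    show "(\<lambda>z. cnj (component n k \<psi> z) * component n k \<psi> z) \<in> borel_measurable (particle_measure n k)"
      by (rule borel_measurable_times[OF measurable_compose[OF m(1) c] m(1)])
    show "(\<lambda>z. cnj (component n k \<psi>' z) * component n k \<psi>' z) \<in> borel_measurable (particle_measure n k)"
      by (rule borel_measurable_times[OF measurable_compose[OF m(2) c] m(2)])
    have "AE z in particle_measure n k. component n k \<psi> z = component n k \<psi>' z" using assms(3) by (simp add: ae_eq_def)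
    then show "AE z in particle_measure n k. cnj (component n k \<psi> z) * component n k \<psi> z = cnj (component n k \<psi>' z) * component n k \<psi>' z"
      by eventually_elim simp
  qed
  then show ?thesis unfolding fock_norm_def fock_inner_def by simp
qed

lemma ae_eq_refl: "ae_eq \<psi> \<psi>" by (simp add: ae_eq_def)

lemma ae_eq_cmul: "ae_eq \<psi> \<phi> \<Longrightarrow> ae_eq (\<lambda>M N. c * \<psi> M N) (\<lambda>M N. c * \<phi> M N)"
  unfolding ae_eq_def component_scale[of _ _ "\<lambda>_ _. c"] by (auto elim!: AE_mp)

lemma levy_limit_cong:
  assumes "meas \<psi>" "meas \<psi>'" "ae_eq \<psi> \<psi>'" "meas \<phi>"
  shows "levy_limit \<sigma> a b \<psi> \<phi> \<longleftrightarrow> levy_limit \<sigma> a b \<psi>' \<phi>"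
proof -
  have r: "regular_op (\<lambda>\<psi> M N. levy_sum \<sigma> a n t \<psi> M N - \<phi> M N)" for n t
  proof -
    have "regular_op (\<lambda>\<psi>. \<phi>)" using assms(4) by (simp add: regular_op_def ae_eq_refl)
    from regular_diff[OF regular_levy_sum this] show ?thesis .
  qed
  have "fock_norm (\<lambda>M N. levy_sum \<sigma> a n t \<psi> M N - \<phi> M N) = fock_norm (\<lambda>M N. levy_sum \<sigma> a n t \<psi>' M N - \<phi> M N)" for n t
    by (rule fock_norm_cong) (use r[of n t] assms in \<open>auto simp: regular_op_def\<close>)
  then show ?thesis unfolding levy_limit_def by simp
qed

text \<open>The predicates that define the two areas agree, hence so do the chosen representatives.\<close>

lemma levy_area_cong:
  assumes "meas \<psi>" "meas \<psi>'" "ae_eq \<psi> \<psi>'"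
  shows "levy_area \<sigma> a b \<psi> = levy_area \<sigma> a b \<psi>'"
proof -
  have "(\<phi> \<in> finite_particle \<and> levy_limit \<sigma> a b \<psi> \<phi>) = (\<phi> \<in> finite_particle \<and> levy_limit \<sigma> a b \<psi>' \<phi>)" for \<phi>
    using levy_limit_cong[OF assms] finite_particle_meas by blast
  then show ?thesis unfolding levy_area_def by simp
qed

lemma exists_partition:
  assumes "a < b" "\<delta> > 0" obtains n t where "is_partition a b n t" "\<forall>j<n. t (Suc j) - t j < \<delta>"
proof -
  obtain m :: nat where m: "(b - a) / \<delta> < real m" using reals_Archimedean2 by blast
  define n where "n = Suc m"
  define h where "h = (b - a) / real n"
  have h: "0 < h" "h < \<delta>" "real n * h = b - a"
  proof -
    show "0 < h" using assms by (simp add: h_def n_def)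
    have "(b - a) / \<delta> < real n" using m by (simp add: n_def)
    then have "b - a < real n * \<delta>" using assms by (simp add: field_simps)
    then show "h < \<delta>" unfolding h_def by (subst pos_divide_less_eq) (simp_all add: n_def mult.commute)
    show "real n * h = b - a" by (simp add: h_def n_def)
  qed
  show ?thesis
  proof (rule that[of n "\<lambda>j. a + real j * h"])
    show "is_partition a b n (\<lambda>j. a + real j * h)" using h by (simp add: is_partition_def algebra_simps)
    show "\<forall>j<n. (a + real (Suc j) * h) - (a + real j * h) < \<delta>" using h by (simp add: algebra_simps)
  qed
qed

text \<open>Two limits are both close to the same Levy sum, and the integral over each component is controlled by
the Fock norm.\<close>

lemma levy_limit_unique:
  assumes ab: "a < b" and S: "\<And>n t. is_partition a b n t \<Longrightarrow> levy_sum \<sigma> a n t \<psi> \<in> finite_particle"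
    and \<phi>: "\<phi> \<in> finite_particle" "levy_limit \<sigma> a b \<psi> \<phi>" and \<zeta>: "\<zeta> \<in> finite_particle" "levy_limit \<sigma> a b \<psi> \<zeta>"
  shows "ae_eq \<phi> \<zeta>"
  unfolding ae_eq_def
proof (intro allI)
  fix n k
  let ?P = "particle_measure n k"
  let ?d = "\<lambda>M N. \<phi> M N - \<zeta> M N"
  have dfp: "?d \<in> finite_particle" by (rule finite_particle_diff[OF \<phi>(1) \<zeta>(1)])
  then have di: "integrable ?P (\<lambda>z. (norm (component n k ?d z))\<^sup>2)" by (simp add: finite_particle_def)
  have "(\<integral>z. (norm (component n k ?d z))\<^sup>2 \<partial>?P) \<le> 0 + e" if e: "e > 0" for e
  proof -
    define r where "r = sqrt (e / 4)"
    have r: "r > 0" "r\<^sup>2 = e / 4" using e by (auto simp: r_def)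
    obtain d1 where d10: "d1 > 0" and d11: "\<forall>n t. is_partition a b n t \<and> (\<forall>j<n. t (Suc j) - t j < d1) \<longrightarrow> fock_norm (\<lambda>M N. levy_sum \<sigma> a n t \<psi> M N - \<phi> M N) < r"
      using \<phi>(2)[unfolded levy_limit_def, rule_format, OF r(1)] by blast
    obtain d2 where d20: "d2 > 0" and d21: "\<forall>n t. is_partition a b n t \<and> (\<forall>j<n. t (Suc j) - t j < d2) \<longrightarrow> fock_norm (\<lambda>M N. levy_sum \<sigma> a n t \<psi> M N - \<zeta> M N) < r"
      using \<zeta>(2)[unfolded levy_limit_def, rule_format, OF r(1)] by blast
    obtain l t where p: "is_partition a b l t" "\<forall>j<l. t (Suc j) - t j < min d1 d2"
      by (rule exists_partition[OF ab, of "min d1 d2"]) (use d10 d20 in auto)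
    let ?s = "levy_sum \<sigma> a l t \<psi>"
    let ?x = "\<lambda>M N. ?s M N - \<phi> M N" and ?y = "\<lambda>M N. ?s M N - \<zeta> M N"
    have fx: "?x \<in> finite_particle" and fy: "?y \<in> finite_particle"
      by (rule finite_particle_diff[OF S[OF p(1)] \<phi>(1)], rule finite_particle_diff[OF S[OF p(1)] \<zeta>(1)])
    have nx: "(fock_norm ?x)\<^sup>2 \<le> e / 4" and ny: "(fock_norm ?y)\<^sup>2 \<le> e / 4"
    proof -
      have nn: "0 \<le> fock_norm \<xi>" if xi: "\<xi> \<in> finite_particle" for \<xi>
      proof -
        obtain K where K: "\<And>M N. size M + size N > K \<Longrightarrow> \<xi> M N = 0" using xi unfolding finite_particle_def by blast
        have "fock_norm \<xi> = sqrt (\<Sum>(n,k)\<in>{..K}\<times>{..K}. \<integral>z. (norm (component n k \<xi> z))\<^sup>2 \<partial>particle_measure n k)"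
          by (rule fock_norm_finite) (rule K)
        then show ?thesis by (simp add: sum_nonneg split_def)
      qed
      have "fock_norm ?x < r" "fock_norm ?y < r"
        using d11[rule_format, of l t] d21[rule_format, of l t] p by simp_all
      then have "(fock_norm ?x)\<^sup>2 \<le> r\<^sup>2" "(fock_norm ?y)\<^sup>2 \<le> r\<^sup>2"
        using power_mono[OF less_imp_le nn[OF fx]] power_mono[OF less_imp_le nn[OF fy]] by blast+
      then show "(fock_norm ?x)\<^sup>2 \<le> e / 4" "(fock_norm ?y)\<^sup>2 \<le> e / 4" using r by simp_all
    qed
    have ix: "integrable ?P (\<lambda>z. (norm (component n k ?x z))\<^sup>2)" and iy: "integrable ?P (\<lambda>z. (norm (component n k ?y z))\<^sup>2)"
      using fx fy by (auto simp: finite_particle_def)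
    have "(\<integral>z. (norm (component n k ?d z))\<^sup>2 \<partial>?P) \<le> (\<integral>z. 2 * (norm (component n k ?y z))\<^sup>2 + 2 * (norm (component n k ?x z))\<^sup>2 \<partial>?P)"
    proof (rule integral_mono)
      show "integrable ?P (\<lambda>z. 2 * (norm (component n k ?y z))\<^sup>2 + 2 * (norm (component n k ?x z))\<^sup>2)"
        using ix iy by simp
      fix z
      have "component n k ?d z = component n k ?y z - component n k ?x z" by (simp add: component_diff)
      then show "(norm (component n k ?d z))\<^sup>2 \<le> 2 * (norm (component n k ?y z))\<^sup>2 + 2 * (norm (component n k ?x z))\<^sup>2"
        by (simp only:) (rule norm_diff_sq_le)
    qed (rule di)
    also have "\<dots> = 2 * (\<integral>z. (norm (component n k ?y z))\<^sup>2 \<partial>?P) + 2 * (\<integral>z. (norm (component n k ?x z))\<^sup>2 \<partial>?P)"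
      using ix iy by simp
    also have "\<dots> \<le> 2 * (e / 4) + 2 * (e / 4)"
      using component_integral_le_fock_norm[OF fx, of n k] component_integral_le_fock_norm[OF fy, of n k] nx ny by linarith
    finally show ?thesis by simp
  qed
  then have "(\<integral>z. (norm (component n k ?d z))\<^sup>2 \<partial>?P) \<le> 0" by (rule field_le_epsilon)
  then have "(\<integral>z. (norm (component n k ?d z))\<^sup>2 \<partial>?P) = 0" by (intro antisym) auto
  then have "AE z in ?P. (norm (component n k ?d z))\<^sup>2 = 0"
    using integral_nonneg_eq_0_iff_AE[OF di] by auto
  then show "AE z in ?P. component n k \<phi> z = component n k \<zeta> z"
    by (rule AE_mp) (auto simp: component_diff)
qed

lemma half_line_singleton: "c \<in> space half_line \<Longrightarrow> {c} \<in> null_sets half_line"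
  unfolding half_line_def by (auto simp: null_sets_def sets_restrict_space_iff emeasure_restrict_space space_restrict_space)

lemma AE_half_line_neq: "AE y in half_line. y \<noteq> c"
proof (cases "c \<in> space half_line")
  case True
  then show ?thesis using AE_not_in[OF half_line_singleton] by simp
next
  case False
  then show ?thesis by (intro AE_I2) auto
qed

lemma AE_particles_distinct:
  assumes "i < n" "j < k"
  shows "AE z in particle_measure n k. fst z i \<noteq> snd z j"
proof -
  let ?A = "Pi\<^sub>M {..<n} (\<lambda>_. half_line)" and ?B = "Pi\<^sub>M {..<k} (\<lambda>_. half_line)"
  interpret P: pair_sigma_finite ?A ?B by (rule pair_sigma_finite_particles)
  have id: "(\<lambda>x. x) \<in> borel_measurable half_line" by (rule half_line_borel_measurable) simp
  have ci: "(\<lambda>x. x i) \<in> measurable ?A half_line" by (rule measurable_component_singleton) (use assms in simp)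
  have cj: "(\<lambda>x. x j) \<in> measurable ?B half_line" by (rule measurable_component_singleton) (use assms in simp)
  have mi: "(\<lambda>z. fst z i) \<in> borel_measurable (?A \<Otimes>\<^sub>M ?B)"
    by (rule measurable_compose[OF measurable_compose[OF measurable_fst ci] id])
  have mj: "(\<lambda>z. snd z j) \<in> borel_measurable (?A \<Otimes>\<^sub>M ?B)"
    by (rule measurable_compose[OF measurable_compose[OF measurable_snd cj] id])
  have "AE z in ?A \<Otimes>\<^sub>M ?B. fst z i \<noteq> snd z j"
  proof (rule P.AE_pair_measure)
    show "{z \<in> space (?A \<Otimes>\<^sub>M ?B). fst z i \<noteq> snd z j} \<in> sets (?A \<Otimes>\<^sub>M ?B)" using mi mj by measurable
    show "AE x in ?A. AE y in ?B. fst (x, y) i \<noteq> snd (x, y) j"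
    proof (rule AE_I2)
      fix x assume x: "x \<in> space ?A"
      then have xi: "x i \<in> space half_line" using assms by (auto simp: space_PiM)
      let ?N = "Pi\<^sub>E {..<k} (\<lambda>l. if l = j then {x i} else space half_line)"
      have s: "{x i} \<in> sets half_line" using half_line_singleton[OF xi] by auto
      have "emeasure ?B ?N = (\<Prod>l<k. emeasure half_line (if l = j then {x i} else space half_line))"
        by (rule half_lines.emeasure_PiM) (use s in auto)
      also have "\<dots> = 0" using assms half_line_singleton[OF xi] by (auto simp: prod_zero_iff null_sets_def)
      finally have "?N \<in> null_sets ?B" using s by (auto simp: null_sets_def intro!: sets_PiM_I_finite)
      moreover have "{y \<in> space ?B. \<not> x i \<noteq> y j} \<subseteq> ?N" by (auto simp: space_PiM PiE_def Pi_def)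
      ultimately show "AE y in ?B. fst (x, y) i \<noteq> snd (x, y) j" by (intro AE_I'[of ?N]) auto
    qed
  qed
  then show ?thesis unfolding particle_measure_def .
qed

context levy_interval begin

lemma nice_le_to_fock:
  assumes "nice_le C K \<theta>" shows "nice_le C K (to_fock \<theta>)"
  unfolding nice_le_def
proof (intro conjI allI impI)
  show "meas (to_fock \<theta>)" unfolding to_fock_def using assms
    by (intro meas_scale[of \<theta> "\<lambda>m n. inverse (of_real (sqrt (fact m) * sqrt (fact n)))"]) (simp add: nice_le_def)
  show "norm (to_fock \<theta> M N) \<le> C" for M N
  proof -
    have "1 \<le> sqrt (fact m)" for m by (simp add: fact_ge_1)
    then have "1 \<le> sqrt (fact (size M)) * sqrt (fact (size N))" by (metis mult_mono mult_1 order_trans zero_le_one)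
    moreover have "norm (inverse (complex_of_real x)) \<le> 1" if "1 \<le> x" for x
      using that by (simp add: norm_inverse inverse_le_1_iff)
    ultimately have "norm (inverse (complex_of_real (sqrt (fact (size M)) * sqrt (fact (size N))))) \<le> 1" by blast
    then have "norm (to_fock \<theta> M N) \<le> 1 * norm (\<theta> M N)"
      unfolding to_fock_def norm_mult by (rule mult_right_mono) simp
    then show ?thesis using nice_le_norm_le[OF assms, of M N] by simp
  qed
  fix M N assume "to_fock \<theta> M N \<noteq> 0"
  then have "\<theta> M N \<noteq> 0" by (auto simp: to_fock_def)
  from nice_le_support[OF assms this] show "set_mset M \<subseteq> {a..<b}" "set_mset N \<subseteq> {a..<b}" "size M + size N \<le> K" by auto
qed

lemma nice_to_fock: "nice \<theta> \<Longrightarrow> nice (to_fock \<theta>)" unfolding nice_def by (elim exE, intro exI, rule nice_le_to_fock)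

definition config_box :: "nat \<Rightarrow> nat \<Rightarrow> ((nat \<Rightarrow> real) \<times> (nat \<Rightarrow> real)) set" where
  "config_box n k = Pi\<^sub>E {..<n} (\<lambda>_. {a..<b}) \<times> Pi\<^sub>E {..<k} (\<lambda>_. {a..<b})"

lemma config_box_sets: "config_box n k \<in> sets (particle_measure n k)"
  unfolding config_box_def particle_measure_def by (intro pair_measureI sets_PiM_I_finite) auto

lemma emeasure_config_box_finite: "emeasure (particle_measure n k) (config_box n k) < \<infinity>"
proof -
  interpret B: sigma_finite_measure "Pi\<^sub>M {..<k} (\<lambda>_. half_line)" by (rule sigma_finite_particles)
  have e: "emeasure (Pi\<^sub>M {..<n} (\<lambda>_. half_line)) (Pi\<^sub>E {..<n} (\<lambda>_. {a..<b})) < \<infinity>" for n :: nat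
    by (subst half_lines.emeasure_PiM) (auto simp: emeasure_box power_less_top_ennreal)
  show ?thesis unfolding config_box_def particle_measure_def
    by (subst B.emeasure_pair_measure_Times) (use e in \<open>auto simp: ennreal_mult_less_top intro!: sets_PiM_I_finite\<close>)
qed

lemma component_outside_config_box:
  assumes "nice_le C K \<psi>" "z \<in> space (particle_measure n k)" "z \<notin> config_box n k" shows "component n k \<psi> z = 0"
proof (rule ccontr)
  assume "component n k \<psi> z \<noteq> 0"
  then have "\<psi> (config n (fst z)) (config k (snd z)) \<noteq> 0" by (simp add: component_def split_def)
  from nice_le_support(1,2)[OF assms(1) this]
  have "\<forall>i<n. fst z i \<in> {a..<b}" "\<forall>i<k. snd z i \<in> {a..<b}" by (auto simp: config_def)
  then have "z \<in> config_box n k" using assms(2)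
    unfolding config_box_def particle_measure_def space_pair_measure space_PiM
    by (auto simp: PiE_def Pi_def mem_Times_iff)
  then show False using assms(3) by simp
qed

lemma nice_finite_particle:
  assumes "nice \<psi>" shows "\<psi> \<in> finite_particle"
proof -
  obtain C K where c: "nice_le C K \<psi>" using assms by (auto simp: nice_def)
  have m: "component n k \<psi> \<in> borel_measurable (particle_measure n k)" for n k using c by (simp add: nice_le_def meas_def)
  have "integrable (particle_measure n k) (\<lambda>z. (norm (component n k \<psi> z))\<^sup>2)" for n k
  proof (rule integrableI_bounded_set[where A="config_box n k" and B="C\<^sup>2"])
    show "(\<lambda>z. (norm (component n k \<psi> z))\<^sup>2) \<in> borel_measurable (particle_measure n k)" using m[of n k] by simp
    have "norm (component n k \<psi> z) \<le> C" for z unfolding component_def split_def by (rule nice_le_norm_le[OF c])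
    then show "AE z\<in>config_box n k in particle_measure n k. norm ((norm (component n k \<psi> z))\<^sup>2) \<le> C\<^sup>2"
      by (intro AE_I2) (simp add: power_mono)
  qed (use config_box_sets emeasure_config_box_finite component_outside_config_box[OF c] in auto)
  moreover have "\<exists>K. \<forall>M N. size M + size N > K \<longrightarrow> \<psi> M N = 0"
    using nice_le_support(3)[OF c] by (intro exI[of _ K]) (metis leD)
  ultimately show ?thesis using m unfolding finite_particle_def by blast
qed

end

section \<open>The Levy area and its moments\<close>

lemma tendsto_sum_mset:
  fixes f :: "'i \<Rightarrow> 'x \<Rightarrow> complex"
  assumes "\<forall>x\<in>#M. ((\<lambda>i. f i x) \<longlongrightarrow> L x) F"
  shows "((\<lambda>i. \<Sum>x\<in>#M. f i x) \<longlongrightarrow> (\<Sum>x\<in>#M. L x)) F"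
  using assms
proof (induction M)
  case (add x M)
  have "((\<lambda>i. f i x + (\<Sum>x\<in>#M. f i x)) \<longlongrightarrow> L x + (\<Sum>x\<in>#M. L x)) F"
    by (rule tendsto_add) (use add in auto)
  then show ?case by simp
qed simp

context levy_interval begin

lemma box_fun_le_limit_zero:
  assumes f: "\<And>i::nat. box_fun_le B (f i)" and l: "AE x in half_line. (\<lambda>i. f i x) \<longlonglongrightarrow> 0"
  shows "(\<lambda>i. \<integral>x. f i x \<partial>half_line) \<longlonglongrightarrow> 0"
proof -
  have "(\<lambda>i. \<integral>x. f i x \<partial>half_line) \<longlonglongrightarrow> (\<integral>x. 0 \<partial>half_line)"
  proof (rule integral_dominated_convergence[where w="\<lambda>x. B * indicator {a..<b} x"])
    show "integrable half_line (\<lambda>x. B * indicator {a..<b} x :: real)"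
      by (intro integrable_mult_right integrable_real_indicator) (auto simp: emeasure_box)
    show "AE x in half_line. norm (f i x) \<le> B * indicator {a..<b} x" for i
    proof (rule AE_I2)
      fix x show "norm (f i x) \<le> B * indicator {a..<b} x"
        using f[of i] by (cases "x \<in> {a..<b}") (auto simp: box_fun_le_def)
    qed
    show "(\<lambda>x. f i x) \<in> borel_measurable half_line" for i using f[of i] by (simp add: box_fun_le_def)
  qed (use l in simp_all)
  then show ?thesis by simp
qed

lemma hop_left_limit_zero:
  assumes h: "\<And>i::nat. box_kernel_le B (h i)" and l: "\<And>x y. x \<noteq> y \<Longrightarrow> (\<lambda>i. h i x y) \<longlonglongrightarrow> 0" and t: "nice_le C K \<theta>"
  shows "(\<lambda>i. hop_left (h i) \<theta> M N) \<longlonglongrightarrow> 0"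
proof -
  have "(\<lambda>i. \<integral>y. h i x y * \<theta> (add_mset y R) N \<partial>half_line) \<longlonglongrightarrow> 0" for x R
  proof (rule box_fun_le_limit_zero)
    show "box_fun_le (B * C) (\<lambda>y. h i x y * \<theta> (add_mset y R) N)" for i by (rule box_fun_le_nice_left[OF box_kernel_le_section[OF h] t])
    show "AE y in half_line. (\<lambda>i. h i x y * \<theta> (add_mset y R) N) \<longlonglongrightarrow> 0"
      using AE_half_line_neq[of x]
    proof (rule AE_mp, intro AE_I2 impI)
      fix y :: real assume "y \<noteq> x"
      then show "(\<lambda>i. h i x y * \<theta> (add_mset y R) N) \<longlonglongrightarrow> 0" by (intro tendsto_mult_left_zero l) simp
    qed
  qed
  then have "(\<lambda>i. hop_left (h i) \<theta> M N) \<longlonglongrightarrow> (\<Sum>x\<in>#M. 0)"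
    unfolding hop_left_def by (intro tendsto_sum_mset) blast
  then show ?thesis by simp
qed

lemma hop_right_limit_zero:
  assumes h: "\<And>i::nat. box_kernel_le B (h i)" and l: "\<And>x y. x \<noteq> y \<Longrightarrow> (\<lambda>i. h i x y) \<longlonglongrightarrow> 0" and t: "nice_le C K \<theta>"
  shows "(\<lambda>i. hop_right (h i) \<theta> M N) \<longlonglongrightarrow> 0"
proof -
  have "(\<lambda>i. hop_left (\<lambda>x y. h i y x) (swap2 \<theta>) N M) \<longlonglongrightarrow> 0"
    by (rule hop_left_limit_zero[OF box_kernel_le_transpose[OF h] _ nice_le_swap2[OF t]]) (rule l, simp)
  moreover have "hop_left (\<lambda>x y. h i y x) (swap2 \<theta>) N M = hop_right (h i) \<theta> M N" for i
    by (simp add: hop_left_def hop_right_def swap2_def)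
  ultimately show ?thesis by simp
qed

lemma pair_ann_limit_zero:
  assumes h: "\<And>i::nat. box_kernel_le B (h i)" and l: "\<And>x y. x \<noteq> y \<Longrightarrow> (\<lambda>i. h i x y) \<longlonglongrightarrow> 0" and t: "nice_le C K \<theta>"
  shows "(\<lambda>i. pair_ann (h i) \<theta> M N) \<longlonglongrightarrow> 0"
  unfolding pair_ann_def
proof (rule box_fun_le_limit_zero)
  show "box_fun_le (B * C * (b - a)) (\<lambda>x. \<integral>y. h i x y * \<theta> (add_mset x M) (add_mset y N) \<partial>half_line)" for i
    by (rule box_kernel_le_integral) (rule box_kernel_le_nice[OF h t])
  show "AE x in half_line. (\<lambda>i. \<integral>y. h i x y * \<theta> (add_mset x M) (add_mset y N) \<partial>half_line) \<longlonglongrightarrow> 0"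
  proof (rule AE_I2)
    fix x
    show "(\<lambda>i. \<integral>y. h i x y * \<theta> (add_mset x M) (add_mset y N) \<partial>half_line) \<longlonglongrightarrow> 0"
    proof (rule box_fun_le_limit_zero)
      show "box_fun_le (B * C) (\<lambda>y. h i x y * \<theta> (add_mset x M) (add_mset y N))" for i by (rule box_fun_le_nice_right[OF box_kernel_le_section[OF h] t])
      show "AE y in half_line. (\<lambda>i. h i x y * \<theta> (add_mset x M) (add_mset y N)) \<longlonglongrightarrow> 0"
        using AE_half_line_neq[of x]
      proof (rule AE_mp, intro AE_I2 impI)
        fix y :: real assume "y \<noteq> x"
        then show "(\<lambda>i. h i x y * \<theta> (add_mset x M) (add_mset y N)) \<longlonglongrightarrow> 0" by (intro tendsto_mult_left_zero l) simp
      qed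
    qed
  qed
qed

lemma pair_cre_limit_zero:
  assumes l: "\<And>x y. x \<noteq> y \<Longrightarrow> (\<lambda>i. h i x y) \<longlonglongrightarrow> 0" and d: "\<forall>x\<in>#M. \<forall>y\<in>#N. x \<noteq> y"
  shows "(\<lambda>i::nat. pair_cre (h i) \<theta> M N) \<longlonglongrightarrow> 0"
proof -
  have "(\<lambda>i. h i x y * c) \<longlonglongrightarrow> 0" if "x \<in># M" "y \<in># N" for x y c
    by (intro tendsto_mult_left_zero l) (use d that in blast)
  then have "(\<lambda>i. pair_cre (h i) \<theta> M N) \<longlonglongrightarrow> (\<Sum>x\<in>#M. \<Sum>y\<in>#N. 0)"
    unfolding pair_cre_def by (intro tendsto_sum_mset ballI) blast
  then show ?thesis by simp
qed

lemma levy_op_limit_zero: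
  assumes h: "\<And>i::nat. box_kernel_le B (h i)" and l: "\<And>x y. x \<noteq> y \<Longrightarrow> (\<lambda>i. h i x y) \<longlonglongrightarrow> 0" and t: "nice_le C K \<theta>"
    and d: "\<forall>x\<in>#M. \<forall>y\<in>#N. x \<noteq> y"
  shows "(\<lambda>i. levy_op \<alpha> \<beta> \<gamma> (h i) \<theta> M N) \<longlonglongrightarrow> 0"
proof -
  have "(\<lambda>i. levy_op \<alpha> \<beta> \<gamma> (h i) \<theta> M N) \<longlonglongrightarrow> \<alpha> * 0 + \<beta> * 0 + \<gamma> * (0 - 0)"
    unfolding levy_op_def
    by (intro tendsto_add tendsto_mult tendsto_diff tendsto_const hop_left_limit_zero[OF h l t] hop_right_limit_zero[OF h l t]
        pair_cre_limit_zero[OF l d] pair_ann_limit_zero[OF h l t])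
  then show ?thesis by simp
qed

lemma levy_op_uniform_bound:
  assumes t: "nice_le C K \<theta>"
  shows "\<exists>C' K'. \<forall>h. box_kernel_le B h \<longrightarrow> nice_le C' K' (levy_op \<alpha> \<beta> \<gamma> h \<theta>)"
proof (intro exI allI impI)
  fix h assume h: "box_kernel_le B h"
  have "levy_op \<alpha> \<beta> \<gamma> h \<theta> = (\<lambda>M N. (\<alpha> * hop_left h \<theta> M N + \<beta> * hop_right h \<theta> M N) + (\<gamma> * pair_cre h \<theta> M N + (-\<gamma>) * pair_ann h \<theta> M N))"
    by (simp add: levy_op_def fun_eq_iff algebra_simps)
  moreover note nice_le_add[OF nice_le_add[OF nice_le_cmul[OF nice_le_hop_left[OF h t], of \<alpha>] nice_le_cmul[OF nice_le_hop_right[OF h t], of \<beta>]]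
     nice_le_add[OF nice_le_cmul[OF nice_le_pair_cre[OF h t], of \<gamma>] nice_le_cmul[OF nice_le_pair_ann[OF h t], of "-\<gamma>"]]]
  ultimately show "nice_le
     ((norm \<alpha> * (real K * (B * C * (b - a))) + norm \<beta> * (real K * (B * C * (b - a)))) + (norm \<gamma> * (real (K + 2) * (real (K + 2) * (B * C))) + norm (-\<gamma>) * (B * C * (b - a) * (b - a))))
     (max (max K K) (max (K + 2) K)) (levy_op \<alpha> \<beta> \<gamma> h \<theta>)" by simp
qed

text \<open>Otherwise there is a sequence of kernels that concentrate on the diagonal and violate the bound. Along
it the vectors tend to zero at every configuration without a coincidence of a left and a right particle,
hence almost everywhere, and they are uniformly bounded with support in a box of finite measure.\<close>

lemma levy_op_small:
  assumes t: "nice \<theta>" and e: "\<epsilon> > 0"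
  shows "\<exists>\<delta>>0. \<forall>h. box_kernel_le 2 h \<and> (\<forall>x y. \<delta> \<le> \<bar>x - y\<bar> \<longrightarrow> h x y = 0) \<longrightarrow>
     fock_norm (to_fock (\<lambda>M N. \<i> * levy_op \<alpha> \<beta> \<gamma> h \<theta> M N)) < \<epsilon>"
proof (rule ccontr)
  assume neg: "\<not> ?thesis"
  have "\<forall>i::nat. \<exists>h. box_kernel_le 2 h \<and> (\<forall>x y. inverse (real (Suc i)) \<le> \<bar>x - y\<bar> \<longrightarrow> h x y = 0) \<and>
     \<not> fock_norm (to_fock (\<lambda>M N. \<i> * levy_op \<alpha> \<beta> \<gamma> h \<theta> M N)) < \<epsilon>"
  proof
    fix i :: nat
    have "inverse (real (Suc i)) > 0" by simp
    with neg show "\<exists>h. box_kernel_le 2 h \<and> (\<forall>x y. inverse (real (Suc i)) \<le> \<bar>x - y\<bar> \<longrightarrow> h x y = 0) \<and>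
       \<not> fock_norm (to_fock (\<lambda>M N. \<i> * levy_op \<alpha> \<beta> \<gamma> h \<theta> M N)) < \<epsilon>" by blast
  qed
  from choice[OF this] obtain h where H: "\<forall>i::nat. box_kernel_le 2 (h i) \<and> (\<forall>x y. inverse (real (Suc i)) \<le> \<bar>x - y\<bar> \<longrightarrow> h i x y = 0) \<and>
     \<not> fock_norm (to_fock (\<lambda>M N. \<i> * levy_op \<alpha> \<beta> \<gamma> (h i) \<theta> M N)) < \<epsilon>" by blast
  have h: "box_kernel_le 2 (h i)" and z: "inverse (real (Suc i)) \<le> \<bar>x - y\<bar> \<Longrightarrow> h i x y = 0"
    and bad: "\<not> fock_norm (to_fock (\<lambda>M N. \<i> * levy_op \<alpha> \<beta> \<gamma> (h i) \<theta> M N)) < \<epsilon>" for i x y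
    using H by blast+
  obtain C K where c: "nice_le C K \<theta>" using t by (auto simp: nice_def)
  obtain C' K' where "\<forall>h. box_kernel_le 2 h \<longrightarrow> nice_le C' K' (levy_op \<alpha> \<beta> \<gamma> h \<theta>)" using levy_op_uniform_bound[OF c] by blast
  then have nb: "nice_le (norm \<i> * C') K' (to_fock (\<lambda>M N. \<i> * levy_op \<alpha> \<beta> \<gamma> (h i) \<theta> M N))" for i
    using nice_le_to_fock[OF nice_le_cmul] h by blast
  define \<psi> where "\<psi> i = to_fock (\<lambda>M N. \<i> * levy_op \<alpha> \<beta> \<gamma> (h i) \<theta> M N)" for i
  have nb: "nice_le C' K' (\<psi> i)" for i using nb[of i] by (simp add: \<psi>_def)
  have l: "(\<lambda>i. h i x y) \<longlonglongrightarrow> 0" if "x \<noteq> y" for x y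
  proof (rule tendsto_eventually)
    have "0 < \<bar>x - y\<bar>" using that by simp
    then have "\<forall>\<^sub>F i in sequentially. inverse (real (Suc i)) < \<bar>x - y\<bar>"
      by (rule order_tendstoD(2)[OF LIMSEQ_inverse_real_of_nat])
    then show "\<forall>\<^sub>F i in sequentially. h i x y = 0" by eventually_elim (simp add: z)
  qed
  have pt: "(\<lambda>i. \<psi> i M N) \<longlonglongrightarrow> 0" if d: "\<forall>x\<in>#M. \<forall>y\<in>#N. x \<noteq> y" for M N
    unfolding \<psi>_def to_fock_def
    by (rule tendsto_mult_right_zero, rule tendsto_mult_right_zero, rule levy_op_limit_zero[OF h l c d])
  have int: "(\<lambda>i. \<integral>z. (norm (component n k (\<psi> i) z))\<^sup>2 \<partial>particle_measure n k) \<longlonglongrightarrow> 0" for n k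
  proof -
    have "(\<lambda>i. \<integral>z. (norm (component n k (\<psi> i) z))\<^sup>2 \<partial>particle_measure n k) \<longlonglongrightarrow> (\<integral>z. 0 \<partial>particle_measure n k)"
    proof (rule integral_dominated_convergence[where w="\<lambda>z. C'\<^sup>2 * indicator (config_box n k) z"])
      show "integrable (particle_measure n k) (\<lambda>z. C'\<^sup>2 * indicator (config_box n k) z :: real)"
        by (intro integrable_mult_right integrable_real_indicator config_box_sets emeasure_config_box_finite)
      show "(\<lambda>z. (norm (component n k (\<psi> i) z))\<^sup>2) \<in> borel_measurable (particle_measure n k)" for i
      proof -
        have "component n k (\<psi> i) \<in> borel_measurable (particle_measure n k)" using nb[of i] by (simp add: nice_le_def meas_def)
        then show ?thesis by simp
      qed
      show "AE z in particle_measure n k. norm ((norm (component n k (\<psi> i) z))\<^sup>2) \<le> C'\<^sup>2 * indicator (config_box n k) z" for i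
      proof (rule AE_I2)
        fix z assume zs: "z \<in> space (particle_measure n k)"
        have "norm (component n k (\<psi> i) z) \<le> C'" unfolding component_def split_def by (rule nice_le_norm_le[OF nb])
        then show "norm ((norm (component n k (\<psi> i) z))\<^sup>2) \<le> C'\<^sup>2 * indicator (config_box n k) z"
          using component_outside_config_box[OF nb zs, of i] by (cases "z \<in> config_box n k") (auto simp: power_mono)
      qed
      have "AE z in particle_measure n k. \<forall>i\<in>{..<n}. \<forall>j\<in>{..<k}. fst z i \<noteq> snd z j"
        by (intro AE_finite_allI AE_particles_distinct) auto
      then show "AE z in particle_measure n k. (\<lambda>i. (norm (component n k (\<psi> i) z))\<^sup>2) \<longlonglongrightarrow> 0"
      proof (rule AE_mp, intro AE_I2 impI)
        fix z :: "(nat \<Rightarrow> real) \<times> (nat \<Rightarrow> real)"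
        assume "\<forall>i\<in>{..<n}. \<forall>j\<in>{..<k}. fst z i \<noteq> snd z j"
        then have "\<forall>x\<in>#config n (fst z). \<forall>y\<in>#config k (snd z). x \<noteq> y" by (auto simp: config_def)
        then have "(\<lambda>i. component n k (\<psi> i) z) \<longlonglongrightarrow> 0" unfolding component_def split_def by (rule pt)
        then have "(\<lambda>i. (norm (component n k (\<psi> i) z))\<^sup>2) \<longlonglongrightarrow> (norm (0::complex))\<^sup>2" by (intro tendsto_power tendsto_norm)
        then show "(\<lambda>i. (norm (component n k (\<psi> i) z))\<^sup>2) \<longlonglongrightarrow> 0" by simp
      qed
    qed simp
    then show ?thesis by simp
  qed
  have fn: "fock_norm (\<psi> i) = sqrt (\<Sum>(n,k)\<in>{..K'}\<times>{..K'}. \<integral>z. (norm (component n k (\<psi> i) z))\<^sup>2 \<partial>particle_measure n k)" for i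
  proof (rule fock_norm_finite)
    fix M N :: "real multiset" assume "K' < size M + size N"
    then show "\<psi> i M N = 0" using nice_le_support(3)[OF nb[of i], of M N] by fastforce
  qed
  have "(\<lambda>i. fock_norm (\<psi> i)) \<longlonglongrightarrow> sqrt (\<Sum>(n,k)\<in>{..K'}\<times>{..K'}. 0)"
    unfolding fn split_def by (intro tendsto_real_sqrt tendsto_sum int)
  then have "(\<lambda>i. fock_norm (\<psi> i)) \<longlonglongrightarrow> 0" by simp
  then have "\<forall>\<^sub>F i in sequentially. fock_norm (\<psi> i) < \<epsilon>" using e by (rule order_tendstoD(2))
  then obtain i where "fock_norm (\<psi> i) < \<epsilon>" using eventually_happens'[OF sequentially_bot] by blast
  then show False using bad[of i] by (simp add: \<psi>_def)
qed

abbreviation area_op :: "real \<Rightarrow> (real \<Rightarrow> real \<Rightarrow> complex) \<Rightarrow> fock2 \<Rightarrow> fock2" where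
  "area_op \<sigma> k \<theta> \<equiv> (\<lambda>M N. \<i> * levy_op (of_real (c_plus \<sigma> ^ 2)) (of_real (c_minus \<sigma> ^ 2)) (of_real (c_plus \<sigma> * c_minus \<sigma>)) k \<theta> M N)"

lemma nice_area_op: "box_kernel k \<Longrightarrow> nice \<theta> \<Longrightarrow> nice (area_op \<sigma> k \<theta>)"
  by (intro nice_cmul nice_linear_nice[OF nice_linear_levy_op])

lemma levy_limit_to_fock:
  assumes t: "nice \<theta>"
  shows "levy_limit \<sigma> a b (to_fock \<theta>) (to_fock (area_op \<sigma> sgn_kernel \<theta>))"
  unfolding levy_limit_def
proof (intro allI impI)
  fix \<epsilon> :: real assume "\<epsilon> > 0"
  from levy_op_small[OF t this] obtain \<delta> where \<delta>: "\<delta> > 0"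
    and s: "\<And>h. box_kernel_le 2 h \<Longrightarrow> \<forall>x y. \<delta> \<le> \<bar>x - y\<bar> \<longrightarrow> h x y = 0 \<Longrightarrow> fock_norm (to_fock (area_op \<sigma> h \<theta>)) < \<epsilon>" by blast
  show "\<exists>\<delta>>0. \<forall>n t. is_partition a b n t \<and> (\<forall>j<n. t (Suc j) - t j < \<delta>) \<longrightarrow>
     fock_norm (\<lambda>M N. levy_sum \<sigma> a n t (to_fock \<theta>) M N - to_fock (area_op \<sigma> sgn_kernel \<theta>) M N) < \<epsilon>"
  proof (intro exI conjI allI impI)
    fix n t assume p: "is_partition a b n t \<and> (\<forall>j<n. t (Suc j) - t j < \<delta>)"
    let ?h = "\<lambda>x y. step_kernel n t x y - sgn_kernel x y"
    have "(\<lambda>M N. levy_sum \<sigma> a n t (to_fock \<theta>) M N - to_fock (area_op \<sigma> sgn_kernel \<theta>) M N) = to_fock (area_op \<sigma> ?h \<theta>)"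
      unfolding levy_sum_to_fock[OF conjunct1[OF p] t] levy_op_kdiff[OF box_kernel_step_kernel[OF conjunct1[OF p]] box_kernel_sgn_kernel t]
      by (simp add: to_fock_def fun_eq_iff algebra_simps)
    moreover have "fock_norm (to_fock (area_op \<sigma> ?h \<theta>)) < \<epsilon>"
      by (rule s) (use step_kernel_near[OF conjunct1[OF p] conjunct2[OF p]] in blast)+
    ultimately show "fock_norm (\<lambda>M N. levy_sum \<sigma> a n t (to_fock \<theta>) M N - to_fock (area_op \<sigma> sgn_kernel \<theta>) M N) < \<epsilon>" by simp
  qed (rule \<delta>)
qed

lemma levy_area_to_fock:
  assumes t: "nice \<theta>"
  shows "levy_area \<sigma> a b (to_fock \<theta>) \<in> finite_particle"
    and "ae_eq (levy_area \<sigma> a b (to_fock \<theta>)) (to_fock (area_op \<sigma> sgn_kernel \<theta>))"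
proof -
  let ?\<phi> = "to_fock (area_op \<sigma> sgn_kernel \<theta>)" and ?l = "levy_area \<sigma> a b (to_fock \<theta>)"
  have f: "?\<phi> \<in> finite_particle" by (intro nice_finite_particle nice_to_fock nice_area_op box_kernel_sgn_kernel t)
  have l: "?l \<in> finite_particle \<and> levy_limit \<sigma> a b (to_fock \<theta>) ?l"
    unfolding levy_area_def by (rule someI[of _ ?\<phi>]) (use f levy_limit_to_fock[OF t] in blast)
  then show "?l \<in> finite_particle" by blast
  show "ae_eq ?l ?\<phi>"
  proof (rule levy_limit_unique[OF a_less_b _ _ _ f levy_limit_to_fock[OF t]])
    show "levy_sum \<sigma> a n u (to_fock \<theta>) \<in> finite_particle" if "is_partition a b n u" for n u
      unfolding levy_sum_to_fock[OF that t] by (intro nice_finite_particle nice_to_fock nice_area_op box_kernel_step_kernel that t)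
  qed (use l in blast)+
qed

end

lemma emeasure_particle_0: "emeasure (particle_measure 0 0) (space (particle_measure 0 0)) = 1"
proof -
  interpret B: sigma_finite_measure "Pi\<^sub>M {..<0::nat} (\<lambda>_. half_line)" by (rule sigma_finite_particles)
  have "emeasure (Pi\<^sub>M {} (\<lambda>_::nat. half_line)) {\<lambda>_. undefined} = 1" by simp
  then show ?thesis unfolding particle_measure_def space_pair_measure
    by (subst B.emeasure_pair_measure_Times) (simp_all add: space_PiM sets_PiM_empty)
qed

lemma component_0: "component 0 0 \<psi> z = \<psi> {#} {#}"
  by (simp add: component_def config_def split_def)

lemma ae_eq_vacuum_component:
  assumes "ae_eq \<psi> \<phi>" shows "\<psi> {#} {#} = \<phi> {#} {#}"
proof (rule ccontr)
  assume ne: "\<psi> {#} {#} \<noteq> \<phi> {#} {#}"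
  have "AE z in particle_measure 0 0. component 0 0 \<psi> z = component 0 0 \<phi> z" using assms by (simp add: ae_eq_def)
  then have "AE z in particle_measure 0 0. False" using ne by (simp add: component_0)
  then have "emeasure (particle_measure 0 0) (space (particle_measure 0 0)) = 0"
    by (subst (asm) AE_iff_measurable[OF sets.top]) auto
  then show False by (simp add: emeasure_particle_0)
qed

lemma vacuum_expectation_eq: "vacuum_expectation X = X vacuum {#} {#}"
proof -
  let ?f = "\<lambda>(n, k). \<integral>z. cnj (component n k vacuum z) * component n k (X vacuum) z \<partial>particle_measure n k"
  have "?f p = 0" if "p \<noteq> (0,0)" for p
  proof -
    obtain n k where p: "p = (n,k)" by (cases p)
    have "component n k vacuum z = 0" for z
    proof -
      have "config n x = {#} \<longleftrightarrow> n = 0" for n x by (metis size_config size_eq_0_iff_empty)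
      then show ?thesis using that p by (auto simp: component_def split_def vacuum_def)
    qed
    then show ?thesis using p by simp
  qed
  then have "infsum ?f UNIV = infsum ?f {(0,0)}" by (intro infsum_cong_neutral) auto
  also have "\<dots> = ?f (0,0)" by (subst infsum_finite) simp_all
  also have "\<dots> = X vacuum {#} {#}"
    by (simp add: component_0 measure_def emeasure_particle_0) (simp add: vacuum_def)
  finally show ?thesis unfolding vacuum_expectation_def fock_inner_def .
qed

context levy_interval begin

text \<open>By induction on the power: the area of the previous power is the area of its explicit nice
representative, on which the limit of the Levy sums is known.\<close>

lemma normalized_levy_area_power:
  assumes \<sigma>: "\<sigma> > 1"
  defines "\<alpha> \<equiv> complex_of_real (c_plus \<sigma> ^ 2 / \<sigma>\<^sup>2)" and "\<beta> \<equiv> complex_of_real (c_minus \<sigma> ^ 2 / \<sigma>\<^sup>2)"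
    and "g \<equiv> c_plus \<sigma> * c_minus \<sigma> / \<sigma>\<^sup>2"
  shows "\<alpha> + \<beta> = 1"
    and "meas ((normalized_levy_area \<sigma> a b ^^ k) vacuum)"
    and "ae_eq ((normalized_levy_area \<sigma> a b ^^ k) vacuum) (to_fock (\<lambda>M N. \<i> ^ k * fact k * taylor \<alpha> \<beta> g k M N))"
proof -
  have s2: "\<sigma>\<^sup>2 > 1" using \<sigma> by (simp add: one_less_power)
  have "c_plus \<sigma> ^ 2 = (\<sigma>\<^sup>2 + 1) / 2" "c_minus \<sigma> ^ 2 = (\<sigma>\<^sup>2 - 1) / 2"
    unfolding c_plus_def c_minus_def using s2 by simp_all
  then have "c_plus \<sigma> ^ 2 + c_minus \<sigma> ^ 2 = \<sigma>\<^sup>2" by simp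
  then have "c_plus \<sigma> ^ 2 / \<sigma>\<^sup>2 + c_minus \<sigma> ^ 2 / \<sigma>\<^sup>2 = 1" using \<sigma> by (simp add: add_divide_distrib[symmetric])
  then show ab: "\<alpha> + \<beta> = 1" unfolding \<alpha>_def \<beta>_def of_real_add[symmetric] by simp
  interpret levy_recursion a b \<alpha> \<beta> g by unfold_locales (rule ab)
  let ?\<theta> = "\<lambda>k M N. \<i> ^ k * fact k * taylor \<alpha> \<beta> g k M N"
  have nice: "nice (?\<theta> k)" for k by (intro nice_cmul nice_w)
  have step: "to_fock (area_op \<sigma> sgn_kernel (?\<theta> k)) M N / of_real (\<sigma>\<^sup>2) = to_fock (?\<theta> (Suc k)) M N" for k M N
  proof -
    have "levy_op (of_real (c_plus \<sigma> ^ 2)) (of_real (c_minus \<sigma> ^ 2)) (of_real (c_plus \<sigma> * c_minus \<sigma>)) sgn_kernel (?\<theta> k) M N / of_real (\<sigma>\<^sup>2)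
       = D (?\<theta> k) M N"
      unfolding levy_op_def \<alpha>_def \<beta>_def g_def of_real_divide by (simp only: add_divide_distrib times_divide_eq_left)
    also have "\<dots> = \<i> ^ k * fact k * (of_nat (Suc k) * taylor \<alpha> \<beta> g (Suc k) M N)"
      unfolding nice_linear_cmul[OF nice_linear_D nice_w] D_w ..
    finally have *: "levy_op (of_real (c_plus \<sigma> ^ 2)) (of_real (c_minus \<sigma> ^ 2)) (of_real (c_plus \<sigma> * c_minus \<sigma>)) sgn_kernel (?\<theta> k) M N / of_real (\<sigma>\<^sup>2)
       = \<i> ^ k * fact k * (of_nat (Suc k) * taylor \<alpha> \<beta> g (Suc k) M N)" .
    have **: "c * (\<i> * x) / y = c * (\<i> * (x / y))" for c x y :: complex by simp
    show ?thesis unfolding to_fock_def ** * power_Suc fact_Suc[of k] by (simp only: mult_ac)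
  qed
  have "meas ((normalized_levy_area \<sigma> a b ^^ k) vacuum) \<and> ae_eq ((normalized_levy_area \<sigma> a b ^^ k) vacuum) (to_fock (?\<theta> k))" for k
  proof (induction k)
    case 0
    have "to_fock (?\<theta> 0) = vacuum" by (auto simp: to_fock_def vacuum_def fun_eq_iff)
    then show ?case using nice_le_vacuum by (simp add: ae_eq_refl nice_le_def)
  next
    case (Suc k)
    let ?\<psi> = "(normalized_levy_area \<sigma> a b ^^ k) vacuum"
    have "meas (to_fock (?\<theta> k))" by (intro finite_particle_meas nice_finite_particle nice_to_fock nice)
    then have eq: "levy_area \<sigma> a b ?\<psi> = levy_area \<sigma> a b (to_fock (?\<theta> k))" using Suc levy_area_cong by blast
    have n: "(normalized_levy_area \<sigma> a b ^^ Suc k) vacuum = (\<lambda>M N. inverse (of_real (\<sigma>\<^sup>2)) * levy_area \<sigma> a b (to_fock (?\<theta> k)) M N)"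
      by (simp add: normalized_levy_area_def eq divide_inverse mult.commute)
    have s: "to_fock (?\<theta> (Suc k)) = (\<lambda>M N. inverse (of_real (\<sigma>\<^sup>2)) * to_fock (area_op \<sigma> sgn_kernel (?\<theta> k)) M N)"
      unfolding fun_eq_iff step[symmetric] by (simp add: divide_inverse mult.commute)
    show ?case unfolding n s
      by (intro conjI meas_cmul ae_eq_cmul finite_particle_meas levy_area_to_fock nice)
  qed
  then show "meas ((normalized_levy_area \<sigma> a b ^^ k) vacuum)"
    "ae_eq ((normalized_levy_area \<sigma> a b ^^ k) vacuum) (to_fock (?\<theta> k))" by blast+
qed

lemma levy_moment:
  assumes \<sigma>: "\<sigma> > 1"
  shows "vacuum_expectation (normalized_levy_area \<sigma> a b ^^ (2 * m)) =
    of_real ((-1) ^ m * fact (2 * m) * vac_moment (\<lambda>j. - (b - a) * fps_nth (tanh_series (b - a)) (j - 1)) (c_plus \<sigma> * c_minus \<sigma> / \<sigma>\<^sup>2) (2 * m))"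
proof -
  let ?\<alpha> = "complex_of_real (c_plus \<sigma> ^ 2 / \<sigma>\<^sup>2)" and ?\<beta> = "complex_of_real (c_minus \<sigma> ^ 2 / \<sigma>\<^sup>2)" and ?g = "c_plus \<sigma> * c_minus \<sigma> / \<sigma>\<^sup>2"
  interpret levy_recursion a b ?\<alpha> ?\<beta> ?g by unfold_locales (rule normalized_levy_area_power(1)[OF \<sigma>])
  have "vacuum_expectation (normalized_levy_area \<sigma> a b ^^ (2 * m)) = to_fock (\<lambda>M N. \<i> ^ (2 * m) * fact (2 * m) * w (2 * m) M N) {#} {#}"
    unfolding vacuum_expectation_eq by (rule ae_eq_vacuum_component[OF normalized_levy_area_power(3)[OF \<sigma>]])
  also have "\<dots> = \<i> ^ (2 * m) * fact (2 * m) * w (2 * m) {#} {#}" by (simp add: to_fock_def)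
  also have "\<i> ^ (2 * m) = of_real ((-1) ^ m)" by (simp add: power_mult)
  finally show ?thesis unfolding taylor_vacuum_component by (simp del: vac_moment.simps)
qed

end

lemma coupling_limit: "((\<lambda>\<sigma>. c_plus \<sigma> * c_minus \<sigma> / \<sigma>\<^sup>2) \<longlongrightarrow> 1/2) at_top"
proof -
  have "((\<lambda>\<sigma>::real. inverse (\<sigma>\<^sup>2)) \<longlongrightarrow> 0) at_top"
    by (rule tendsto_inverse_0_at_top) (rule filterlim_pow_at_top, simp, rule filterlim_ident)
  then have "((\<lambda>\<sigma>::real. sqrt ((1 + inverse (\<sigma>\<^sup>2)) / 2) * sqrt ((1 - inverse (\<sigma>\<^sup>2)) / 2)) \<longlongrightarrow> sqrt ((1 + 0) / 2) * sqrt ((1 - 0) / 2)) at_top"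
    by (intro tendsto_mult tendsto_real_sqrt tendsto_divide tendsto_add tendsto_diff tendsto_const) auto
  moreover have "\<forall>\<^sub>F \<sigma> in at_top. sqrt ((1 + inverse (\<sigma>\<^sup>2)) / 2) * sqrt ((1 - inverse (\<sigma>\<^sup>2)) / 2) = c_plus \<sigma> * c_minus \<sigma> / \<sigma>\<^sup>2"
    using eventually_gt_at_top[of 1]
  proof eventually_elim
    fix \<sigma> :: real assume s: "1 < \<sigma>"
    have 1: "(1 + inverse (\<sigma>\<^sup>2)) / 2 = ((\<sigma>\<^sup>2 + 1) / 2) / \<sigma>\<^sup>2" "(1 - inverse (\<sigma>\<^sup>2)) / 2 = ((\<sigma>\<^sup>2 - 1) / 2) / \<sigma>\<^sup>2"
      using s by (simp_all add: field_simps)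
    show "sqrt ((1 + inverse (\<sigma>\<^sup>2)) / 2) * sqrt ((1 - inverse (\<sigma>\<^sup>2)) / 2) = c_plus \<sigma> * c_minus \<sigma> / \<sigma>\<^sup>2"
      unfolding 1 real_sqrt_divide[of _ "\<sigma>\<^sup>2"] c_plus_def c_minus_def using s by (simp add: power2_eq_square)
  qed
  ultimately have "((\<lambda>\<sigma>. c_plus \<sigma> * c_minus \<sigma> / \<sigma>\<^sup>2) \<longlongrightarrow> sqrt ((1 + 0) / 2) * sqrt ((1 - 0) / 2)) at_top"
    by (rule Lim_transform_eventually)
  then show ?thesis by simp
qed

theorem mainTheorem2:
  fixes a b :: real and m :: nat
  assumes "0 \<le> a" and "a < b" and "m \<ge> 1"
  shows "((\<lambda>\<sigma>::real. vacuum_expectation (normalized_levy_area \<sigma> a b ^^ (2 * m)))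
           \<longlongrightarrow> complex_of_real (((b - a) / 2) ^ (2 * m) * real (zigzag (2 * m)))) at_top"
proof -
  interpret levy_interval a b by unfold_locales (use assms in auto)
  let ?\<tau> = "\<lambda>j. - (b - a) * fps_nth (tanh_series (b - a)) (j - 1)"
  let ?g = "\<lambda>\<sigma>. c_plus \<sigma> * c_minus \<sigma> / \<sigma>\<^sup>2"
  have "((\<lambda>\<sigma>. vac_moment ?\<tau> (?g \<sigma>) (2 * m)) \<longlongrightarrow> vac_moment ?\<tau> (1/2) (2 * m)) at_top"
    by (rule isCont_tendsto_compose[OF isCont_vac_moment coupling_limit])
  then have lim: "((\<lambda>\<sigma>. complex_of_real ((-1) ^ m * fact (2 * m) * vac_moment ?\<tau> (?g \<sigma>) (2 * m)))
     \<longlongrightarrow> of_real ((-1) ^ m * fact (2 * m) * vac_moment ?\<tau> (1/2) (2 * m))) at_top"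
    by (intro tendsto_of_real tendsto_mult tendsto_const)
  have val: "(-1) ^ m * fact (2 * m) * vac_moment ?\<tau> (1/2) (2 * m) = ((b - a) / 2) ^ (2 * m) * real (zigzag (2 * m))"
  proof -
    have "vac_moment ?\<tau> (1/2) (2 * m) = (-1) ^ m * ((b - a) / 2) ^ (2 * m) * real (zigzag (2 * m)) / fact (2 * m)"
      by (subst vac_moment_half[where L="b - a"]) simp_all
    then have "(-1) ^ m * fact (2 * m) * vac_moment ?\<tau> (1/2) (2 * m)
      = ((-1) ^ m * (-1) ^ m) * (((b - a) / 2) ^ (2 * m) * real (zigzag (2 * m)))" by simp
    also have "(-1::real) ^ m * (-1) ^ m = 1" by (simp add: power_mult_distrib[symmetric])
    finally show ?thesis by simp
  qed
  show ?thesis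
  proof (rule Lim_transform_eventually[OF lim[unfolded val]])
    show "\<forall>\<^sub>F \<sigma> in at_top. complex_of_real ((-1) ^ m * fact (2 * m) * vac_moment ?\<tau> (?g \<sigma>) (2 * m)) = vacuum_expectation (normalized_levy_area \<sigma> a b ^^ (2 * m))"
      using eventually_gt_at_top[of 1] by eventually_elim (rule levy_moment[symmetric])
  qed
qed

end
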